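(* Let $K$ and $L$ be convex bodies in $\mathbb{R}^n$, let $M\subseteq\mathbb{R}^2$ be compact, convex and contained in the positive orthant, and let $1\le j\le n$. Let $N_1,N_2$ be positive integers. Let $X_1,\dots,X_{N_1+N_2}$ be independent random vectors with $X_1,\dots,X_{N_1}$ uniformly distributed in $K$ and $X_{N_1+1},\dots,X_{N_1+N_2}$ uniformly distributed in $L$, and let $X_1^*,\dots,X_{N_1+N_2}^*$ be independent random vectors with $X_1^*,\dots,X_{N_1}^*$ uniformly distributed in $r_KB$ and $X_{N_1+1}^*,\dots,X_{N_1+N_2}^*$ uniformly distributed in $r_LB$. Set $K_{N_1}=\mathrm{conv}\{X_1,\dots,X_{N_1}\}$, $L_{N_2}=\mathrm{conv}\{X_{N_1+1},\dots,X_{N_1+N_2}\}$, $(r_KB)_{N_1}=\mathrm{conv}\{X_1^*,\dots,X_{N_1}^*\}$ and $(r_LB)_{N_2}=\mathrm{conv}\{X_{N_1+1}^*,\dots,X_{N_1+N_2}^*\}$. Then for every $\alpha>0$, $$\mathbb{P}\big(V_j(K_{N_1}\oplus_M L_{N_2})>\alpha\big)\ \ge\ \mathbb{P}\big(V_j((r_KB)_{N_1}\oplus_M (r_LB)_{N_2})>\alpha\big).$$ Moreover, $$V_j(K\oplus_M L)\ \ge\ V_j(r_KB\oplus_M r_LB).$$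
   Context: A convex body is a compact convex set with non-empty interior. $B$ is the Euclidean unit ball in $\mathbb{R}^n$, $V_n$ is volume, and $r_K=(V_n(K)/V_n(B))^{1/n}$ is the radius of a Euclidean ball with the same volume as $K$ (similarly $r_L$). The positive orthant of $\mathbb{R}^2$ is $[0,\infty)^2$. For $M\subseteq\mathbb{R}^2$ and $K,L\subseteq\mathbb{R}^n$, the $M$-combination is $K\oplus_M L=\{a_1x+a_2y: x\in K,\ y\in L,\ (a_1,a_2)\in M\}$ (for $M$ convex in the positive orthant and $K,L$ convex, this set is convex). $V_j$ denotes the $j$-th intrinsic volume of compact convex sets in $\mathbb{R}^n$, defined by the Steiner formula $V_n(K+\varepsilon B)=\sum_{j=0}^n\omega_{n-j}V_j(K)\varepsilon^{n-j}$ for $\varepsilon>0$, where $\omega_k$ is the volume of the Euclidean unit ball in $\mathbb{R}^k$. *)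

theory Defs
  imports "HOL-Probability.Probability"
begin

definition convex_body :: "(real ^ 'n) set \<Rightarrow> bool" where
  "convex_body K \<longleftrightarrow> compact K \<and> convex K \<and> interior K \<noteq> {}"

text \<open>The radius of a Euclidean ball with the same volume as \<open>K\<close>.\<close>

definition vol_radius :: "(real ^ 'n) set \<Rightarrow> real" where
  "vol_radius K =
     root CARD('n) (measure lborel K / measure lborel (cball (0 :: real ^ 'n) 1))"

definition M_combination ::
  "(real \<times> real) set \<Rightarrow> (real ^ 'n) set \<Rightarrow> (real ^ 'n) set \<Rightarrow> (real ^ 'n) set" where
  "M_combination M K L =
     {a1 *\<^sub>R x + a2 *\<^sub>R y | a1 a2 x y. x \<in> K \<and> y \<in> L \<and> (a1, a2) \<in> M}"

text \<open>
  \<open>v\<close> is the coefficient sequence in the Steiner formula of \<open>K\<close>; \<open>+\<close> on sets is the Minkowski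
  sum and \<open>unit_ball_vol (real k)\<close> is the volume of the unit ball in dimension \<open>k\<close>. Indices
  beyond the dimension do not occur in the formula; they are set to 0 so that \<open>v\<close> is unique.
\<close>

definition steiner_coeffs :: "(real ^ 'n) set \<Rightarrow> (nat \<Rightarrow> real) \<Rightarrow> bool" where
  "steiner_coeffs K v \<longleftrightarrow>
     (\<forall>\<epsilon>>0. measure lborel (K + (*\<^sub>R) \<epsilon> ` cball 0 1) =
        (\<Sum>j=0..CARD('n). unit_ball_vol (real (CARD('n) - j)) * v j * \<epsilon> ^ (CARD('n) - j))) \<and>
     (\<forall>j>CARD('n). v j = 0)"

definition intrinsic_volume :: "nat \<Rightarrow> (real ^ 'n) set \<Rightarrow> real" where
  "intrinsic_volume j K = (THE v. steiner_coeffs K v) j"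

lemma steiner_coeffs_unique:
  fixes K :: "(real ^ 'n) set"
  assumes v: "steiner_coeffs K v" and w: "steiner_coeffs K w"
  shows "v = w"
proof -
  let ?n = "CARD('n)"
  define d where "d k = unit_ball_vol (real k) * (v (?n - k) - w (?n - k))" for k
  have rev: "(\<Sum>j=0..?n. unit_ball_vol (real (?n - j)) * u j * e ^ (?n - j)) =
      (\<Sum>k\<le>?n. unit_ball_vol (real k) * u (?n - k) * e ^ k)" for u :: "nat \<Rightarrow> real" and e
    by (rule sum.reindex_bij_witness[where i = "\<lambda>k. ?n - k" and j = "\<lambda>k. ?n - k"]) auto
  have "(\<Sum>k\<le>?n. d k * e ^ k) = 0" if "e > 0" for e
  proof -
    have "(\<Sum>k\<le>?n. unit_ball_vol (real k) * v (?n - k) * e ^ k) =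
        (\<Sum>k\<le>?n. unit_ball_vol (real k) * w (?n - k) * e ^ k)"
      unfolding rev[symmetric] using v w that by (auto simp add: steiner_coeffs_def simp del: of_nat_diff)
    then show ?thesis
      by (simp add: d_def algebra_simps sum_subtractf)
  qed
  then have "{0<..} \<subseteq> {e. (\<Sum>k\<le>?n. d k * e ^ k) = 0}"
    by auto
  then have "infinite {e. (\<Sum>k\<le>?n. d k * e ^ k) = 0}"
    by (rule infinite_super) (rule infinite_Ioi)
  then have d0: "d k = 0" if "k \<le> ?n" for k
    using polyfun_finite_roots[of d ?n] that by blast
  show ?thesis
  proof
    fix j
    show "v j = w j"
    proof (cases "j \<le> ?n")
      case True
      have "unit_ball_vol (real (?n - j)) \<noteq> 0"
        by (rule less_imp_neq[THEN not_sym]) (rule unit_ball_vol_pos, rule of_nat_0_le_iff)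
      then show ?thesis
        using d0[of "?n - j"] True unfolding d_def by (simp del: of_nat_diff)
    next
      case False
      then show ?thesis
        using v w by (simp add: steiner_coeffs_def)
    qed
  qed
qed

definition uniform_rv :: "'w measure \<Rightarrow> ('w \<Rightarrow> real ^ 'n) \<Rightarrow> (real ^ 'n) set \<Rightarrow> bool" where
  "uniform_rv \<Omega> X A \<longleftrightarrow> X \<in> borel_measurable \<Omega> \<and> distr \<Omega> borel X = uniform_measure lborel A"

definition indep_uniform_sample ::
  "'w measure \<Rightarrow> (nat \<Rightarrow> 'w \<Rightarrow> real ^ 'n) \<Rightarrow> nat \<Rightarrow> (real ^ 'n) set \<Rightarrow> nat \<Rightarrow> (real ^ 'n) set \<Rightarrow> bool"
  where
  "indep_uniform_sample \<Omega> X N1 K N2 L \<longleftrightarrow>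
     prob_space \<Omega> \<and>
     prob_space.indep_vars \<Omega> (\<lambda>_. borel) X {1..N1 + N2} \<and>
     (\<forall>i\<in>{1..N1}. uniform_rv \<Omega> (X i) K) \<and>
     (\<forall>i\<in>{N1 + 1..N1 + N2}. uniform_rv \<Omega> (X i) L)"

text \<open>The convex hull of the points \<open>X\<^sub>i(w)\<close> with \<open>i \<in> I\<close>.\<close>

definition random_hull :: "(nat \<Rightarrow> 'w \<Rightarrow> real ^ 'n) \<Rightarrow> nat set \<Rightarrow> 'w \<Rightarrow> (real ^ 'n) set" where
  "random_hull X I w = convex hull ((\<lambda>i. X i w) ` I)"

end

theory Submission
  imports Defs
begin

text \<open>
  Along a shadow system in direction \<open>u\<close> the chords parallel to \<open>u\<close> have convex length, so the volume is
  convex. The volume of \<open>K + [-s v, s v]\<close> is affine in \<open>s\<close>, so its slope in \<open>s\<close> is again monotone and convex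
  along shadow systems. Iterating this, so are all coefficients of the volume of \<open>K + s Z\<close> for a zonotope
  \<open>Z\<close>; letting \<open>Z\<close> tend to the ball yields the Steiner formula together with the same properties of the
  intrinsic volumes.

  Let \<open>G\<close> be the set of tuples of points for which the intrinsic volume of the \<open>M\<close>-combination of the hulls
  is at most \<open>\<alpha>\<close>. If all points move on lines parallel to \<open>u\<close>, the section of \<open>G\<close> is
  convex and symmetric, and the Prekopa-Leindler inequality shows that Steiner symmetrization of the bodies
  does not decrease the measure of \<open>G\<close> within their product. No compactness argument
  is needed to reach balls: if a body \<open>A\<close> with the volume of a ball \<open>B\<close> satisfies \<open>|A - B| = m\<close>, then some
  translation by a vector \<open>w\<close> moves a part of \<open>B - A\<close> of measure at least \<open>c m\<^sup>2\<close> into \<open>A - B\<close>, and symmetrization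
  in the direction of \<open>w\<close> decreases \<open>m\<close> by that much. This gives the first claim.

  The second claim follows from the first: if the intrinsic volume for \<open>K\<close> and \<open>L\<close> were smaller than the one
  for the balls, then random points near sufficiently fine nets of the balls would exceed, with
  positive probability, a value that points of \<open>K\<close> and \<open>L\<close> never exceed.
\<close>

section \<open>The Prekopa-Leindler inequality and integration along lines\<close>

text \<open>\<open>intrinsic_volume\<close> is a definite description, so nothing is known about it
  before the Steiner formula is proved for every nonempty compact convex set. Solving that formula
  for its coefficients by interpolation gives combinations of volumes with weights of varying sign,
  from which neither monotonicity nor convexity along shadow systems can be read off. This is why
  the ball is approached by zonotopes: there a coefficient is an iterated difference of volumes, and
  every difference, being the slope of an affine function, keeps both properties. Interpolation
  still serves to pass to the limit, and for measurability and invariance.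

  Prekopa-Leindler is needed only with equal weights: on a line it is applied to the indicator of
  the section and to its mirror image. These have equal integrals, so the square of one integral is
  bounded by the square of the integral for the symmetral. Reflections also take the place of
  rotations: they show that the support function of the average of all segments
  \<open>[-v, v]\<close> with \<open>v\<close> in the ball is constant on the sphere, which yields
  zonotopes close to the ball.\<close>

lemma emeasure_lborel_vimage_affine:
  fixes A :: "'a::euclidean_space set"
  assumes "A \<in> sets borel" "c \<noteq> 0"
  shows "emeasure lborel A = ennreal (\<bar>c\<bar> ^ DIM('a)) * emeasure lborel {x. t + c *\<^sub>R x \<in> A}"
proof -
  have [measurable]: "A \<in> sets borel" by fact
  have "emeasure lborel A = emeasure (density (distr lborel borel (\<lambda>x. t + c *\<^sub>R x)) (\<lambda>_. \<bar>c\<bar>^DIM('a))) A"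
    using lborel_affine[OF assms(2), of t] by simp
  also have "\<dots> = ennreal (\<bar>c\<bar> ^ DIM('a)) * emeasure (distr lborel borel (\<lambda>x. t + c *\<^sub>R x)) A"
    using assms(1) by (simp add: emeasure_density nn_integral_cmult_indicator)
  also have "emeasure (distr lborel borel (\<lambda>x. t + c *\<^sub>R x)) A = emeasure lborel {x. t + c *\<^sub>R x \<in> A}"
    using assms(1) by (subst emeasure_distr) (auto simp: vimage_def)
  finally show ?thesis .
qed

text \<open>For \<open>a\<close> near \<open>Sup A\<close> and \<open>b\<close> near \<open>Inf B\<close> the sets \<open>A + b\<close> and \<open>a + B\<close> almost do not overlap.\<close>

lemma emeasure_level_sets_midpoint:
  fixes A B H :: "real set"
  assumes [measurable]: "A \<in> sets borel" "B \<in> sets borel" "H \<in> sets borel"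
    and ne: "A \<noteq> {}" "B \<noteq> {}" and bd: "bounded A" "bounded B"
    and mid: "\<And>a b. a \<in> A \<Longrightarrow> b \<in> B \<Longrightarrow> (a + b) / 2 \<in> H"
  shows "emeasure lborel A + emeasure lborel B \<le> 2 * emeasure lborel H"
proof (rule ennreal_le_epsilon)
  fix e :: real assume e: "e > 0"
  define s where "s = Sup A" define l where "l = Inf B"
  have sA: "a \<le> s" if "a \<in> A" for a
    unfolding s_def using bd(1) that by (intro cSup_upper) (auto dest: bounded_imp_bdd_above)
  have lB: "l \<le> b" if "b \<in> B" for b
    unfolding l_def using bd(2) that by (intro cInf_lower) (auto dest: bounded_imp_bdd_below)
  obtain a0 where a0: "a0 \<in> A" "s - e/2 < a0"
    using less_cSupD[of A "s - e/2"] ne(1) e unfolding s_def by auto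
  obtain b0 where b0: "b0 \<in> B" "b0 < l + e/2"
    using cInf_lessD[of B "l + e/2"] ne(2) e unfolding l_def by auto
  define A' where "A' = {x. - b0 + 1 *\<^sub>R x \<in> A}"
  define B' where "B' = {x. - a0 + 1 *\<^sub>R x \<in> B}"
  define H' where "H' = {x. 0 + (1/2) *\<^sub>R x \<in> H}"
  have [measurable]: "A' \<in> sets borel" "B' \<in> sets borel" "H' \<in> sets borel"
    unfolding A'_def B'_def H'_def by measurable
  \<comment> \<open>\<open>A'\<close> is \<open>A + b0\<close>, \<open>B'\<close> is
    \<open>a0 + B\<close> and \<open>H'\<close> is \<open>2 H\<close>; every sum of a point of
    \<open>A\<close> and a point of \<open>B\<close> is twice a midpoint.\<close>
  have "A' \<union> B' \<subseteq> H'"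
    unfolding A'_def B'_def H'_def using mid[OF _ b0(1)] mid[OF a0(1)] by fastforce
  have eA: "emeasure lborel A = emeasure lborel A'"
    using emeasure_lborel_vimage_affine[of A 1 "-b0"] unfolding A'_def by simp
  have eB: "emeasure lborel B = emeasure lborel B'"
    using emeasure_lborel_vimage_affine[of B 1 "-a0"] unfolding B'_def by simp
  have eH: "2 * emeasure lborel H = emeasure lborel H'"
  proof -
    have "2 * emeasure lborel H = (ennreal 2 * ennreal (1/2)) * emeasure lborel H'"
      using emeasure_lborel_vimage_affine[of H "1/2" 0] unfolding H'_def by (simp add: mult.assoc)
    also have "ennreal 2 * ennreal (1/2) = 1"
      by (subst ennreal_mult[symmetric]) auto
    finally show ?thesis by simp
  qed
  have sub: "A' \<inter> B' \<subseteq> {a0 + l .. s + b0}"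
  proof
    fix x assume "x \<in> A' \<inter> B'"
    then have "x - b0 \<in> A" "x - a0 \<in> B" unfolding A'_def B'_def by auto
    from sA[OF this(1)] lB[OF this(2)] show "x \<in> {a0 + l .. s + b0}" by auto
  qed
  have "emeasure lborel (A' \<inter> B') \<le> emeasure lborel {a0 + l .. s + b0}"
    by (rule emeasure_mono[OF sub]) simp
  also have "\<dots> \<le> ennreal e"
    using a0 b0 sA[OF a0(1)] lB[OF b0(1)] by (subst emeasure_lborel_Icc_eq) (auto intro!: ennreal_leI)
  finally have I: "emeasure lborel (A' \<inter> B') \<le> ennreal e" .
  have "A' \<union> B' = A' \<union> (B' - A')" by auto
  have "emeasure lborel A' + emeasure lborel B' = emeasure lborel (A' \<union> B') + emeasure lborel (A' \<inter> B')"
    by (rule emeasure_Un_Int) auto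
  also have "\<dots> \<le> emeasure lborel H' + ennreal e"
    by (intro add_mono I emeasure_mono) (use \<open>A' \<union> B' \<subseteq> H'\<close> in auto)
  finally show "emeasure lborel A + emeasure lborel B \<le> 2 * emeasure lborel H + ennreal e"
    unfolding eA eB eH .
qed

text \<open>Layer-cake formula. Heights are measured relative to \<open>c\<close>, so that functions
  with different bounds can be cut at a common relative height \<open>t\<close> in (0, 1).\<close>

lemma nn_integral_eq_levels:
  fixes f :: "real \<Rightarrow> ennreal" and c :: real
  assumes [measurable]: "f \<in> borel_measurable borel" and le: "\<And>x. f x \<le> ennreal c" and c: "c > 0"
  shows "(\<integral>\<^sup>+x. f x \<partial>lborel) = ennreal c * (\<integral>\<^sup>+t\<in>{0<..<1}. emeasure lborel {x. ennreal (t * c) < f x} \<partial>lborel)"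
proof -
  have p: "f x = ennreal c * (\<integral>\<^sup>+t. indicator {0<..<1} t * indicator {(t, x). ennreal (t * c) < f x} (t, x) \<partial>lborel)" for x
  proof -
    obtain r where r: "f x = ennreal r" "0 \<le> r" "r \<le> c"
      using le[of x] c by (cases "f x") (auto simp: top_unique)
    have *: "(indicator {0<..<1} t * indicator {(t, x). ennreal (t * c) < f x} (t, x) :: ennreal) = indicator {0<..<r/c} t" for t
    proof -
      have "t * c < r \<longleftrightarrow> t < r / c" "r / c \<le> 1" using r c by (auto simp: field_simps)
      then have "0 < t \<and> t < 1 \<and> t * c < r \<longleftrightarrow> 0 < t \<and> t < r / c" by linarith
      then show ?thesis using r c by (auto simp: indicator_def ennreal_less_iff)
    qed
    have "(\<integral>\<^sup>+t. indicator {0<..<1} t * indicator {(t, x). ennreal (t * c) < f x} (t, x) \<partial>lborel) = ennreal (r / c)"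
      using r c unfolding * by simp
    then show ?thesis using r c by (simp add: ennreal_mult[symmetric])
  qed
  have m: "(\<integral>\<^sup>+x. indicator {0<..<1} t * indicator {(t, x). ennreal (t * c) < f x} (t, x) \<partial>lborel) =
     emeasure lborel {x. ennreal (t * c) < f x} * indicator {0<..<1} t" for t :: real
  proof -
    have "(\<integral>\<^sup>+x. indicator {0<..<1} t * indicator {(t, x). ennreal (t * c) < f x} (t, x) \<partial>lborel)
      = indicator {0<..<1} t * (\<integral>\<^sup>+x. indicator {x. ennreal (t * c) < f x} x \<partial>lborel)"
      by (subst nn_integral_cmult[symmetric]) (auto simp: indicator_def intro!: nn_integral_cong)
    then show ?thesis by (simp add: mult.commute)
  qed
  have "(\<integral>\<^sup>+x. f x \<partial>lborel) = ennreal c * (\<integral>\<^sup>+x. \<integral>\<^sup>+t. indicator {0<..<1} t * indicator {(t, x). ennreal (t * c) < f x} (t, x) \<partial>lborel \<partial>lborel)"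
    by (subst p, subst nn_integral_cmult) (auto)
  also have "\<dots> = ennreal c * (\<integral>\<^sup>+t. \<integral>\<^sup>+x. indicator {0<..<1} t * indicator {(t, x). ennreal (t * c) < f x} (t, x) \<partial>lborel \<partial>lborel)"
    by (subst lborel_pair.Fubini') auto
  finally show ?thesis unfolding m .
qed

text \<open>For the function on the right of Prekopa-Leindler no upper bound is available; cutting
  it off at \<open>c\<close> leaves its level sets below \<open>c\<close> unchanged.\<close>

lemma nn_integral_ge_levels:
  fixes f :: "real \<Rightarrow> ennreal" and c :: real
  assumes [measurable]: "f \<in> borel_measurable borel" and c: "c > 0"
  shows "(\<integral>\<^sup>+x. f x \<partial>lborel) \<ge> ennreal c * (\<integral>\<^sup>+t\<in>{0<..<1}. emeasure lborel {x. ennreal (t * c) < f x} \<partial>lborel)"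
proof -
  have "{x. ennreal (t * c) < min (f x) (ennreal c)} = {x. ennreal (t * c) < f x}" if "t \<in> {0<..<1}" for t
    using that c by (auto simp: ennreal_less_iff)
  then have "emeasure lborel {x. ennreal (t * c) < f x} * indicator {0<..<1} t = emeasure lborel {x. ennreal (t * c) < min (f x) (ennreal c)} * indicator {0<..<1} t" for t
    by (cases "t \<in> {0<..<1}") (simp_all del: min_less_iff_conj)
  then have "ennreal c * (\<integral>\<^sup>+t\<in>{0<..<1}. emeasure lborel {x. ennreal (t * c) < f x} \<partial>lborel) =
     ennreal c * (\<integral>\<^sup>+t\<in>{0<..<1}. emeasure lborel {x. ennreal (t * c) < min (f x) (ennreal c)} \<partial>lborel)"
    by simp
  also have "\<dots> = (\<integral>\<^sup>+x. min (f x) (ennreal c) \<partial>lborel)"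
    by (rule nn_integral_eq_levels[symmetric]) (use c in auto)
  also have "\<dots> \<le> (\<integral>\<^sup>+x. f x \<partial>lborel)" by (intro nn_integral_mono) auto
  finally show ?thesis .
qed

lemma ennreal_am_gm: "a * b * 4 \<le> (a + b)\<^sup>2" for a b :: ennreal
proof (cases "a = top \<or> b = top")
  case True then show ?thesis by auto
next
  case False
  then obtain x y where "a = ennreal x" "b = ennreal y" "0 \<le> x" "0 \<le> y"
    by (metis ennreal_cases)
  moreover have "x * y * 4 \<le> (x + y)\<^sup>2" using sum_squares_bound[of x y] by (simp add: power2_sum)
  moreover have "ennreal x * ennreal y * 4 = ennreal (x * y * 4)"
    using calculation by (simp add: ennreal_mult)
  ultimately show ?thesis
    by (simp add: ennreal_power del: ennreal_plus add: ennreal_plus[symmetric]  ennreal_leI)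
qed

text \<open>The level sets at relative height \<open>t\<close> of sup \<open>f\<close>, of sup
  \<open>g\<close> and, for \<open>h\<close>, of the geometric mean of these suprema satisfy the
  one-dimensional Brunn-Minkowski inequality of \<open>emeasure_level_sets_midpoint\<close>.
  Integration over \<open>t\<close> gives an arithmetic mean, which AM-GM turns into the
  product.\<close>

lemma prekopa_leindler_bounded:
  fixes f g h :: "real \<Rightarrow> ennreal"
  assumes [measurable]: "f \<in> borel_measurable borel" "g \<in> borel_measurable borel" "h \<in> borel_measurable borel"
    and bd: "\<And>x. f x \<le> ennreal k" "\<And>x. g x \<le> ennreal l"
    and sp: "\<And>x. \<bar>x\<bar> > k' \<Longrightarrow> f x = 0" "\<And>x. \<bar>x\<bar> > l' \<Longrightarrow> g x = 0"
    and h: "\<And>x y. f x * g y \<le> (h ((x + y) / 2))\<^sup>2"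
  shows "(\<integral>\<^sup>+x. f x \<partial>lborel) * (\<integral>\<^sup>+x. g x \<partial>lborel) \<le> (\<integral>\<^sup>+x. h x \<partial>lborel)\<^sup>2"
proof (cases "(\<forall>x. f x = 0) \<or> (\<forall>x. g x = 0)")
  case True then show ?thesis by auto
next
  case False
  define F where "F = (SUP x. f x)" define G where "G = (SUP x. g x)"
  have "F \<noteq> 0" "G \<noteq> 0" using False by (auto simp: F_def G_def SUP_eq_iff bot_ennreal)
  moreover have "F \<le> ennreal k" "G \<le> ennreal l" unfolding F_def G_def using bd by (auto intro: SUP_least)
  ultimately obtain F' G' where FG: "F = ennreal F'" "F' > 0" "G = ennreal G'" "G' > 0"
    by (cases F; cases G) (auto simp: top_unique)
  define c where "c = sqrt (F' * G')"
  have c: "c > 0" "c\<^sup>2 = F' * G'" using FG by (auto simp: c_def)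
  let ?A = "\<lambda>t. {x. ennreal (t * F') < f x}" let ?B = "\<lambda>t. {x. ennreal (t * G') < g x}"
  let ?H = "\<lambda>t. {x. ennreal (t * c) < h x}"
  have lev: "emeasure lborel (?A t) + emeasure lborel (?B t) \<le> 2 * emeasure lborel (?H t)" if t: "0 < t" "t < 1" for t
  proof (rule emeasure_level_sets_midpoint)
    \<comment> \<open>Normalising by the suprema makes both level sets nonempty for every
      \<open>t < 1\<close>, which the Brunn-Minkowski step requires.\<close>
    have "ennreal (t * F') < F" "ennreal (t * G') < G" using FG t by (auto simp: ennreal_less_iff)
    then show "?A t \<noteq> {}" "?B t \<noteq> {}" unfolding F_def G_def less_SUP_iff by auto
    have "x \<in> {-k'..k'}" if "x \<in> ?A t" for x
      using sp(1)[of x] that by (cases "\<bar>x\<bar> > k'") (auto simp: not_less)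
    moreover have "x \<in> {-l'..l'}" if "x \<in> ?B t" for x
      using sp(2)[of x] that by (cases "\<bar>x\<bar> > l'") (auto simp: not_less)
    ultimately have "?A t \<subseteq> {-k'..k'}" "?B t \<subseteq> {-l'..l'}" by blast+
    then show "bounded (?A t)" "bounded (?B t)" by (auto intro: bounded_subset bounded_closed_interval)
    fix a b assume ab: "a \<in> ?A t" "b \<in> ?B t"
    have "(ennreal (t * c))\<^sup>2 = ennreal (t * F') * ennreal (t * G')"
      using t FG c by (simp add: ennreal_power ennreal_mult[symmetric] power_mult_distrib power2_eq_square mult_ac)
    also have "\<dots> < f a * ennreal (t * G')"
      using ab t FG by (intro ennreal_mult_strict_right_mono) auto
    also have "\<dots> \<le> f a * g b" using ab by (intro mult_left_mono) auto
    also have "\<dots> \<le> (h ((a + b) / 2))\<^sup>2" by (rule h)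
    finally show "(a + b) / 2 \<in> ?H t"
      by (metis (mono_tags, lifting) mem_Collect_eq not_le power_mono zero_le leD)
  qed measurable
  let ?a = "(\<integral>\<^sup>+t\<in>{0<..<1}. emeasure lborel (?A t) \<partial>lborel)"
  let ?b = "(\<integral>\<^sup>+t\<in>{0<..<1}. emeasure lborel (?B t) \<partial>lborel)"
  let ?h = "(\<integral>\<^sup>+t\<in>{0<..<1}. emeasure lborel (?H t) \<partial>lborel)"
  have "?a + ?b = (\<integral>\<^sup>+t\<in>{0<..<1}. emeasure lborel (?A t) + emeasure lborel (?B t) \<partial>lborel)"
    by (subst nn_integral_add[symmetric]) (auto simp: distrib_right)
  also have "\<dots> \<le> (\<integral>\<^sup>+t\<in>{0<..<1}. 2 * emeasure lborel (?H t) \<partial>lborel)"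
    by (intro nn_integral_mono) (auto simp: indicator_def lev)
  also have "\<dots> = 2 * ?h" by (subst nn_integral_cmult[symmetric]) (auto simp: mult.assoc)
  finally have ab: "?a + ?b \<le> 2 * ?h" .
  have "f x \<le> ennreal F'" "g x \<le> ennreal G'" for x
    unfolding FG(1,3)[symmetric] F_def G_def by (auto intro: SUP_upper)
  then have f: "(\<integral>\<^sup>+x. f x \<partial>lborel) = F * ?a" and g: "(\<integral>\<^sup>+x. g x \<partial>lborel) = G * ?b"
    using nn_integral_eq_levels[OF assms(1) _ FG(2)] nn_integral_eq_levels[OF assms(2) _ FG(4)]
    unfolding FG(1,3) by blast+
  have "F * ?a * (G * ?b) * 4 = (ennreal c)\<^sup>2 * (?a * ?b * 4)"
    using c FG by (simp add: ennreal_power ennreal_mult mult_ac)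
  also have "\<dots> \<le> (ennreal c)\<^sup>2 * (2 * ?h)\<^sup>2"
    by (intro mult_left_mono order_trans[OF ennreal_am_gm] power_mono ab) auto
  also have "\<dots> = (ennreal c * ?h)\<^sup>2 * 4" by (simp add: power_mult_distrib mult_ac)
  also have "\<dots> \<le> (\<integral>\<^sup>+x. h x \<partial>lborel)\<^sup>2 * 4"
    by (intro mult_right_mono power_mono nn_integral_ge_levels c) auto
  finally have "4 * (F * ?a * (G * ?b)) \<le> 4 * (\<integral>\<^sup>+x. h x \<partial>lborel)\<^sup>2" by (simp add: mult.commute)
  then show ?thesis unfolding f g by (subst (asm) ennreal_mult_le_mult_iff) auto
qed

text \<open>The hypothesis survives when \<open>f\<close> and \<open>g\<close> are made smaller.
  Hence both are truncated in height and support, with \<open>h\<close> left unchanged, and monotone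
  convergence removes the two truncations independently.\<close>

lemma prekopa_leindler_real:
  fixes f g h :: "real \<Rightarrow> ennreal"
  assumes [measurable]: "f \<in> borel_measurable borel" "g \<in> borel_measurable borel" "h \<in> borel_measurable borel"
    and h: "\<And>x y. f x * g y \<le> (h ((x + y) / 2))\<^sup>2"
  shows "(\<integral>\<^sup>+x. f x \<partial>lborel) * (\<integral>\<^sup>+x. g x \<partial>lborel) \<le> (\<integral>\<^sup>+x. h x \<partial>lborel)\<^sup>2"
proof -
  define T where "T f k x = min (f x) (of_nat k) * indicator {-real k..real k} x"
    for f :: "real \<Rightarrow> ennreal" and k x
  have T_le: "T f k x \<le> f x" for f k x
    unfolding T_def by (auto simp: indicator_def)
  have T_mono: "mono (T f)" for f
    unfolding T_def mono_def le_fun_def by (auto simp: indicator_def min_le_iff_disj)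
  have T_SUP: "(SUP k. T f k x) = f x" for f x
  proof (rule antisym)
    show "(SUP k. T f k x) \<le> f x" by (intro SUP_least T_le)
    have "f x = (SUP k. min (f x) (of_nat k))"
      unfolding inf_min[symmetric] inf_SUP[symmetric] ennreal_SUP_of_nat_eq_top by simp
    also have "\<dots> \<le> (SUP k. T f k x)"
    proof (rule SUP_least)
      fix k :: nat
      define m where "m = max k (nat \<lceil>\<bar>x\<bar>\<rceil>)"
      have "\<bar>x\<bar> \<le> real m" unfolding m_def by linarith
      moreover have "of_nat k \<le> (of_nat m :: ennreal)" unfolding m_def by (intro of_nat_mono) simp
      ultimately have "min (f x) (of_nat k) \<le> T f m x"
        unfolding T_def by (auto simp: indicator_def min_le_iff_disj abs_le_iff)
      also have "\<dots> \<le> (SUP k. T f k x)" by (rule SUP_upper) simp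
      finally show "min (f x) (of_nat k) \<le> (SUP k. T f k x)" .
    qed
    finally show "f x \<le> (SUP k. T f k x)" .
  qed
  have [measurable]: "T f k \<in> borel_measurable borel" if [measurable]: "f \<in> borel_measurable borel" for f k
    unfolding T_def by measurable
  have int: "(\<integral>\<^sup>+x. f x \<partial>lborel) = (SUP k. (\<integral>\<^sup>+x. T f k x \<partial>lborel))"
    if [measurable]: "f \<in> borel_measurable borel" for f
    by (subst nn_integral_monotone_convergence_SUP[symmetric]) (auto simp: T_mono T_SUP)
  have bound: "(\<integral>\<^sup>+x. T f k x \<partial>lborel) * (\<integral>\<^sup>+x. T g l x \<partial>lborel) \<le> (\<integral>\<^sup>+x. h x \<partial>lborel)\<^sup>2" for k l
  proof (rule prekopa_leindler_bounded)
    show "T f k x \<le> ennreal (real k)" "T g l x \<le> ennreal (real l)" for x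
      unfolding T_def by (auto simp: indicator_def ennreal_of_nat_eq_real_of_nat)
    show "\<bar>x\<bar> > real k \<Longrightarrow> T f k x = 0" "\<bar>x\<bar> > real l \<Longrightarrow> T g l x = 0" for x
      unfolding T_def by (auto simp: indicator_def)
    show "T f k x * T g l y \<le> (h ((x + y) / 2))\<^sup>2" for x y
      by (rule order_trans[OF mult_mono h]) (auto intro: T_le)
  qed measurable
  show ?thesis
    unfolding int[OF assms(1)] int[OF assms(2)]
    unfolding SUP_mult_right_ennreal SUP_mult_left_ennreal
    by (intro SUP_least bound)
qed

interpretation lborelP: product_sigma_finite "\<lambda>_ :: 'i. lborel :: 'a::euclidean_space measure"
  by standard

abbreviation lborel_pow :: "'i set \<Rightarrow> ('i \<Rightarrow> 'a::euclidean_space) measure" where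
  "lborel_pow I \<equiv> PiM I (\<lambda>_. lborel)"

text \<open>Induction on the number of coordinates: when one coordinate is integrated out, the
  one-dimensional inequality says that the partial integrals satisfy the hypothesis again.\<close>

theorem prekopa_leindler_PiM:
  fixes f g h :: "('i \<Rightarrow> real) \<Rightarrow> ennreal"
  assumes "finite I"
    and "f \<in> borel_measurable (lborel_pow I)" "g \<in> borel_measurable (lborel_pow I)"
      "h \<in> borel_measurable (lborel_pow I)"
    and "\<And>x y. x \<in> extensional I \<Longrightarrow> y \<in> extensional I \<Longrightarrow>
      f x * g y \<le> (h (\<lambda>i\<in>I. (x i + y i) / 2))\<^sup>2"
  shows "(\<integral>\<^sup>+x. f x \<partial>lborel_pow I) * (\<integral>\<^sup>+x. g x \<partial>lborel_pow I)
    \<le> (\<integral>\<^sup>+x. h x \<partial>lborel_pow I)\<^sup>2"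
  using assms
proof (induction I arbitrary: f g h rule: finite_induct)
  case empty
  show ?case using empty(4)[of "\<lambda>_. undefined" "\<lambda>_. undefined"]
    by (simp add: lborelP.nn_integral_empty restrict_def)
next
  case (insert i I)
  note [measurable] = insert.prems(1,2,3)
  have sect: "(\<lambda>y. f (x(i := y))) \<in> borel_measurable borel"
    if [measurable]: "f \<in> borel_measurable (lborel_pow (insert i I))" and x: "x \<in> extensional I" for f x
  proof -
    have "(\<lambda>y. x(i := y)) \<in> measurable lborel (lborel_pow (insert i I))"
      by (rule measurable_component_update[OF _ insert.hyps(2)]) (use x in \<open>simp add: space_PiM PiE_def\<close>)
    then show ?thesis using measurable_compose[OF _ that(1)] by simp
  qed
  have int: "(\<integral>\<^sup>+x. f x \<partial>lborel_pow (insert i I)) =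
      (\<integral>\<^sup>+x. (\<integral>\<^sup>+y. f (x(i := y)) \<partial>lborel) \<partial>lborel_pow I)"
    if [measurable]: "f \<in> borel_measurable (lborel_pow (insert i I))" for f
    using insert.hyps by (intro lborelP.product_nn_integral_insert) auto
  show ?case unfolding int[OF insert.prems(1)] int[OF insert.prems(2)] int[OF insert.prems(3)]
  proof (rule insert.IH)
    fix x y :: "'i \<Rightarrow> real" assume xy: "x \<in> extensional I" "y \<in> extensional I"
    have z: "(\<lambda>i\<in>I. (x i + y i) / 2) \<in> extensional I" by simp
    show "(\<integral>\<^sup>+t. f (x(i := t)) \<partial>lborel) * (\<integral>\<^sup>+t. g (y(i := t)) \<partial>lborel) \<le>
      (\<integral>\<^sup>+t. h ((\<lambda>i\<in>I. (x i + y i) / 2)(i := t)) \<partial>lborel)\<^sup>2"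
    proof (rule prekopa_leindler_real)
      fix s t :: real
      have "(\<lambda>j\<in>insert i I. ((x(i := s)) j + (y(i := t)) j) / 2) = (\<lambda>i\<in>I. (x i + y i) / 2)(i := (s + t) / 2)"
        using insert.hyps by (auto simp: fun_eq_iff)
      moreover have "x(i := s) \<in> extensional (insert i I)" "y(i := t) \<in> extensional (insert i I)"
        using xy by (auto simp: extensional_def)
      ultimately show "f (x(i := s)) * g (y(i := t)) \<le> (h ((\<lambda>i\<in>I. (x i + y i) / 2)(i := (s + t) / 2)))\<^sup>2"
        using insert.prems(4)[of "x(i := s)" "y(i := t)"] by (simp del: fun_upd_apply)
    qed (rule sect[OF insert.prems(1) xy(1)] sect[OF insert.prems(2) xy(2)] sect[OF insert.prems(3) z])+
  qed measurable
qed

section \<open>Maps preserving Lebesgue measure, and integration over parallel lines\<close>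

lemma distr_lborel_translation:
  "distr lborel lborel (\<lambda>x. x + c) = (lborel :: 'a::euclidean_space measure)"
proof -
  have "distr lborel lborel (\<lambda>x. x + c) = distr lborel borel ((+) c)"
    by (rule distr_cong) (auto simp: add.commute)
  then show ?thesis by (simp add: lborel_distr_plus)
qed

lemma distr_lborel_point_reflection:
  "distr lborel lborel (\<lambda>x. c - x) = (lborel :: 'a::euclidean_space measure)"
proof -
  have "distr lborel lborel (\<lambda>x. c - x) = distr lborel borel (\<lambda>x. c + (-1) *\<^sub>R x)"
    by (rule distr_cong) auto
  also have "\<dots> = lborel"
    using lborel_affine[of "-1" c] by (simp add: density_1)
  finally show ?thesis .
qed

lemma distr_PiM_lborel:
  assumes I: "finite I" and [measurable]: "\<And>i. i \<in> I \<Longrightarrow> T i \<in> borel_measurable borel"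
    and T: "\<And>i. i \<in> I \<Longrightarrow> distr lborel lborel (T i) = (lborel :: 'a::euclidean_space measure)"
  shows "distr (lborel_pow I) (lborel_pow I) (\<lambda>x. \<lambda>i\<in>I. T i (x i)) = lborel_pow I"
proof (rule lborelP.PiM_eqI[OF I])
  fix A :: "'b \<Rightarrow> 'a set" assume A: "\<And>i. i \<in> I \<Longrightarrow> A i \<in> sets lborel"
  have m [measurable]: "(\<lambda>x. \<lambda>i\<in>I. T i (x i)) \<in> lborel_pow I \<rightarrow>\<^sub>M lborel_pow I"
    by measurable
  have "emeasure (distr (lborel_pow I) (lborel_pow I) (\<lambda>x. \<lambda>i\<in>I. T i (x i))) (Pi\<^sub>E I A)
    = emeasure (lborel_pow I) (PiE I (\<lambda>i. T i -` A i))"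
    using A I by (subst emeasure_distr[OF m])
      (auto intro!: sets_PiM_I_finite arg_cong2[where f=emeasure] simp: space_PiM PiE_iff)
  also have "\<dots> = (\<Prod>i\<in>I. emeasure lborel (T i -` A i))"
    using A I by (subst lborelP.emeasure_PiM) (auto intro!: measurable_sets_borel[OF assms(2)])
  also have "\<dots> = (\<Prod>i\<in>I. emeasure lborel (A i))"
  proof (rule prod.cong[OF refl])
    fix i assume i: "i \<in> I"
    have "emeasure lborel (A i) = emeasure (distr lborel lborel (T i)) (A i)" using T[OF i] by simp
    also have "\<dots> = emeasure lborel (T i -` A i)"
      using A[OF i] i by (subst emeasure_distr) auto
    finally show "emeasure lborel (T i -` A i) = emeasure lborel (A i)" by simp
  qed
  finally show "emeasure (distr (lborel_pow I) (lborel_pow I) (\<lambda>x. \<lambda>i\<in>I. T i (x i))) (Pi\<^sub>E I A)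
    = (\<Prod>i\<in>I. emeasure lborel (A i))" .
qed simp

lemma nn_integral_PiM_lborel_vimage:
  assumes I: "finite I" and [measurable]: "\<And>i. i \<in> I \<Longrightarrow> T i \<in> borel_measurable borel"
    and T: "\<And>i. i \<in> I \<Longrightarrow> distr lborel lborel (T i) = (lborel :: 'a::euclidean_space measure)"
    and [measurable]: "f \<in> borel_measurable (lborel_pow I)"
  shows "(\<integral>\<^sup>+x. f (\<lambda>i\<in>I. T i (x i)) \<partial>lborel_pow I) = (\<integral>\<^sup>+x. f x \<partial>lborel_pow I)"
proof -
  have [measurable]: "(\<lambda>x. \<lambda>i\<in>I. T i (x i)) \<in> lborel_pow I \<rightarrow>\<^sub>M lborel_pow I"
    by measurable
  have "(\<integral>\<^sup>+x. f x \<partial>lborel_pow I) =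
    (\<integral>\<^sup>+x. f x \<partial>distr (lborel_pow I) (lborel_pow I) (\<lambda>x. \<lambda>i\<in>I. T i (x i)))"
    using distr_PiM_lborel[of I T] assms by simp
  then show ?thesis by (simp add: nn_integral_distr)
qed

text \<open>Fubini for the lines in direction \<open>u\<close>, each represented by its points in a slab of width 1.
  Only the translation invariance of Lebesgue measure is needed.\<close>

lemma nn_integral_lines_PiM:
  fixes u :: "'a::euclidean_space" and f :: "('i \<Rightarrow> 'a) \<Rightarrow> ennreal"
  assumes I: "finite I" and u: "norm u = 1" and [measurable]: "f \<in> borel_measurable (lborel_pow I)"
  shows "(\<integral>\<^sup>+x. f x \<partial>lborel_pow I) =
    (\<integral>\<^sup>+x. indicator (PiE I (\<lambda>_. {x. x \<bullet> u \<in> {0..1}})) x *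
      (\<integral>\<^sup>+s. f (\<lambda>i\<in>I. x i + s i *\<^sub>R u) \<partial>lborel_pow I) \<partial>lborel_pow I)"
proof -
  let ?P = "PiM I (\<lambda>_. lborel :: 'a measure)" let ?Q = "PiM I (\<lambda>_. lborel :: real measure)"
  interpret P: finite_product_sigma_finite "\<lambda>_. lborel :: 'a measure" I by standard (rule I)
  interpret Q: finite_product_sigma_finite "\<lambda>_. lborel :: real measure" I by standard (rule I)
  interpret PQ: pair_sigma_finite ?P ?Q ..
  define S where "S = PiE I (\<lambda>_. {x :: 'a. x \<bullet> u \<in> {0..1}})"
  have [measurable]: "S \<in> sets ?P" unfolding S_def by (intro sets_PiM_I_finite I) simp
  have [measurable]: "(\<lambda>(x, s). \<lambda>i\<in>I. x i + s i *\<^sub>R u) \<in> ?P \<Otimes>\<^sub>M ?Q \<rightarrow>\<^sub>M ?P"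
     "(\<lambda>(x, s). \<lambda>i\<in>I. x i - s i *\<^sub>R u) \<in> ?P \<Otimes>\<^sub>M ?Q \<rightarrow>\<^sub>M ?P" by measurable
  have uu: "u \<bullet> u = 1" using u by (simp add: norm_eq_1)
  \<comment> \<open>The shifts that bring a fixed tuple into the slab form a product of unit
    intervals, because \<open>u\<close> is a unit vector.\<close>
  have slab: "(\<integral>\<^sup>+s. indicator S (\<lambda>i\<in>I. x i - s i *\<^sub>R u) \<partial>?Q) = 1" for x :: "'i \<Rightarrow> 'a"
  proof -
    have "(\<integral>\<^sup>+s. indicator S (\<lambda>i\<in>I. x i - s i *\<^sub>R u) \<partial>?Q) =
      (\<integral>\<^sup>+s. indicator (PiE I (\<lambda>i. {x i \<bullet> u - 1..x i \<bullet> u})) s \<partial>?Q)"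
    proof (rule nn_integral_cong)
      fix s assume "s \<in> space ?Q"
      then have "(\<lambda>i\<in>I. x i - s i *\<^sub>R u) \<in> S \<longleftrightarrow> s \<in> PiE I (\<lambda>i. {x i \<bullet> u - 1..x i \<bullet> u})"
        by (auto simp: S_def PiE_iff space_PiM inner_diff_left uu Ball_def algebra_simps)
      then show "indicator S (\<lambda>i\<in>I. x i - s i *\<^sub>R u) = (indicator (PiE I (\<lambda>i. {x i \<bullet> u - 1..x i \<bullet> u})) s :: ennreal)"
        by (simp only: indicator_def)
    qed
    also have "\<dots> = 1"
      using I by (subst nn_integral_indicator) (auto simp: lborelP.emeasure_PiM)
    finally show ?thesis .
  qed
  have "(\<integral>\<^sup>+x. indicator S x * (\<integral>\<^sup>+s. f (\<lambda>i\<in>I. x i + s i *\<^sub>R u) \<partial>?Q) \<partial>?P) =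
    (\<integral>\<^sup>+x. \<integral>\<^sup>+s. indicator S x * f (\<lambda>i\<in>I. x i + s i *\<^sub>R u) \<partial>?Q \<partial>?P)"
    by (subst nn_integral_cmult[symmetric]) auto
  also have "\<dots> = (\<integral>\<^sup>+s. \<integral>\<^sup>+x. indicator S x * f (\<lambda>i\<in>I. x i + s i *\<^sub>R u) \<partial>?P \<partial>?Q)"
    by (subst PQ.Fubini') auto
  \<comment> \<open>For each fixed \<open>s\<close>, translation invariance moves the shift from
    \<open>f\<close> to the indicator of the slab; integrating over \<open>s\<close> first then
    leaves only \<open>f\<close>.\<close>
  also have "\<dots> = (\<integral>\<^sup>+s. \<integral>\<^sup>+x. indicator S (\<lambda>i\<in>I. x i - s i *\<^sub>R u) * f x \<partial>?P \<partial>?Q)"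
  proof (rule nn_integral_cong)
    fix s assume s: "s \<in> space ?Q"
    have [measurable]: "(\<lambda>x. \<lambda>i\<in>I. x i - s i *\<^sub>R u) \<in> ?P \<rightarrow>\<^sub>M ?P" by measurable
    have "(\<integral>\<^sup>+x. indicator S x * f (\<lambda>i\<in>I. x i + s i *\<^sub>R u) \<partial>?P)
       = (\<integral>\<^sup>+x. (\<lambda>x. indicator S (\<lambda>i\<in>I. x i - s i *\<^sub>R u) * f x) (\<lambda>i\<in>I. x i + s i *\<^sub>R u) \<partial>?P)"
      by (rule nn_integral_cong)
        (auto intro!: arg_cong2[where f="(*)"] arg_cong[where f="indicator S"] simp: space_PiM PiE_iff extensional_def fun_eq_iff)
    also have "\<dots> = (\<integral>\<^sup>+x. indicator S (\<lambda>i\<in>I. x i - s i *\<^sub>R u) * f x \<partial>?P)"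
      by (rule nn_integral_PiM_lborel_vimage[OF I]) (auto simp: distr_lborel_translation)
    finally show "(\<integral>\<^sup>+x. indicator S x * f (\<lambda>i\<in>I. x i + s i *\<^sub>R u) \<partial>?P) = (\<integral>\<^sup>+x. indicator S (\<lambda>i\<in>I. x i - s i *\<^sub>R u) * f x \<partial>?P)" .
  qed
  also have "\<dots> = (\<integral>\<^sup>+x. \<integral>\<^sup>+s. indicator S (\<lambda>i\<in>I. x i - s i *\<^sub>R u) * f x \<partial>?Q \<partial>?P)"
    by (subst PQ.Fubini') auto
  also have "\<dots> = (\<integral>\<^sup>+x. f x \<partial>?P)"
    by (subst nn_integral_multc) (auto simp: slab)
  finally show ?thesis by (simp add: S_def)
qed

section \<open>Shadow systems and volumes of sums with zonotopes\<close>

lemma nn_integral_lines: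
  fixes u :: "'a::euclidean_space" and f :: "'a \<Rightarrow> ennreal"
  assumes u: "norm u = 1" and [measurable]: "f \<in> borel_measurable borel"
  shows "(\<integral>\<^sup>+x. f x \<partial>lborel) =
    (\<integral>\<^sup>+x. indicator {x. x \<bullet> u \<in> {0..1}} x * (\<integral>\<^sup>+s. f (x + s *\<^sub>R u) \<partial>lborel) \<partial>lborel)"
proof -
  let ?P = "PiM {()} (\<lambda>_. lborel :: 'a measure)"
  have "(\<integral>\<^sup>+x. f x \<partial>lborel) = (\<integral>\<^sup>+x. f (x ()) \<partial>?P)"
    by (rule lborelP.product_nn_integral_singleton[symmetric]) simp
  also have "\<dots> = (\<integral>\<^sup>+x. indicator (PiE {()} (\<lambda>_. {x. x \<bullet> u \<in> {0..1}})) x *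
      (\<integral>\<^sup>+s. f (x () + s () *\<^sub>R u) \<partial>lborel_pow {()}) \<partial>?P)"
    using nn_integral_lines_PiM[OF _ u, of "{()}" "\<lambda>x. f (x ())"] by simp
  also have "\<dots> = (\<integral>\<^sup>+x. (\<lambda>x. indicator {x. x \<bullet> u \<in> {0..1}} x * (\<integral>\<^sup>+s. f (x + s *\<^sub>R u) \<partial>lborel)) (x ()) \<partial>?P)"
  proof (rule nn_integral_cong)
    fix x :: "unit \<Rightarrow> 'a"
    have "(\<integral>\<^sup>+s. f (x () + s () *\<^sub>R u) \<partial>lborel_pow {()}) = (\<integral>\<^sup>+s. f (x () + s *\<^sub>R u) \<partial>lborel)"
      by (rule lborelP.product_nn_integral_singleton) simp
    moreover have "x \<in> PiE {()} (\<lambda>_. {x. x \<bullet> u \<in> {0..1}}) \<longleftrightarrow> x () \<in> {x. x \<bullet> u \<in> {0..1}}"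
      by (auto simp: PiE_iff extensional_def)
    ultimately show "indicator (PiE {()} (\<lambda>_. {x. x \<bullet> u \<in> {0..1}})) x *
      (\<integral>\<^sup>+s. f (x () + s () *\<^sub>R u) \<partial>lborel_pow {()}) = indicator {x. x \<bullet> u \<in> {0..1}} (x ()) * (\<integral>\<^sup>+s. f (x () + s *\<^sub>R u) \<partial>lborel)"
      by (simp add: indicator_def)
  qed
  also have "\<dots> = (\<integral>\<^sup>+x. indicator {x. x \<bullet> u \<in> {0..1}} x * (\<integral>\<^sup>+s. f (x + s *\<^sub>R u) \<partial>lborel) \<partial>lborel)"
    by (rule lborelP.product_nn_integral_singleton) measurable
  finally show ?thesis .
qed

lemma emeasure_lines:
  fixes u :: "'a::euclidean_space"
  assumes u: "norm u = 1" and [measurable]: "A \<in> sets borel"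
  shows "emeasure lborel A =
    (\<integral>\<^sup>+x. indicator {x. x \<bullet> u \<in> {0..1}} x * emeasure lborel {s. x + s *\<^sub>R u \<in> A} \<partial>lborel)"
proof -
  have "(\<integral>\<^sup>+s. indicator A (x + s *\<^sub>R u) \<partial>lborel) = emeasure lborel {s. x + s *\<^sub>R u \<in> A}" for x
  proof -
    have "(\<integral>\<^sup>+s. indicator A (x + s *\<^sub>R u) \<partial>lborel) = (\<integral>\<^sup>+s. indicator {s. x + s *\<^sub>R u \<in> A} s \<partial>lborel)"
      by (intro nn_integral_cong) (auto simp: indicator_def)
    then show ?thesis by simp
  qed
  then show ?thesis using nn_integral_lines[OF u, of "indicator A"] by simp
qed

section \<open>Reflections and chords of compact convex sets\<close>

definition reflection :: "'a::euclidean_space \<Rightarrow> 'a \<Rightarrow> 'a" where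
  "reflection u x = x - (2 * (x \<bullet> u)) *\<^sub>R u"

lemma linear_reflection: "linear (reflection u)"
  unfolding reflection_def by (rule linearI) (auto simp: inner_left_distrib algebra_simps)

lemma inner_reflection: "norm u = 1 \<Longrightarrow> reflection u x \<bullet> u = - (x \<bullet> u)"
  unfolding reflection_def by (simp add: inner_diff_left norm_eq_1)

lemma reflection_reflection [simp]: "norm u = 1 \<Longrightarrow> reflection u (reflection u x) = x"
  using inner_reflection[of u x] unfolding reflection_def[of u "reflection u x"] by (simp add: reflection_def)

lemma norm_reflection: "norm u = 1 \<Longrightarrow> norm (reflection u x) = norm x"
  unfolding norm_eq_sqrt_inner reflection_def
  by (simp add: inner_diff_left inner_diff_right inner_commute algebra_simps)

lemma measurable_reflection [measurable]: "reflection u \<in> borel_measurable borel"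
  unfolding reflection_def by measurable

lemma continuous_on_reflection: "continuous_on A (reflection u)"
  unfolding reflection_def by (intro continuous_intros)

text \<open>Checked line by line: on a line parallel to \<open>u\<close> the reflection acts on the
  parameter as \<open>s \<mapsto> - 2 * (x \<bullet> u) - s\<close>, which preserves length.\<close>

lemma distr_lborel_reflection:
  assumes u: "norm u = 1"
  shows "distr lborel lborel (reflection u) = lborel"
proof (rule measure_eqI)
  fix A assume "A \<in> sets (distr lborel lborel (reflection u))"
  then have [measurable]: "A \<in> sets borel" by simp
  have "emeasure (distr lborel lborel (reflection u)) A = emeasure lborel (reflection u -` A)"
    by (subst emeasure_distr) auto
  also have "\<dots> = emeasure lborel A"
  proof (subst (1 2) emeasure_lines[OF u])
    have "emeasure lborel {s. x + s *\<^sub>R u \<in> A} = emeasure lborel {s. x + s *\<^sub>R u \<in> reflection u -` A}" for x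
    proof -
      have "{s. x + s *\<^sub>R u \<in> reflection u -` A} = {s. (- 2 * (x \<bullet> u)) + (-1) *\<^sub>R s \<in> {s. x + s *\<^sub>R u \<in> A}}"
      proof -
        have "reflection u (x + s *\<^sub>R u) = x + (- 2 * (x \<bullet> u) + (-1) *\<^sub>R s) *\<^sub>R u" for s
          using u by (simp add: reflection_def norm_eq_1 inner_left_distrib algebra_simps flip: scaleR_2)
        then show ?thesis by simp
      qed
      then show ?thesis
        using emeasure_lborel_vimage_affine[of "{s. x + s *\<^sub>R u \<in> A}" "-1" "- 2 * (x \<bullet> u)"] by simp
    qed
    then show "(\<integral>\<^sup>+x. indicator {x. x \<bullet> u \<in> {0..1}} x * emeasure lborel {s. x + s *\<^sub>R u \<in> reflection u -` A} \<partial>lborel)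
      = (\<integral>\<^sup>+x. indicator {x. x \<bullet> u \<in> {0..1}} x * emeasure lborel {s. x + s *\<^sub>R u \<in> A} \<partial>lborel)"
      by simp
  qed (auto intro: measurable_sets_borel[OF measurable_reflection])
  finally show "emeasure (distr lborel lborel (reflection u)) A = emeasure lborel A" .
qed simp

text \<open>Weaker than \<open>convex_body\<close>, because hulls of points and zonotopes may be
  flat. Nonemptiness provides nearest points.\<close>

definition cvx_compact :: "'a::euclidean_space set \<Rightarrow> bool" where
  "cvx_compact A \<longleftrightarrow> compact A \<and> convex A \<and> A \<noteq> {}"

lemma cvx_compact_plus: "cvx_compact A \<Longrightarrow> cvx_compact B \<Longrightarrow> cvx_compact (A + B)"
proof -
  assume *: "cvx_compact A" "cvx_compact B"
  have "A + B = {x + y |x y. x \<in> A \<and> y \<in> B}" unfolding set_plus_def by auto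
  with * compact_sums[of A B] convex_set_plus[of A B] show ?thesis
    unfolding cvx_compact_def by auto
qed

lemma cvx_compact_borel: "cvx_compact A \<Longrightarrow> A \<in> sets borel"
  unfolding cvx_compact_def by (simp add: borel_compact)

text \<open>An empty chord is represented by an interval with \<open>a > b\<close>; hence the later
  case distinctions on \<open>a \<le> b\<close>.\<close>

lemma chord_interval:
  assumes "compact A" "convex A" and u: "norm u = 1"
  shows "\<exists>a b. {s. x + s *\<^sub>R u \<in> A} = {a..b :: real}"
proof -
  let ?S = "{s. x + s *\<^sub>R u \<in> A}"
  have "closed ((\<lambda>s. x + s *\<^sub>R u) -` A)"
    using assms(1) by (intro closed_vimage continuous_intros compact_imp_closed)
  then have "closed ?S" by (simp add: vimage_def)
  moreover have "bounded ?S"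
  proof -
    obtain r where r: "\<And>y. y \<in> A \<Longrightarrow> norm y \<le> r"
      using compact_imp_bounded[OF assms(1)] unfolding bounded_iff by auto
    have "norm s \<le> r + norm x" if "s \<in> ?S" for s
      using r[of "x + s *\<^sub>R u"] norm_triangle_ineq4[of "x + s *\<^sub>R u" x] that u by simp
    then show ?thesis unfolding bounded_iff by blast
  qed
  moreover have "convex ?S"
  proof (rule convexI)
    fix s t a b :: real assume st: "s \<in> ?S" "t \<in> ?S" "0 \<le> a" "0 \<le> b" "a + b = 1"
    have "x + (a *\<^sub>R s + b *\<^sub>R t) *\<^sub>R u = (a + b) *\<^sub>R x + (a *\<^sub>R s + b *\<^sub>R t) *\<^sub>R u" using st by simp
    also have "\<dots> = a *\<^sub>R (x + s *\<^sub>R u) + b *\<^sub>R (x + t *\<^sub>R u)"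
      by (simp add: algebra_simps)
    also have "\<dots> \<in> A" using st assms(2) by (intro convexD) auto
    finally show "a *\<^sub>R s + b *\<^sub>R t \<in> ?S" by simp
  qed
  ultimately show ?thesis
    using connected_compact_interval_1[of ?S] by (simp add: compact_eq_bounded_closed convex_connected)
qed

section \<open>Adding a segment to a convex set\<close>

definition sym_segment :: "'a::euclidean_space \<Rightarrow> 'a set" where
  "sym_segment v = closed_segment (- v) v"

lemma sym_segment_alt: "sym_segment v = (\<lambda>t. t *\<^sub>R v) ` {-1..1}"
proof -
  have "(1 - t) *\<^sub>R (- v) + t *\<^sub>R v = (2 * t - 1) *\<^sub>R v" for t
    by (simp add: algebra_simps flip: scaleR_2)
  moreover have "(\<lambda>t. (2 * t - 1 :: real)) ` {0..1} = {-1..1}"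
  proof -
    have "x \<in> (\<lambda>t. (2 * t - 1 :: real)) ` {0..1}" if "x \<in> {-1..1}" for x
      using that by (intro image_eqI[of _ _ "(x + 1) / 2"]) (auto simp: field_simps)
    then show ?thesis by auto
  qed
  then have "(\<lambda>t. t *\<^sub>R v) ` (\<lambda>t. 2 * t - 1) ` {0..1} = (\<lambda>t. t *\<^sub>R v) ` {-1..1}"
    by simp
  ultimately show ?thesis unfolding sym_segment_def closed_segment_image_interval image_image by simp
qed

lemma cvx_compact_segment [simp]: "cvx_compact (sym_segment v)"
  unfolding cvx_compact_def sym_segment_def by auto

lemma subset_plus_sym_segment: "K \<subseteq> K + sym_segment v"
proof
  fix x assume "x \<in> K"
  then have "x + 0 \<in> K + sym_segment v" by (intro set_plus_intro) (auto simp: sym_segment_alt intro!: image_eqI[of _ _ 0])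
  then show "x \<in> K + sym_segment v" by simp
qed

text \<open>Adding the segment lengthens every nonempty chord in direction \<open>v\<close> by
  \<open>2 * s * norm v\<close>. By Fubini the slope \<open>c\<close> is \<open>2 * norm v\<close>
  times the volume of the projection of \<open>K\<close> along \<open>v\<close>.\<close>

lemma measure_plus_sym_segment:
  fixes K :: "'a::euclidean_space set"
  assumes K: "cvx_compact K" and v: "v \<noteq> 0"
  shows "\<exists>c::real. c \<ge> 0 \<and> (\<forall>s\<ge>0. measure lborel (K + sym_segment (s *\<^sub>R v)) = measure lborel K + s * c)"
proof -
  define u where "u = v /\<^sub>R norm v"
  have u: "norm u = 1" using v by (simp add: u_def)
  have vu: "v = norm v *\<^sub>R u" using v by (simp add: u_def)
  have uu: "u \<noteq> 0" using u by auto
  let ?L = "{x. \<exists>s. x + s *\<^sub>R u \<in> K}"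
  have "?L = (\<Union>x\<in>K. \<Union>y\<in>range (\<lambda>s. s *\<^sub>R u). {x + y})"
  proof (intro equalityI subsetI)
    fix x assume "x \<in> ?L"
    then obtain s where s: "x + s *\<^sub>R u \<in> K" by auto
    moreover have "x = (x + s *\<^sub>R u) + (- s) *\<^sub>R u" by simp
    ultimately show "x \<in> (\<Union>x\<in>K. \<Union>y\<in>range (\<lambda>s. s *\<^sub>R u). {x + y})" by blast
  next
    fix x assume "x \<in> (\<Union>x\<in>K. \<Union>y\<in>range (\<lambda>s. s *\<^sub>R u). {x + y})"
    then obtain k s where "k \<in> K" "x = k + s *\<^sub>R u" by auto
    then show "x \<in> ?L" by (auto intro!: exI[of _ "- s"])
  qed
  moreover have "closed \<dots>"
  proof -
    have "closed (range (\<lambda>s. s *\<^sub>R u))"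
      using closed_subspace[OF subspace_span[of "{u}"]] by (simp add: span_singleton full_SetCompr_eq)
    then show ?thesis using K by (intro compact_closed_sums) (auto simp: cvx_compact_def)
  qed
  ultimately have [measurable]: "?L \<in> sets borel" by (metis borel_closed)
  note [measurable] = cvx_compact_borel[OF K]
  \<comment> \<open>\<open>?L\<close> is the union of all lines parallel to \<open>u\<close> that
    meet \<open>K\<close>; its measure within a slab of unit width is the volume of the projection
    of \<open>K\<close>.\<close>
  define m where "m = (\<integral>\<^sup>+x. indicator {x. x \<bullet> u \<in> {0..1}} x * indicator ?L x \<partial>lborel)"
  have main: "emeasure lborel (K + sym_segment (s *\<^sub>R v)) = emeasure lborel K + ennreal (2 * s * norm v) * m" if s: "s \<ge> 0" for s
  proof -
    have [measurable]: "K + sym_segment (s *\<^sub>R v) \<in> sets borel" by (intro cvx_compact_borel cvx_compact_plus K) simp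
    have chord: "emeasure lborel {t. x + t *\<^sub>R u \<in> K + sym_segment (s *\<^sub>R v)} =
       emeasure lborel {t. x + t *\<^sub>R u \<in> K} + ennreal (2 * s * norm v) * indicator ?L x" for x
    proof -
      define h where "h = s * norm v"
      have h: "h \<ge> 0" using s by (simp add: h_def)
      have sv: "s *\<^sub>R v = h *\<^sub>R u" unfolding h_def using vu by (metis scaleR_scaleR)
      have mem: "x + t *\<^sub>R u \<in> K + sym_segment (s *\<^sub>R v) \<longleftrightarrow> (\<exists>r. x + r *\<^sub>R u \<in> K \<and> \<bar>t - r\<bar> \<le> h)" for t
      proof
        assume "x + t *\<^sub>R u \<in> K + sym_segment (s *\<^sub>R v)"
        then obtain k q where k: "k \<in> K" "q \<in> {-1..1}" "x + t *\<^sub>R u = k + q *\<^sub>R (h *\<^sub>R u)"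
          unfolding sv sym_segment_alt set_plus_def by auto
        then have "k = x + (t - q * h) *\<^sub>R u" by (simp add: algebra_simps)
        moreover have "\<bar>q * h\<bar> \<le> 1 * h" unfolding abs_mult using k h by (intro mult_mono) auto
        ultimately show "\<exists>r. x + r *\<^sub>R u \<in> K \<and> \<bar>t - r\<bar> \<le> h" using k(1) by (intro exI[of _ "t - q * h"]) auto
      next
        assume "\<exists>r. x + r *\<^sub>R u \<in> K \<and> \<bar>t - r\<bar> \<le> h"
        then obtain r where r: "x + r *\<^sub>R u \<in> K" "\<bar>t - r\<bar> \<le> h" by auto
        have "(t - r) *\<^sub>R u \<in> sym_segment (h *\<^sub>R u)"
        proof (cases "h = 0")
          case True then show ?thesis using r by (auto simp: sym_segment_alt intro!: image_eqI[of _ _ 0])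
        next
          case False
          then have "(t - r) / h \<in> {-1..1}" using r h by (auto simp: divide_simps abs_le_iff)
          then show ?thesis unfolding sym_segment_alt using False by (intro image_eqI[of _ _ "(t - r) / h"]) simp_all
        qed
        from set_plus_intro[OF r(1) this] show "x + t *\<^sub>R u \<in> K + sym_segment (s *\<^sub>R v)"
          unfolding sv by (simp add: algebra_simps)
      qed
      obtain a b where ab: "{t. x + t *\<^sub>R u \<in> K} = {a..b}"
        using chord_interval[OF _ _ u, of K x] K by (auto simp: cvx_compact_def)
      then have abK: "x + t *\<^sub>R u \<in> K \<longleftrightarrow> a \<le> t \<and> t \<le> b" for t by auto
      show ?thesis
      proof (cases "a \<le> b")
        case True
        have "{t. x + t *\<^sub>R u \<in> K + sym_segment (s *\<^sub>R v)} = {a - h..b + h}"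
          unfolding mem abK
        proof (intro equalityI subsetI CollectI)
          fix t assume t: "t \<in> {a - h..b + h}"
          show "\<exists>r. (a \<le> r \<and> r \<le> b) \<and> \<bar>t - r\<bar> \<le> h"
            using t True h by (intro exI[of _ "max a (min b t)"]) (auto simp: max_def min_def abs_le_iff)
        qed auto
        moreover have "x \<in> ?L" using abK[of a] True by auto
        ultimately show ?thesis unfolding ab using True h
          by (simp add: h_def ennreal_plus[symmetric] del: ennreal_plus)
      next
        case False
        then have "x \<notin> ?L" using abK by auto
        moreover have "{t. x + t *\<^sub>R u \<in> K + sym_segment (s *\<^sub>R v)} = {}" unfolding mem abK using False by auto
        ultimately show ?thesis using ab False by simp
      qed
    qed
    have [measurable]: "(\<lambda>x. emeasure lborel {t. x + t *\<^sub>R u \<in> K}) \<in> borel_measurable borel"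
      by measurable
    show ?thesis
      by (subst (1 2) emeasure_lines[OF u], measurable, unfold chord m_def)
        (subst nn_integral_cmult[symmetric], measurable, subst nn_integral_add[symmetric], auto simp: algebra_simps)
  qed
  have fin: "emeasure lborel (K + sym_segment (s *\<^sub>R v)) < \<infinity>" "emeasure lborel K < \<infinity>" for s
    using K cvx_compact_plus[OF K cvx_compact_segment[of "s *\<^sub>R v"]] emeasure_compact_finite[of K]
      emeasure_compact_finite[of "K + sym_segment (s *\<^sub>R v)"] unfolding cvx_compact_def by simp_all
  have "ennreal (2 * 1 * norm v) * m < \<infinity>"
    using main[of 1] fin(1)[of 1] by (simp add: top.not_eq_extremum)
  then have "m < \<infinity>" using v by (auto simp: ennreal_mult_less_top top.not_eq_extremum)
  then obtain c where c: "m = ennreal c" "c \<ge> 0" by (cases m) auto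
  have "measure lborel (K + sym_segment (s *\<^sub>R v)) = measure lborel K + s * (2 * norm v * c)" if "s \<ge> 0" for s
  proof -
    have "ennreal (measure lborel (K + sym_segment (s *\<^sub>R v))) = ennreal (measure lborel K + s * (2 * norm v * c))"
    proof -
      have "emeasure lborel (K + sym_segment (s *\<^sub>R v)) = ennreal (measure lborel (K + sym_segment (s *\<^sub>R v)))"
        "emeasure lborel K = ennreal (measure lborel K)"
        using fin(1)[of s] fin(2) by (intro emeasure_eq_ennreal_measure; simp add: less_top)+
      then show ?thesis
        using main[OF that] that c by (simp add: ennreal_mult[symmetric] mult_ac)
    qed
    then show ?thesis using that c by (subst (asm) ennreal_inj) auto
  qed
  then show ?thesis using c by (intro exI[of _ "2 * norm v * c"]) auto
qed

text \<open>\<open>C\<close> is the middle member of a shadow system in direction \<open>u\<close> with outer members \<open>A\<close> and \<open>B\<close>.\<close>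

definition shadow_mid :: "'a::euclidean_space \<Rightarrow> 'a set \<Rightarrow> 'a set \<Rightarrow> 'a set \<Rightarrow> bool" where
  "shadow_mid u A B C \<longleftrightarrow> (\<forall>p\<in>C. \<exists>t. p + t *\<^sub>R u \<in> A \<and> p - t *\<^sub>R u \<in> B)"

lemma shadow_mid_plus:
  assumes "shadow_mid u A B C"
  shows "shadow_mid u (A + Z) (B + Z) (C + Z)"
  unfolding shadow_mid_def
proof
  fix p assume "p \<in> C + Z"
  then obtain c z where c: "c \<in> C" "z \<in> Z" "p = c + z" by (auto simp: set_plus_def)
  then obtain t where "c + t *\<^sub>R u \<in> A" "c - t *\<^sub>R u \<in> B" using assms by (auto simp: shadow_mid_def)
  then show "\<exists>t. p + t *\<^sub>R u \<in> A + Z \<and> p - t *\<^sub>R u \<in> B + Z"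
    using set_plus_intro[of "c + t *\<^sub>R u" A z Z] set_plus_intro[of "c - t *\<^sub>R u" B z Z] c
    by (intro exI[of _ t]) (simp add: algebra_simps)
qed

lemma measure_shadow_mid:
  assumes u: "norm u = 1" and A: "cvx_compact A" and B: "cvx_compact B" and C: "cvx_compact C" and sh: "shadow_mid u A B C"
  shows "measure lborel C \<le> (measure lborel A + measure lborel B) / 2"
proof -
  note [measurable] = cvx_compact_borel[OF A] cvx_compact_borel[OF B] cvx_compact_borel[OF C]
  have chord: "2 * emeasure lborel {s. x + s *\<^sub>R u \<in> C} \<le>
    emeasure lborel {s. x + s *\<^sub>R u \<in> A} + emeasure lborel {s. x + s *\<^sub>R u \<in> B}" for x
  proof -
    obtain a a' where a: "{s. x + s *\<^sub>R u \<in> A} = {a..a'}" using chord_interval[OF _ _ u] A unfolding cvx_compact_def by blast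
    obtain b b' where b: "{s. x + s *\<^sub>R u \<in> B} = {b..b'}" using chord_interval[OF _ _ u] B unfolding cvx_compact_def by blast
    obtain c c' where c: "{s. x + s *\<^sub>R u \<in> C} = {c..c'}" using chord_interval[OF _ _ u] C unfolding cvx_compact_def by blast
    show ?thesis
    proof (cases "c \<le> c'")
      case True
      have *: "\<exists>t. s + t \<in> {a..a'} \<and> s - t \<in> {b..b'}" if "s \<in> {c..c'}" for s
      proof -
        have "x + s *\<^sub>R u \<in> C" using that c by auto
        then obtain t where "x + s *\<^sub>R u + t *\<^sub>R u \<in> A" "x + s *\<^sub>R u - t *\<^sub>R u \<in> B" using sh by (auto simp: shadow_mid_def)
        then have "s + t \<in> {s. x + s *\<^sub>R u \<in> A}" "s - t \<in> {s. x + s *\<^sub>R u \<in> B}" by (auto simp: algebra_simps)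
        then show ?thesis using a b by auto
      qed
      \<comment> \<open>Only the two end points are needed: \<open>2 * (c' - c)\<close> is the sum
        of the differences of their partners in the chords of \<open>A\<close> and \<open>B\<close>,
        and each difference is at most the length of its chord.\<close>
      from *[of c] *[of c'] True obtain t t' where t: "c + t \<in> {a..a'}" "c - t \<in> {b..b'}" "c' + t' \<in> {a..a'}" "c' - t' \<in> {b..b'}" by auto
      have "2 * ennreal (c' - c) = ennreal (2 * (c' - c))" using True by (subst ennreal_mult) auto
      also have "\<dots> \<le> ennreal ((a' - a) + (b' - b))" using t by (intro ennreal_leI) auto
      also have "\<dots> = ennreal (a' - a) + ennreal (b' - b)" using t by (intro ennreal_plus) auto
      finally show ?thesis unfolding a b c using t True by simp
    qed (auto simp: a b c)
  qed
  have "2 * emeasure lborel C \<le> emeasure lborel A + emeasure lborel B"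
  proof -
    have "2 * emeasure lborel C = (\<integral>\<^sup>+x. indicator {x. x \<bullet> u \<in> {0..1}} x * (2 * emeasure lborel {s. x + s *\<^sub>R u \<in> C}) \<partial>lborel)"
      by (subst emeasure_lines[OF u]) (auto simp: nn_integral_cmult[symmetric] mult_ac)
    also have "\<dots> \<le> (\<integral>\<^sup>+x. indicator {x. x \<bullet> u \<in> {0..1}} x * (emeasure lborel {s. x + s *\<^sub>R u \<in> A} + emeasure lborel {s. x + s *\<^sub>R u \<in> B}) \<partial>lborel)"
      by (intro nn_integral_mono mult_left_mono chord) auto
    also have "\<dots> = emeasure lborel A + emeasure lborel B"
      by (subst (1 2) emeasure_lines[OF u]) (auto simp: nn_integral_add[symmetric] distrib_left)
    finally show ?thesis .
  qed
  moreover have "emeasure lborel A < \<infinity>" "emeasure lborel B < \<infinity>" "emeasure lborel C < \<infinity>"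
    using A B C emeasure_compact_finite[of A] emeasure_compact_finite[of B] emeasure_compact_finite[of C]
    unfolding cvx_compact_def by simp_all
  ultimately have "ennreal (2 * measure lborel C) \<le> ennreal (measure lborel A + measure lborel B)"
    by (simp add: emeasure_eq_ennreal_measure ennreal_mult)
  then show ?thesis by (subst (asm) ennreal_le_iff) auto
qed

lemma measure_cvx_compact_mono: "cvx_compact A \<Longrightarrow> cvx_compact B \<Longrightarrow> A \<subseteq> B \<Longrightarrow> measure lborel A \<le> measure lborel B"
  by (rule measure_mono_fmeasurable) (auto simp: cvx_compact_def fmeasurable_compact borel_compact)

text \<open>Monotonicity, convexity along shadow systems and affinity are bundled because they are
  inherited together: affinity turns the first two for \<open>f\<close> into the first two for a
  difference of \<open>f\<close>. Monotonicity makes the coefficients defined later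
  nonnegative.\<close>

definition segment_affine :: "('a::euclidean_space set \<Rightarrow> real) \<Rightarrow> bool" where
  "segment_affine f \<longleftrightarrow>
    (\<forall>A B. cvx_compact A \<longrightarrow> cvx_compact B \<longrightarrow> A \<subseteq> B \<longrightarrow> f A \<le> f B) \<and>
    (\<forall>u A B C. norm u = 1 \<longrightarrow> cvx_compact A \<longrightarrow> cvx_compact B \<longrightarrow> cvx_compact C \<longrightarrow> shadow_mid u A B C \<longrightarrow> f C \<le> (f A + f B) / 2) \<and>
    (\<forall>K v s. cvx_compact K \<longrightarrow> s \<ge> 0 \<longrightarrow> f (K + sym_segment (s *\<^sub>R v)) = f K + s * (f (K + sym_segment v) - f K))"

lemma segment_affineD:
  assumes "segment_affine f"
  shows "cvx_compact A \<Longrightarrow> cvx_compact B \<Longrightarrow> A \<subseteq> B \<Longrightarrow> f A \<le> f B"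
    and "norm u = 1 \<Longrightarrow> cvx_compact A \<Longrightarrow> cvx_compact B \<Longrightarrow> cvx_compact C \<Longrightarrow> shadow_mid u A B C \<Longrightarrow> f C \<le> (f A + f B) / 2"
    and "cvx_compact K \<Longrightarrow> s \<ge> 0 \<Longrightarrow> f (K + sym_segment (s *\<^sub>R v)) = f K + s * (f (K + sym_segment v) - f K)"
  using assms unfolding segment_affine_def by blast+

lemma segment_affine_measure: "segment_affine (measure lborel)"
  unfolding segment_affine_def
proof (intro conjI allI impI)
  fix K :: "'a set" and v :: 'a and s :: real assume K: "cvx_compact K" and s: "s \<ge> 0"
  show "measure lborel (K + sym_segment (s *\<^sub>R v)) = measure lborel K + s * (measure lborel (K + sym_segment v) - measure lborel K)"
  proof (cases "v = 0")
    case True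
    then show ?thesis by (simp add: sym_segment_def set_plus_def)
  next
    case False
    obtain c where "\<forall>s\<ge>0. measure lborel (K + sym_segment (s *\<^sub>R v)) = measure lborel K + s * c"
      using measure_plus_sym_segment[OF K False] by blast
    from this[rule_format, OF s] this[rule_format, of 1] show ?thesis by simp
  qed
qed (fact measure_cvx_compact_mono measure_shadow_mid)+

lemma slope_le:
  fixes p q p' q' :: real
  assumes "\<And>s. s \<ge> 0 \<Longrightarrow> p + s * q \<le> p' + s * q'"
  shows "q \<le> q'"
proof (rule ccontr)
  assume n: "\<not> q \<le> q'"
  define s where "s = (\<bar>p' - p\<bar> + 1) / (q - q')"
  have "s \<ge> 0" "s * (q - q') = \<bar>p' - p\<bar> + 1" using n by (auto simp: s_def)
  with assms[of s] show False by (simp add: algebra_simps)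
qed

text \<open>The properties of the difference are those of the slope in \<open>s\<close> of the affine map \<open>s \<mapsto> f (K + [-s v, s v])\<close>.\<close>

lemma segment_affine_diff:
  assumes f: "segment_affine f"
  shows "segment_affine (\<lambda>K. f (K + sym_segment v) - f K)"
  unfolding segment_affine_def
proof (intro conjI allI impI)
  fix A B :: "'a set" assume A: "cvx_compact A" and B: "cvx_compact B" and AB: "A \<subseteq> B"
  show "f (A + sym_segment v) - f A \<le> f (B + sym_segment v) - f B"
  proof (rule slope_le)
    fix s :: real assume s: "s \<ge> 0"
    have "f (A + sym_segment (s *\<^sub>R v)) \<le> f (B + sym_segment (s *\<^sub>R v))"
      by (intro segment_affineD(1)[OF f] cvx_compact_plus A B cvx_compact_segment set_plus_mono2 AB order_refl)
    then show "f A + s * (f (A + sym_segment v) - f A) \<le> f B + s * (f (B + sym_segment v) - f B)"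
      using segment_affineD(3)[OF f A s, of v] segment_affineD(3)[OF f B s, of v] by simp
  qed
next
  fix u :: 'a and A B C :: "'a set" assume u: "norm u = 1" and A: "cvx_compact A" and B: "cvx_compact B" and C: "cvx_compact C" and sh: "shadow_mid u A B C"
  show "f (C + sym_segment v) - f C \<le> (f (A + sym_segment v) - f A + (f (B + sym_segment v) - f B)) / 2"
  proof (rule slope_le)
    fix s :: real assume s: "s \<ge> 0"
    have "f (C + sym_segment (s *\<^sub>R v)) \<le> (f (A + sym_segment (s *\<^sub>R v)) + f (B + sym_segment (s *\<^sub>R v))) / 2"
      by (intro segment_affineD(2)[OF f u] cvx_compact_plus A B C cvx_compact_segment shadow_mid_plus sh)
    then show "f C + s * (f (C + sym_segment v) - f C) \<le> (f A + f B) / 2 + s * ((f (A + sym_segment v) - f A + (f (B + sym_segment v) - f B)) / 2)"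
      using segment_affineD(3)[OF f A s, of v] segment_affineD(3)[OF f B s, of v] segment_affineD(3)[OF f C s, of v] by (simp add: field_simps)
  qed
next
  fix K :: "'a set" and w :: 'a and s :: real assume K: "cvx_compact K" and s: "s \<ge> 0"
  have "K + sym_segment (s *\<^sub>R w) + sym_segment v = K + sym_segment v + sym_segment (s *\<^sub>R w)" "K + sym_segment w + sym_segment v = K + sym_segment v + sym_segment w"
    by (simp_all add: ac_simps)
  then show "f (K + sym_segment (s *\<^sub>R w) + sym_segment v) - f (K + sym_segment (s *\<^sub>R w)) =
    f (K + sym_segment v) - f K + s * (f (K + sym_segment w + sym_segment v) - f (K + sym_segment w) - (f (K + sym_segment v) - f K))"
    using segment_affineD(3)[OF f K s, of w] segment_affineD(3)[OF f cvx_compact_plus[OF K cvx_compact_segment[of v]] s, of w] by (simp add: algebra_simps)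
qed

lemma segment_affine_add:
  assumes "segment_affine f" "segment_affine g"
  shows "segment_affine (\<lambda>K. f K + g K)"
  unfolding segment_affine_def
proof (intro conjI allI impI)
  fix K :: "'a set" and v :: 'a and s :: real assume "cvx_compact K" "s \<ge> 0"
  then show "f (K + sym_segment (s *\<^sub>R v)) + g (K + sym_segment (s *\<^sub>R v)) = f K + g K + s * (f (K + sym_segment v) + g (K + sym_segment v) - (f K + g K))"
    using segment_affineD(3)[OF assms(1)] segment_affineD(3)[OF assms(2)] by (simp add: algebra_simps)
next
  fix u :: 'a and A B C :: "'a set" assume "norm u = 1" "cvx_compact A" "cvx_compact B" "cvx_compact C" "shadow_mid u A B C"
  then show "f C + g C \<le> (f A + g A + (f B + g B)) / 2"
    using segment_affineD(2)[OF assms(1), of u A B C] segment_affineD(2)[OF assms(2), of u A B C] by simp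
qed (auto intro!: add_mono segment_affineD(1)[OF assms(1)] segment_affineD(1)[OF assms(2)])

section \<open>Zonotopes and the polynomial expansion of volume\<close>

primrec zonotope :: "'a::euclidean_space list \<Rightarrow> 'a set" where
  "zonotope [] = {0}"
| "zonotope (v # vs) = sym_segment v + zonotope vs"

lemma cvx_compact_zonotope [simp]: "cvx_compact (zonotope vs)"
  by (induction vs) (auto intro!: cvx_compact_plus simp del: cvx_compact_def, simp add: cvx_compact_def)

lemma zonotope_scale: "zonotope (map ((*\<^sub>R) s) vs) = (*\<^sub>R) s ` zonotope vs"
proof (induction vs)
  case (Cons v vs)
  have "sym_segment (s *\<^sub>R v) = (*\<^sub>R) s ` sym_segment v" by (auto simp: sym_segment_alt image_image mult.commute)
  then show ?case using Cons by (force simp: set_plus_def scaleR_add_right image_def)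
qed simp

text \<open>\<open>zonotope_coeff vs k K\<close> is the coefficient of \<open>s ^ k\<close> in the volume of \<open>K + s Z\<close>, where \<open>Z\<close> is the zonotope of \<open>vs\<close>.\<close>

primrec zonotope_coeff :: "'a::euclidean_space list \<Rightarrow> nat \<Rightarrow> 'a set \<Rightarrow> real" where
  "zonotope_coeff [] k K = (if k = 0 then measure lborel K else 0)"
| "zonotope_coeff (v # vs) k K =
    zonotope_coeff vs k K + (if k = 0 then 0 else zonotope_coeff vs (k - 1) (K + sym_segment v) - zonotope_coeff vs (k - 1) K)"

lemma segment_affine_zero: "segment_affine (\<lambda>_. 0)" unfolding segment_affine_def by simp

lemma segment_affine_zonotope_coeff: "segment_affine (zonotope_coeff vs k)"
proof (induction vs arbitrary: k)
  case Nil
  show ?case using segment_affine_measure segment_affine_zero by (cases "k = 0") (auto simp: fun_eq_iff cong: if_cong)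
next
  case (Cons v vs)
  have "zonotope_coeff (v # vs) k = (\<lambda>K. zonotope_coeff vs k K + (if k = 0 then 0 else zonotope_coeff vs (k - 1) (K + sym_segment v) - zonotope_coeff vs (k - 1) K))"
    by (rule ext) simp
  then show ?case using segment_affine_add[OF Cons[of k] segment_affine_diff[OF Cons[of "k-1"], of v]] Cons[of k] by (cases "k = 0") auto
qed

text \<open>Every difference in the recursion is nonnegative by monotonicity, since
  \<open>K \<subseteq> K + sym_segment v\<close>. This allows a single term to be bounded by the
  whole polynomial.\<close>

lemma zonotope_coeff_nonneg: "cvx_compact K \<Longrightarrow> zonotope_coeff vs k K \<ge> 0"
proof (induction vs arbitrary: k)
  case (Cons v vs)
  then show ?case
    using segment_affineD(1)[OF segment_affine_zonotope_coeff, OF Cons.prems cvx_compact_plus[OF Cons.prems cvx_compact_segment] subset_plus_sym_segment] by simp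
qed simp

lemma zonotope_coeff_gt_length: "k > length vs \<Longrightarrow> zonotope_coeff vs k K = 0"
  by (induction vs arbitrary: k K) auto

lemma measure_plus_zonotope:
  assumes K: "cvx_compact K" and s: "s \<ge> 0"
  shows "measure lborel (K + (*\<^sub>R) s ` zonotope vs) = (\<Sum>k\<le>length vs. zonotope_coeff vs k K * s ^ k)"
  unfolding zonotope_scale[symmetric] using K
proof (induction vs arbitrary: K)
  case Nil
  have "K + {0} = K" by (simp add: set_plus_def)
  then show ?case by simp
next
  case (Cons v vs)
  let ?Z = "zonotope (map ((*\<^sub>R) s) vs)"
  have eq: "K + zonotope (map ((*\<^sub>R) s) (v # vs)) = K + ?Z + sym_segment (s *\<^sub>R v)" "K + ?Z + sym_segment v = K + sym_segment v + ?Z" by (simp_all add: ac_simps)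
  \<comment> \<open>Affinity trades the scaled segment for the unscaled one, so that the induction
    hypothesis applies to \<open>K\<close> and \<open>K + sym_segment v\<close>, neither of which
    depends on \<open>s\<close>.\<close>
  have "measure lborel (K + zonotope (map ((*\<^sub>R) s) (v # vs))) = measure lborel (K + ?Z) + s * (measure lborel (K + sym_segment v + ?Z) - measure lborel (K + ?Z))"
    unfolding eq(1) by (subst segment_affineD(3)[OF segment_affine_measure cvx_compact_plus[OF Cons.prems cvx_compact_zonotope] s]) (simp add: eq(2))
  also have "\<dots> = (\<Sum>k\<le>length vs. zonotope_coeff vs k K * s ^ k) + s * (\<Sum>k\<le>length vs. (zonotope_coeff vs k (K + sym_segment v) - zonotope_coeff vs k K) * s ^ k)"
    using Cons.IH[OF Cons.prems] Cons.IH[OF cvx_compact_plus[OF Cons.prems cvx_compact_segment[of v]]] by (simp add: sum_subtractf algebra_simps)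
  also have "(\<Sum>k\<le>length vs. zonotope_coeff vs k K * s ^ k) = (\<Sum>k\<le>Suc (length vs). zonotope_coeff vs k K * s ^ k)"
    by (simp add: zonotope_coeff_gt_length)
  also have "s * (\<Sum>k\<le>length vs. (zonotope_coeff vs k (K + sym_segment v) - zonotope_coeff vs k K) * s ^ k) =
    (\<Sum>k\<le>Suc (length vs). (if k = 0 then 0 else zonotope_coeff vs (k - 1) (K + sym_segment v) - zonotope_coeff vs (k - 1) K) * s ^ k)"
    by (subst sum.atMost_Suc_shift) (simp add: sum_distrib_left mult_ac)
  also have "(\<Sum>k\<le>Suc (length vs). zonotope_coeff vs k K * s ^ k) + \<dots> = (\<Sum>k\<le>length (v # vs). zonotope_coeff (v # vs) k K * s ^ k)"
    unfolding sum.distrib[symmetric] by (simp add: distrib_right)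
  finally show ?case .
qed

text \<open>The formal degree is the number of segments, but for \<open>s \<ge> 1\<close> the sum
  lies in a ball of radius \<open>(r + q) * s\<close>, so the volume grows at most like the power of
  \<open>s\<close> given by the dimension. With nonnegative coefficients this leaves no room for a
  higher term.\<close>

lemma zonotope_coeff_eq_0:
  fixes K :: "'a::euclidean_space set"
  assumes K: "cvx_compact K" and k: "k > DIM('a)"
  shows "zonotope_coeff vs k K = 0"
proof (cases "k \<le> length vs")
  case True
  obtain r where r: "K \<subseteq> cball 0 r" "r > 0"
    using K bounded_subset_ballD[of K 0] compact_imp_bounded unfolding cvx_compact_def by (metis ball_subset_cball subset_trans)
  obtain q where q: "zonotope vs \<subseteq> cball 0 q" "q > 0"
    using cvx_compact_zonotope[of vs] bounded_subset_ballD[of "zonotope vs" 0] compact_imp_bounded unfolding cvx_compact_def by (metis ball_subset_cball subset_trans)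
  define C where "C = unit_ball_vol (real DIM('a)) * (r + q) ^ DIM('a)"
  have bound: "zonotope_coeff vs k K \<le> C / s" if s: "s \<ge> 1" for s
  proof -
    have "zonotope_coeff vs k K * s ^ k \<le> (\<Sum>k\<le>length vs. zonotope_coeff vs k K * s ^ k)"
      using True s zonotope_coeff_nonneg[OF K] by (intro member_le_sum) auto
    also have "\<dots> = measure lborel (K + (*\<^sub>R) s ` zonotope vs)" using measure_plus_zonotope[OF K] s by simp
    also have "\<dots> \<le> measure lborel (cball (0::'a) ((r + q) * s))"
    proof (rule measure_cvx_compact_mono)
      show "K + (*\<^sub>R) s ` zonotope vs \<subseteq> cball 0 ((r + q) * s)"
      proof
        fix x assume "x \<in> K + (*\<^sub>R) s ` zonotope vs"
        then obtain y z where "y \<in> K" "z \<in> zonotope vs" "x = y + s *\<^sub>R z" by (auto simp: set_plus_def)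
        moreover from this have "norm y \<le> r" "norm z \<le> q" using r q by auto
        moreover have "r \<le> r * s" using s r by simp
        moreover have "norm (s *\<^sub>R z) \<le> s * q" using s calculation by (simp add: mult_left_mono)
        moreover have "norm x \<le> norm y + norm (s *\<^sub>R z)" using calculation(3) norm_triangle_ineq[of y "s *\<^sub>R z"] by simp
        ultimately show "x \<in> cball 0 ((r + q) * s)" by (simp add: algebra_simps)
      qed
      show "cvx_compact (cball (0::'a) ((r + q) * s))" unfolding cvx_compact_def using r q s by (auto simp: not_less)
    qed (unfold zonotope_scale[symmetric], intro cvx_compact_plus K cvx_compact_zonotope)
    also have "\<dots> = C * s ^ DIM('a)" unfolding C_def using r q s by (subst content_cball) (auto simp: power_mult_distrib)
    also have "\<dots> \<le> C * s ^ (k - 1)" unfolding C_def using r q s k by (intro mult_left_mono power_increasing) auto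
    finally have "zonotope_coeff vs k K * s * s ^ (k - 1) \<le> C * s ^ (k - 1)" using k by (cases k) (auto simp: mult_ac)
    then show ?thesis using s by (simp add: field_simps)
  qed
  have "((\<lambda>s. C / s) \<longlongrightarrow> 0) at_top" by real_asymp
  then have "zonotope_coeff vs k K \<le> 0"
    by (rule tendsto_lowerbound) (auto intro!: eventually_at_top_linorderI[of 1] bound)
  with zonotope_coeff_nonneg[OF K, of vs k] show ?thesis by simp
qed (simp add: zonotope_coeff_gt_length)

lemma measure_plus_zonotope':
  fixes K :: "'a::euclidean_space set"
  assumes K: "cvx_compact K" and s: "s \<ge> 0"
  shows "measure lborel (K + (*\<^sub>R) s ` zonotope vs) = (\<Sum>k\<le>DIM('a). zonotope_coeff vs k K * s ^ k)"
proof -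
  have "(\<Sum>k\<le>length vs. zonotope_coeff vs k K * s ^ k) = (\<Sum>k\<le>length vs + DIM('a). zonotope_coeff vs k K * s ^ k)"
    by (rule sum.mono_neutral_left) (auto simp: zonotope_coeff_gt_length)
  also have "\<dots> = (\<Sum>k\<le>DIM('a). zonotope_coeff vs k K * s ^ k)"
    by (rule sum.mono_neutral_right) (auto simp: zonotope_coeff_eq_0[OF K])
  finally show ?thesis using measure_plus_zonotope[OF K s] by simp
qed

section \<open>The Steiner formula\<close>

text \<open>If a hyperplane with normal \<open>a\<close> strictly separated a point of the ball from
  \<open>Z\<close>, the assumption in the direction opposite to \<open>a\<close> would give a point
  of \<open>Z\<close> on the wrong side.\<close>

lemma ball_subset_of_support:
  fixes Z :: "'a::euclidean_space set"
  assumes Z: "cvx_compact Z" and r: "\<And>u. norm u = 1 \<Longrightarrow> \<exists>z\<in>Z. r \<le> z \<bullet> u"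
  shows "cball 0 r \<subseteq> Z"
proof
  fix p :: 'a assume p: "p \<in> cball 0 r"
  show "p \<in> Z"
  proof (rule ccontr)
    assume "p \<notin> Z"
    then obtain a b where ab: "a \<bullet> p < b" "\<And>x. x \<in> Z \<Longrightarrow> b < a \<bullet> x"
      using separating_hyperplane_closed_point[of Z p] Z compact_imp_closed[of Z] unfolding cvx_compact_def by auto
    have "a \<noteq> 0" using ab Z unfolding cvx_compact_def by force
    define u where "u = - (a /\<^sub>R norm a)"
    have u: "norm u = 1" using \<open>a \<noteq> 0\<close> by (simp add: u_def)
    then obtain z where z: "z \<in> Z" "r \<le> z \<bullet> u" using r by blast
    have "norm a * r \<le> norm a * (z \<bullet> u)" using z by (intro mult_left_mono) auto
    also have "norm a * (z \<bullet> u) = - (a \<bullet> z)" using \<open>a \<noteq> 0\<close> by (simp add: u_def inner_commute)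
    finally have "norm a * r \<le> - (a \<bullet> z)" .
    moreover have "- (a \<bullet> p) \<le> norm a * norm p" using Cauchy_Schwarz_ineq2[of a p] by linarith
    moreover have "norm a * norm p \<le> norm a * r" using p by (intro mult_left_mono) auto
    ultimately show False using ab(1) ab(2)[OF z(1)] by linarith
  qed
qed

text \<open>The support function of \<open>zonotope vs\<close>, by the two lemmas that
  follow.\<close>

definition zonotope_support :: "'a::euclidean_space list \<Rightarrow> 'a \<Rightarrow> real" where
  "zonotope_support vs u = (\<Sum>v\<leftarrow>vs. \<bar>v \<bullet> u\<bar>)"

lemma zonotope_support_upper: "z \<in> zonotope vs \<Longrightarrow> z \<bullet> u \<le> zonotope_support vs u"
proof (induction vs arbitrary: z)
  case (Cons v vs)
  then obtain t y where z: "y \<in> zonotope vs" "t \<in> {-1..1}" "z = t *\<^sub>R v + y" by (auto simp: sym_segment_alt set_plus_def)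
  have "t * (v \<bullet> u) \<le> \<bar>t\<bar> * \<bar>v \<bullet> u\<bar>" by (metis abs_ge_self abs_mult)
  also have "\<dots> \<le> 1 * \<bar>v \<bullet> u\<bar>" using z by (intro mult_right_mono) auto
  finally show ?case using Cons.IH[OF z(1)] z(3) by (simp add: zonotope_support_def inner_left_distrib)
qed (simp add: zonotope_support_def)

lemma zonotope_support_attained: "\<exists>z\<in>zonotope vs. z \<bullet> u = zonotope_support vs u"
proof (induction vs)
  case (Cons v vs)
  then obtain y where y: "y \<in> zonotope vs" "y \<bullet> u = zonotope_support vs u" by auto
  have "sgn (v \<bullet> u) *\<^sub>R v \<in> sym_segment v" unfolding sym_segment_alt by (intro imageI) (auto simp: sgn_if)
  then have "sgn (v \<bullet> u) *\<^sub>R v + y \<in> zonotope (v # vs)" using y by (auto intro: set_plus_intro)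
  moreover have "(sgn (v \<bullet> u) *\<^sub>R v + y) \<bullet> u = zonotope_support (v # vs) u"
    using y by (simp add: zonotope_support_def inner_left_distrib sgn_if)
  ultimately show ?case by blast
qed (simp add: zonotope_support_def)

lemma zonotope_support_scale: "zonotope_support (map ((*\<^sub>R) c) vs) u = \<bar>c\<bar> * zonotope_support vs u"
  by (induction vs) (auto simp: zonotope_support_def abs_mult algebra_simps)

lemma set_integrable_abs_inner:
  fixes E :: "'a::euclidean_space set"
  assumes "E \<in> sets borel" "E \<subseteq> cball 0 1"
  shows "set_integrable lborel E (\<lambda>v. \<bar>v \<bullet> u\<bar>)"
proof (rule set_integrable_subset)
  show "set_integrable lborel (cball 0 1) (\<lambda>v. \<bar>v \<bullet> u\<bar>)"
    unfolding set_integrable_def by (intro borel_integrable_compact continuous_intros) simp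
qed (use assms in auto)

text \<open>Each ball of the cover cuts a piece off \<open>E\<close>; its centre, weighted by the
  volume of the piece, becomes the generator of one segment. The list is chosen before
  \<open>u\<close>, so the estimate holds for all directions at once, as is needed to compare
  sets.\<close>

lemma riemann_sum_abs_inner:
  fixes E :: "'a::euclidean_space set"
  assumes "E \<in> sets borel" "E \<subseteq> cball 0 1" "E \<subseteq> (\<Union>p\<in>set ps. ball p d)"
  shows "\<exists>vs. \<forall>u. \<bar>(LINT v:E|lborel. \<bar>v \<bullet> u\<bar>) - zonotope_support vs u\<bar> \<le> d * norm u * measure lborel E"
  using assms
proof (induction ps arbitrary: E)
  case Nil
  then show ?case by (intro exI[of _ "[]"]) (simp add: zonotope_support_def set_lebesgue_integral_def)
next
  case (Cons p ps)
  define E1 where "E1 = E \<inter> ball p d" define E2 where "E2 = E - ball p d"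
  have [measurable]: "E1 \<in> sets borel" "E2 \<in> sets borel" using Cons.prems by (auto simp: E1_def E2_def)
  have E: "E = E1 \<union> E2" "E1 \<inter> E2 = {}" by (auto simp: E1_def E2_def)
  have sub: "E1 \<subseteq> cball 0 1" "E2 \<subseteq> cball 0 1" using Cons.prems by (auto simp: E1_def E2_def)
  have fin: "emeasure lborel E1 < \<infinity>" "emeasure lborel E2 < \<infinity>"
    using emeasure_mono[OF sub(1), of lborel] emeasure_mono[OF sub(2), of lborel] emeasure_lborel_cball_finite[of "0::'a" 1]
    by (simp_all add: le_less_trans)
  have "E2 \<subseteq> (\<Union>p\<in>set ps. ball p d)" using Cons.prems by (auto simp: E2_def)
  then obtain vs where vs: "\<And>u. \<bar>(LINT v:E2|lborel. \<bar>v \<bullet> u\<bar>) - zonotope_support vs u\<bar> \<le> d * norm u * measure lborel E2"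
    using Cons.IH[of E2] sub by auto
  show ?case
  proof (intro exI allI)
    fix u :: 'a
    have i1: "set_integrable lborel E1 (\<lambda>v. \<bar>v \<bullet> u\<bar>)" and i2: "set_integrable lborel E2 (\<lambda>v. \<bar>v \<bullet> u\<bar>)"
      using sub by (auto intro!: set_integrable_abs_inner)
    have ic: "set_integrable lborel E1 (\<lambda>v. c)" for c :: real
      unfolding set_integrable_def using fin by (intro integrable_scaleR_left integrable_real_indicator) auto
    have c: "(LINT v:E1|lborel. c) = measure lborel E1 * c" for c
      using fin by (simp add: set_lebesgue_integral_def)
    have split: "(LINT v:E|lborel. \<bar>v \<bullet> u\<bar>) = (LINT v:E1|lborel. \<bar>v \<bullet> u\<bar>) + (LINT v:E2|lborel. \<bar>v \<bullet> u\<bar>)"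
      unfolding E(1) by (intro set_integral_Un E(2) i1 i2)
    have meas: "measure lborel E = measure lborel E1 + measure lborel E2"
      using fin unfolding E(1) by (intro measure_Union E(2)) auto
    have "\<bar>(LINT v:E1|lborel. \<bar>v \<bullet> u\<bar>) - measure lborel E1 * \<bar>p \<bullet> u\<bar>\<bar> = \<bar>LINT v:E1|lborel. \<bar>v \<bullet> u\<bar> - \<bar>p \<bullet> u\<bar>\<bar>"
      using i1 ic by (simp add: set_integral_diff c)
    also have "\<dots> \<le> (LINT v:E1|lborel. \<bar>\<bar>v \<bullet> u\<bar> - \<bar>p \<bullet> u\<bar>\<bar>)"
      using set_integral_norm_bound[OF set_integral_diff(1)[OF i1 ic[of "\<bar>p \<bullet> u\<bar>"]]] by simp
    also have "\<dots> \<le> (LINT v:E1|lborel. d * norm u)"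
    proof (rule set_integral_mono[OF set_integrable_abs[OF set_integral_diff(1)[OF i1 ic]] ic])
      fix v assume "v \<in> E1"
      then have "norm (v - p) \<le> d" by (auto simp: E1_def dist_norm norm_minus_commute)
      have "\<bar>\<bar>v \<bullet> u\<bar> - \<bar>p \<bullet> u\<bar>\<bar> \<le> \<bar>(v - p) \<bullet> u\<bar>" by (simp add: inner_diff_left)
      also have "\<dots> \<le> norm (v - p) * norm u" by (rule Cauchy_Schwarz_ineq2)
      also have "\<dots> \<le> d * norm u" using \<open>norm (v - p) \<le> d\<close> by (intro mult_right_mono) auto
      finally show "\<bar>\<bar>v \<bullet> u\<bar> - \<bar>p \<bullet> u\<bar>\<bar> \<le> d * norm u" .
    qed
    finally have 1: "\<bar>(LINT v:E1|lborel. \<bar>v \<bullet> u\<bar>) - measure lborel E1 * \<bar>p \<bullet> u\<bar>\<bar> \<le> measure lborel E1 * (d * norm u)"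
      by (simp add: c mult_ac)
    have "zonotope_support (measure lborel E1 *\<^sub>R p # vs) u = measure lborel E1 * \<bar>p \<bullet> u\<bar> + zonotope_support vs u"
      by (simp add: zonotope_support_def abs_mult)
    with 1 vs[of u] show "\<bar>(LINT v:E|lborel. \<bar>v \<bullet> u\<bar>) - zonotope_support (measure lborel E1 *\<^sub>R p # vs) u\<bar> \<le> d * norm u * measure lborel E"
      unfolding split meas by (simp add: algebra_simps)
  qed
qed

text \<open>This is the reflection in the hyperplane bisecting \<open>u\<close> and
  \<open>u'\<close>; such reflections replace rotations in moving unit vectors onto each
  other.\<close>

lemma reflection_exchange:
  assumes "norm u = norm u'" "u \<noteq> u'"
  defines "w \<equiv> (u - u') /\<^sub>R norm (u - u')"
  shows "norm w = 1" "reflection w u = u'"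
proof -
  show "norm w = 1" using assms by (simp add: w_def)
  have "norm (u - u') ^ 2 = 2 * (u \<bullet> (u - u'))"
    using arg_cong[OF assms(1), of "\<lambda>r. r ^ 2"]
    by (simp add: inner_diff_left inner_diff_right inner_commute power2_norm_eq_inner)
  then have "2 * (u \<bullet> w) = norm (u - u')"
    using assms(2) by (simp add: w_def divide_simps power2_eq_square)
  then show "reflection w u = u'" using assms(2) by (simp add: reflection_def w_def)
qed

lemma reflection_adjoint: "reflection w v \<bullet> u = v \<bullet> reflection w u"
  unfolding reflection_def by (simp add: inner_diff_left inner_diff_right inner_commute)

text \<open>A reflection taking \<open>u\<close> to \<open>u'\<close> is self-adjoint and preserves
  the ball and Lebesgue measure. As a function of \<open>u\<close>, the integral is thus a multiple
  of the norm, that is, the support function of a ball.\<close>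

lemma integral_ball_abs_inner:
  fixes u u' :: "'a::euclidean_space"
  assumes "norm u = norm u'"
  shows "(LINT v:cball 0 1|lborel. \<bar>v \<bullet> u\<bar>) = (LINT v:cball 0 1|lborel. \<bar>v \<bullet> u'\<bar>)"
proof (cases "u = u'")
  case False
  define w where "w = (u - u') /\<^sub>R norm (u - u')"
  have w: "norm w = 1" "reflection w u = u'" using reflection_exchange[OF assms False] by (auto simp: w_def)
  have "(LINT v:cball 0 1|lborel. \<bar>v \<bullet> u\<bar>) = (LINT v|distr lborel lborel (reflection w). indicator (cball 0 1) v *\<^sub>R \<bar>v \<bullet> u\<bar>)"
    unfolding set_lebesgue_integral_def distr_lborel_reflection[OF w(1)] ..
  also have "\<dots> = (LINT v|lborel. indicator (cball 0 1) (reflection w v) *\<^sub>R \<bar>reflection w v \<bullet> u\<bar>)"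
    by (rule integral_distr) (auto intro!: borel_measurable_times borel_measurable_indicator)
  also have "\<dots> = (LINT v:cball 0 1|lborel. \<bar>v \<bullet> u'\<bar>)"
    unfolding set_lebesgue_integral_def reflection_adjoint w(2) using w(1) by (simp add: indicator_def norm_reflection)
  finally show ?thesis .
qed simp

lemma integral_ball_abs_inner_pos:
  fixes u :: "'a::euclidean_space"
  assumes u: "norm u = 1"
  shows "(LINT v:cball 0 1|lborel. \<bar>v \<bullet> u\<bar>) > 0"
proof -
  \<comment> \<open>Within distance 1/4 of \<open>u / 2\<close> the inner product with
    \<open>u\<close> is at least 1/4.\<close>
  let ?B = "cball ((1/2) *\<^sub>R u) (1/4)"
  have sub: "?B \<subseteq> cball 0 1"
    using u by (simp add: cball_subset_cball_iff)
  have "0 < measure lborel ?B * (1/4)"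
    by (subst content_cball) auto
  also have "\<dots> = (LINT v:?B|lborel. 1/4)"
    using emeasure_lborel_cball_finite[of "(1/2) *\<^sub>R u" "1/4"] by (simp add: set_lebesgue_integral_def)
  also have "\<dots> \<le> (LINT v:?B|lborel. \<bar>v \<bullet> u\<bar>)"
  proof (rule set_integral_mono)
    show "set_integrable lborel ?B (\<lambda>v. 1/4 :: real)"
      unfolding set_integrable_def using emeasure_lborel_cball_finite[of "(1/2) *\<^sub>R u" "1/4"]
      by (intro integrable_scaleR_left integrable_real_indicator) auto
    show "set_integrable lborel ?B (\<lambda>v. \<bar>v \<bullet> u\<bar>)" by (rule set_integrable_abs_inner[OF _ sub]) simp
    fix v assume "v \<in> ?B"
    then have "norm (v - (1/2) *\<^sub>R u) \<le> 1/4" by (simp add: dist_norm norm_minus_commute)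
    moreover have "\<bar>(v - (1/2) *\<^sub>R u) \<bullet> u\<bar> \<le> norm (v - (1/2) *\<^sub>R u) * norm u" by (rule Cauchy_Schwarz_ineq2)
    moreover have "(v - (1/2) *\<^sub>R u) \<bullet> u = v \<bullet> u - 1/2" using u by (simp add: inner_diff_left norm_eq_1)
    ultimately show "1/4 \<le> \<bar>v \<bullet> u\<bar>" using u by simp
  qed
  also have "\<dots> \<le> (LINT v:cball 0 1|lborel. \<bar>v \<bullet> u\<bar>)"

    using set_integrable_abs_inner[OF _ sub, of u] set_integrable_abs_inner[of "cball 0 1" u] sub
    unfolding set_lebesgue_integral_def set_integrable_def
    by (intro integral_mono) (auto simp: indicator_def)
  finally show ?thesis .
qed

text \<open>The integral of \<open>\<bar>v \<bullet> u\<bar>\<close> over the unit ball is a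
  constant \<open>c\<close> on the sphere. A Riemann sum for it is the support function of a
  zonotope and differs from \<open>c\<close> by at most \<open>d\<close>; division by
  \<open>c - d\<close> puts the zonotope between the two balls.\<close>

lemma zonotope_approx_ball:
  assumes e: "e > 0"
  shows "\<exists>vs :: 'a::euclidean_space list. cball 0 1 \<subseteq> zonotope vs \<and> zonotope vs \<subseteq> cball 0 (1 + e)"
proof -
  obtain b :: 'a where b: "b \<in> Basis" using nonempty_Basis by blast
  define c where "c = (LINT v:cball 0 1|lborel. \<bar>v \<bullet> b\<bar>)"
  define V where "V = measure lborel (cball (0::'a) 1)"
  have V: "V > 0" unfolding V_def by (subst content_cball) auto
  have c: "c > 0" using b unfolding c_def by (intro integral_ball_abs_inner_pos) simp
  \<comment> \<open>Chosen so that \<open>(c + d) / (c - d) = 1 + e\<close>. The mesh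
    \<open>d / V\<close> of the cover below makes the error of the Riemann sum at most
    \<open>d\<close>.\<close>
  define d where "d = c * e / (2 + e)"
  have d: "d > 0" "d < c" using c e by (auto simp: d_def field_simps)
  have "cball (0::'a) 1 \<subseteq> (\<Union>x\<in>cball 0 1. ball x (d / V))" using d V by auto
  then obtain P where P: "P \<subseteq> cball 0 1" "finite P" "cball (0::'a) 1 \<subseteq> (\<Union>x\<in>P. ball x (d / V))"
    by (rule compactE_image[OF compact_cball open_ball])
  then obtain ps where ps: "set ps = P" using finite_list by blast
  obtain vs :: "'a list" where vs: "\<And>u. \<bar>(LINT v:cball 0 1|lborel. \<bar>v \<bullet> u\<bar>) - zonotope_support vs u\<bar> \<le> d / V * norm u * V"
    using riemann_sum_abs_inner[of "cball (0::'a) 1" "d/V" ps] P ps unfolding V_def by auto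
  have sup: "\<bar>c - zonotope_support vs u\<bar> \<le> d" if "norm u = 1" for u
    using vs[of u] integral_ball_abs_inner[of u b] that b V unfolding c_def by simp
  define ws where "ws = map ((*\<^sub>R) (1 / (c - d))) vs"
  have s: "1 \<le> zonotope_support ws u" "zonotope_support ws u \<le> 1 + e" if "norm u = 1" for u
  proof -
    have *: "zonotope_support ws u = zonotope_support vs u / (c - d)"
      unfolding ws_def using d by (simp add: zonotope_support_scale)
    have "c - d \<le> zonotope_support vs u" "zonotope_support vs u \<le> c + d" using sup[OF that] by auto
    moreover have "(1 + e) * (c - d) = c + d" using e by (simp add: d_def field_simps)
    ultimately show "1 \<le> zonotope_support ws u" "zonotope_support ws u \<le> 1 + e"
      unfolding * using d by (simp_all add: field_simps)
  qed
  have "cball 0 1 \<subseteq> zonotope ws"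
  proof (rule ball_subset_of_support)
    fix u :: 'a assume "norm u = 1"
    then show "\<exists>z\<in>zonotope ws. 1 \<le> z \<bullet> u" using s(1)[of u] zonotope_support_attained[of ws u] by metis
  qed simp
  moreover have "z \<in> cball 0 (1 + e)" if z: "z \<in> zonotope ws" for z
  proof (cases "z = 0")
    case False
    then have "norm z = z \<bullet> (z /\<^sub>R norm z)" by (simp add: dot_square_norm power2_eq_square)
    also have "\<dots> \<le> zonotope_support ws (z /\<^sub>R norm z)" by (rule zonotope_support_upper[OF z])
    also have "\<dots> \<le> 1 + e" using False by (intro s) simp
    finally show ?thesis by simp
  qed (use e in simp)
  ultimately show ?thesis by blast
qed

text \<open>The weights are the coefficients of the Lagrange basis polynomials \<open>l i\<close> at
  the nodes 1, ..., n + 1. They do not depend on \<open>c\<close>, so convergence of values gives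
  convergence of coefficients.\<close>

lemma polynomial_coefficients_from_values:
  "\<exists>L :: nat \<Rightarrow> nat \<Rightarrow> real. \<forall>c. \<forall>k\<le>n. c k = (\<Sum>i\<le>n. L k i * (\<Sum>j\<le>n. c j * real (Suc i) ^ j))"
proof -
  define l where "l i = (\<Prod>j\<in>{..n}-{i}. smult (1 / (real (Suc i) - real (Suc j))) [:- real (Suc j), 1:])" for i
  have deg: "degree (l i) \<le> n" if "i \<le> n" for i
  proof -
    have "degree (l i) \<le> (\<Sum>j\<in>{..n}-{i}. degree (smult (1 / (real (Suc i) - real (Suc j))) [:- real (Suc j), 1:]))"
      unfolding l_def by (rule degree_prod_sum_le[unfolded o_def]) simp
    also have "\<dots> \<le> (\<Sum>j\<in>{..n}-{i}. 1)" by (intro sum_mono) auto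
    also have "\<dots> = n" using that by simp
    finally show ?thesis .
  qed
  have val: "poly (l i) (real (Suc m)) = (if i = m then 1 else 0)" if "i \<le> n" "m \<le> n" for i m
  proof (cases "i = m")
    case True
    then show ?thesis unfolding l_def poly_prod by (auto intro!: prod.neutral simp: divide_simps)
  next
    case False
    then show ?thesis using that unfolding l_def poly_prod
      by (auto intro!: prod_zero bexI[of _ m] simp: divide_simps)
  qed
  have "c k = (\<Sum>i\<le>n. coeff (l i) k * (\<Sum>j\<le>n. c j * real (Suc i) ^ j))" if k: "k \<le> n" for c k
  proof -
    define p where "p = (\<Sum>j\<le>n. monom (c j) j)"
    define q where "q = (\<Sum>i\<le>n. smult (poly p (real (Suc i))) (l i))"
    have pv: "poly p x = (\<Sum>j\<le>n. c j * x ^ j)" for x unfolding p_def by (simp add: poly_sum poly_monom)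
    have "p = q"
    proof (rule poly_eqI_degree)
      fix x assume "x \<in> (\<lambda>i. real (Suc i)) ` {..n}"
      then obtain m where m: "m \<le> n" "x = real (Suc m)" by auto
      have "poly q x = (\<Sum>i\<le>n. if i = m then poly p (real (Suc m)) else 0)"
        unfolding q_def poly_sum using m val by (intro sum.cong) (auto simp del: of_nat_Suc)
      also have "\<dots> = poly p x" using m by simp
      finally show "poly p x = poly q x" by simp
    next
      have card: "card ((\<lambda>i. real (Suc i)) ` {..n}) = Suc n" by (subst card_image) (auto intro: inj_onI)
      have "degree p \<le> n" unfolding p_def by (intro degree_sum_le) (auto intro: order_trans[OF degree_monom_le])
      then show "degree p < card ((\<lambda>i. real (Suc i)) ` {..n})" using card by simp
      have "degree q \<le> n" unfolding q_def using deg by (intro degree_sum_le) (auto intro: order_trans[OF degree_smult_le])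
      then show "degree q < card ((\<lambda>i. real (Suc i)) ` {..n})" using card by simp
    qed
    then have "coeff p k = coeff q k" by simp
    moreover have "coeff p k = c k" unfolding p_def using k by (simp add: coeff_sum)
    moreover have "coeff q k = (\<Sum>i\<le>n. poly p (real (Suc i)) * coeff (l i) k)" unfolding q_def by (simp add: coeff_sum)
    ultimately show ?thesis by (simp add: pv mult.commute)
  qed
  then show ?thesis by (intro exI[of _ "\<lambda>k i. coeff (l i) k"]) blast
qed

text \<open>The weights recover the \<open>k\<close>-th coefficient of a polynomial of degree at most \<open>n\<close> from its values at \<open>1, \<dots>, n + 1\<close>.\<close>

definition interpolation_weight :: "nat \<Rightarrow> nat \<Rightarrow> nat \<Rightarrow> real" where
  "interpolation_weight n = (SOME L. \<forall>c. \<forall>k\<le>n. c k = (\<Sum>i\<le>n. L k i * (\<Sum>j\<le>n. c j * real (Suc i) ^ j)))"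

lemma interpolation_weight: "k \<le> n \<Longrightarrow> (\<Sum>i\<le>n. interpolation_weight n k i * (\<Sum>j\<le>n. c j * real (Suc i) ^ j)) = c k"
proof -
  have "\<forall>c. \<forall>k\<le>n. c k = (\<Sum>i\<le>n. interpolation_weight n k i * (\<Sum>j\<le>n. c j * real (Suc i) ^ j))"
    unfolding interpolation_weight_def by (rule someI_ex[OF polynomial_coefficients_from_values])
  then show "k \<le> n \<Longrightarrow> ?thesis" by (simp del: of_nat_Suc)
qed

section \<open>Passage from zonotopes to the ball\<close>

lemma scaleR_cball: "s \<ge> 0 \<Longrightarrow> (*\<^sub>R) s ` cball (0::'a::euclidean_space) r = cball 0 (s * r)" if "r \<ge> 0"
proof (cases "s = 0")
  case True then show ?thesis using that by (auto simp: image_constant_conv)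
next
  case False
  assume s: "s \<ge> 0"
  show ?thesis
  proof (intro equalityI subsetI)
    fix x :: 'a assume "x \<in> cball 0 (s * r)"
    then have "x /\<^sub>R s \<in> cball 0 r" using s False by (simp add: field_simps)
    then show "x \<in> (*\<^sub>R) s ` cball 0 r" using False by (intro image_eqI[of _ _ "x /\<^sub>R s"]) auto
  qed (use s in \<open>auto simp: mult_left_mono\<close>)
qed

lemma cball_plus_cball: "a \<ge> 0 \<Longrightarrow> b \<ge> 0 \<Longrightarrow> cball (0::'a::euclidean_space) a + cball 0 b = cball 0 (a + b)"
proof (intro equalityI subsetI)
  fix x :: 'a assume ab: "a \<ge> 0" "b \<ge> 0" and x: "x \<in> cball 0 (a + b)"
  show "x \<in> cball 0 a + cball 0 b"
  proof (cases "a + b = 0")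
    case True
    then show ?thesis using ab x by (auto simp: set_plus_def add_nonneg_eq_0_iff)
  next
    case False
    have "x = (a / (a + b)) *\<^sub>R x + (b / (a + b)) *\<^sub>R x"
      using False by (simp add: add_divide_distrib[symmetric] scaleR_left_distrib[symmetric])
    moreover have "norm ((c / (a + b)) *\<^sub>R x) \<le> c" if "c \<ge> 0" for c
    proof -
      have "norm ((c / (a + b)) *\<^sub>R x) = c / (a + b) * norm x" using that ab by simp
      also have "\<dots> \<le> c / (a + b) * (a + b)" using that ab x by (intro mult_left_mono) auto
      finally show ?thesis using False by simp
    qed
    ultimately show ?thesis using ab by (subst \<open>x = _\<close>) (intro set_plus_intro; simp)
  qed
qed (auto simp: set_plus_def intro: norm_triangle_le add_mono)

lemma cvx_compact_cball [simp]: "r \<ge> 0 \<Longrightarrow> cvx_compact (cball (x::'a::euclidean_space) r)"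
  by (simp add: cvx_compact_def)

text \<open>Continuity of measure from above. A point in all the larger parallel sets has distance
  at most \<open>r\<close> from \<open>K\<close>, and the distance is attained, so it lies in the
  limit set.\<close>

lemma measure_plus_cball_tendsto:
  fixes K :: "'a::euclidean_space set"
  assumes K: "cvx_compact K" and r: "r \<ge> 0" and c: "c \<ge> 0"
  shows "(\<lambda>m. measure lborel (K + cball 0 (r + c / real (Suc m)))) \<longlonglongrightarrow> measure lborel (K + cball 0 r)"
proof -
  let ?A = "\<lambda>m. K + cball (0::'a) (r + c / real (Suc m))"
  have cA: "cvx_compact (?A m)" for m using c r by (intro cvx_compact_plus K cvx_compact_cball) auto
  have I: "(\<Inter>m. ?A m) = K + cball 0 r"
  proof (intro equalityI subsetI)
    fix x assume x: "x \<in> (\<Inter>m. ?A m)"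
    have K': "closed K" "K \<noteq> {}" using K by (auto simp: cvx_compact_def compact_imp_closed)
    obtain k where k: "k \<in> K" "infdist x K = dist x k" using infdist_attains_inf[OF K'] by blast
    have "dist x k \<le> r + c / real (Suc m)" for m
    proof -
      have "x \<in> ?A m" using x by blast
      then obtain y z where "y \<in> K" "norm z \<le> r + c / real (Suc m)" "x = y + z"
        unfolding set_plus_def by auto
      then show ?thesis using infdist_le[of y K x] k by (simp add: dist_norm)
    qed
    moreover have "(\<lambda>m. r + c / real (Suc m)) \<longlonglongrightarrow> r + 0"
      by (intro tendsto_intros LIMSEQ_Suc[OF lim_const_over_n])
    ultimately have "dist x k \<le> r" by (intro LIMSEQ_le_const[of _ r "dist x k"]) auto
    then show "x \<in> K + cball 0 r" using set_plus_intro[OF k(1), of "x - k" "cball 0 r"] by (simp add: dist_norm norm_minus_commute)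
  next
    fix x assume "x \<in> K + cball 0 r"
    moreover have "K + cball 0 r \<subseteq> ?A m" for m using c by (intro set_plus_mono2 order_refl subset_cball) simp
    ultimately show "x \<in> (\<Inter>m. ?A m)" by blast
  qed
  have "decseq ?A"
    using c by (intro decseq_SucI set_plus_mono2 order_refl subset_cball add_left_mono divide_left_mono) auto
  then have "(\<lambda>m. emeasure lborel (?A m)) \<longlonglongrightarrow> emeasure lborel (\<Inter>m. ?A m)"
    using cA emeasure_compact_finite[of "?A m" for m]
    by (intro Lim_emeasure_decseq) (auto simp: cvx_compact_borel cvx_compact_def less_top[symmetric])
  then have "(\<lambda>m. enn2real (emeasure lborel (?A m))) \<longlonglongrightarrow> enn2real (emeasure lborel (K + cball 0 r))"
    unfolding I using cvx_compact_plus[OF K cvx_compact_cball[OF r, of 0]] emeasure_compact_finite[of "K + cball 0 r"]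
    by (intro tendsto_enn2real) (auto simp: cvx_compact_def less_top[symmetric])
  then show ?thesis by (simp add: measure_def)
qed

text \<open>The coefficient of \<open>s ^ k\<close> in the volume of \<open>K + s B\<close>, hence the intrinsic volume of index \<open>n - k\<close> up to
  a constant. Being a fixed combination of volumes, it inherits limits and measurability from them.\<close>

definition parallel_coeff :: "nat \<Rightarrow> 'a::euclidean_space set \<Rightarrow> real" where
  "parallel_coeff k K = (\<Sum>i\<le>DIM('a). interpolation_weight DIM('a) k i * measure lborel (K + cball 0 (real (Suc i))))"

definition ball_zonotope :: "nat \<Rightarrow> 'a::euclidean_space list" where
  "ball_zonotope m = (SOME vs. cball 0 1 \<subseteq> zonotope vs \<and> zonotope vs \<subseteq> cball 0 (1 + 1 / real (Suc m)))"

lemma ball_zonotope: "cball 0 1 \<subseteq> zonotope (ball_zonotope m :: 'a::euclidean_space list)"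
  "zonotope (ball_zonotope m :: 'a list) \<subseteq> cball 0 (1 + 1 / real (Suc m))"
  using someI_ex[OF zonotope_approx_ball[of "1 / real (Suc m)", where ?'a='a]] unfolding ball_zonotope_def by auto

lemma measure_plus_ball_zonotope_tendsto:
  fixes K :: "'a::euclidean_space set"
  assumes K: "cvx_compact K" and s: "s \<ge> 0"
  shows "(\<lambda>m. measure lborel (K + (*\<^sub>R) s ` zonotope (ball_zonotope m))) \<longlonglongrightarrow> measure lborel (K + cball 0 s)"
proof (rule tendsto_sandwich)
  have z: "cvx_compact ((*\<^sub>R) s ` zonotope (ball_zonotope m :: 'a list))" for m
    unfolding zonotope_scale[symmetric] by simp
  have "K + cball 0 s \<subseteq> K + (*\<^sub>R) s ` zonotope (ball_zonotope m)" for m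
    using image_mono[OF ball_zonotope(1)[of m], of "(*\<^sub>R) s"] scaleR_cball[of 1 s, where ?'a='a] s by (intro set_plus_mono2) auto
  then show "\<forall>\<^sub>F m in sequentially. measure lborel (K + cball 0 s) \<le> measure lborel (K + (*\<^sub>R) s ` zonotope (ball_zonotope m))"
    using K s z by (intro always_eventually allI measure_cvx_compact_mono cvx_compact_plus) auto
  have "K + (*\<^sub>R) s ` zonotope (ball_zonotope m) \<subseteq> K + cball 0 (s + s / real (Suc m))" for m
    using image_mono[OF ball_zonotope(2)[of m], of "(*\<^sub>R) s"] scaleR_cball[of "1 + 1 / real (Suc m)" s, where ?'a='a] s
    by (intro set_plus_mono2) (auto simp: algebra_simps)
  then show "\<forall>\<^sub>F m in sequentially. measure lborel (K + (*\<^sub>R) s ` zonotope (ball_zonotope m)) \<le> measure lborel (K + cball 0 (s + s / real (Suc m)))"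
    using K s z by (intro always_eventually allI measure_cvx_compact_mono cvx_compact_plus) auto
qed (use measure_plus_cball_tendsto[OF K s s] in auto)

text \<open>Both sides are the same fixed combination of finitely many volumes. This rests on the
  degree of every zonotope polynomial being at most the dimension, whatever the number of
  segments.\<close>

lemma zonotope_coeff_tendsto:
  fixes K :: "'a::euclidean_space set"
  assumes K: "cvx_compact K" and k: "k \<le> DIM('a)"
  shows "(\<lambda>m. zonotope_coeff (ball_zonotope m) k K) \<longlonglongrightarrow> parallel_coeff k K"
proof -
  have "zonotope_coeff (ball_zonotope m) k K = (\<Sum>i\<le>DIM('a). interpolation_weight DIM('a) k i * measure lborel (K + (*\<^sub>R) (real (Suc i)) ` zonotope (ball_zonotope m)))" for m
    using interpolation_weight[OF k, of "\<lambda>k. zonotope_coeff (ball_zonotope m) k K"] K by (subst measure_plus_zonotope') auto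
  then show ?thesis
    unfolding parallel_coeff_def by (simp del: of_nat_Suc) (intro tendsto_intros measure_plus_ball_zonotope_tendsto K; simp)
qed

text \<open>The volumes of the sums with scaled zonotopes tend to the left side by squeezing and,
  expanded as polynomials in \<open>s\<close>, to the right side coefficient by coefficient.\<close>

theorem steiner_formula:
  fixes K :: "'a::euclidean_space set"
  assumes K: "cvx_compact K" and s: "s \<ge> 0"
  shows "measure lborel (K + cball 0 s) = (\<Sum>k\<le>DIM('a). parallel_coeff k K * s ^ k)"
proof (rule LIMSEQ_unique[OF measure_plus_ball_zonotope_tendsto[OF K s]])
  show "(\<lambda>m. measure lborel (K + (*\<^sub>R) s ` zonotope (ball_zonotope m))) \<longlonglongrightarrow> (\<Sum>k\<le>DIM('a). parallel_coeff k K * s ^ k)"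
    unfolding measure_plus_zonotope'[OF K s] using zonotope_coeff_tendsto[OF K] by (intro tendsto_intros) auto
qed

text \<open>All interpolation nodes are positive, so an expansion valid for \<open>s > 0\<close>
  already determines the coefficients.\<close>

lemma parallel_coeff_unique:
  fixes K :: "'a::euclidean_space set"
  assumes "\<And>s. s > 0 \<Longrightarrow> measure lborel (K + cball 0 s) = (\<Sum>k\<le>DIM('a). c k * s ^ k)" and k: "k \<le> DIM('a)"
  shows "parallel_coeff k K = c k"
  unfolding parallel_coeff_def using interpolation_weight[OF k, of c] assms(1) by simp

lemma parallel_coeff_mono:
  fixes A B :: "'a::euclidean_space set"
  assumes "cvx_compact A" "cvx_compact B" "A \<subseteq> B" "k \<le> DIM('a)"
  shows "parallel_coeff k A \<le> parallel_coeff k B"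
  by (rule LIMSEQ_le[OF zonotope_coeff_tendsto zonotope_coeff_tendsto]) (use assms in \<open>auto intro!: segment_affineD(1)[OF segment_affine_zonotope_coeff]\<close>)

lemma parallel_coeff_shadow_mid:
  fixes A B C :: "'a::euclidean_space set"
  assumes "norm u = 1" "cvx_compact A" "cvx_compact B" "cvx_compact C" "shadow_mid u A B C" and k: "k \<le> DIM('a)"
  shows "parallel_coeff k C \<le> (parallel_coeff k A + parallel_coeff k B) / 2"
proof (rule LIMSEQ_le[OF zonotope_coeff_tendsto])
  show "(\<lambda>m. (zonotope_coeff (ball_zonotope m) k A + zonotope_coeff (ball_zonotope m) k B) / 2) \<longlonglongrightarrow> (parallel_coeff k A + parallel_coeff k B) / 2"
    by (intro tendsto_intros zonotope_coeff_tendsto assms) auto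
  show "\<exists>N. \<forall>n\<ge>N. zonotope_coeff (ball_zonotope n) k C \<le> (zonotope_coeff (ball_zonotope n) k A + zonotope_coeff (ball_zonotope n) k B) / 2"
    using segment_affineD(2)[OF segment_affine_zonotope_coeff assms(1-5)] by blast
qed (use assms in auto)

lemma reflection_plus_cball:
  assumes "norm u = 1"
  shows "reflection u ` K + cball 0 s = reflection u ` (K + cball 0 s)"
proof (intro equalityI subsetI)
  fix x assume "x \<in> reflection u ` K + cball 0 s"
  then obtain y z where "y \<in> K" "norm z \<le> s" "x = reflection u y + z" by (auto simp: set_plus_def)
  then have "x = reflection u (y + reflection u z)" "y + reflection u z \<in> K + cball 0 s"
    using assms by (auto simp: linear_add[OF linear_reflection] norm_reflection intro!: set_plus_intro)
  then show "x \<in> reflection u ` (K + cball 0 s)" by blast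
next
  fix x assume "x \<in> reflection u ` (K + cball 0 s)"
  then obtain y z where "y \<in> K" "norm z \<le> s" "x = reflection u (y + z)" by (auto simp: set_plus_def)
  then have "x = reflection u y + reflection u z" "reflection u z \<in> cball 0 s"
    using assms by (auto simp: linear_add[OF linear_reflection] norm_reflection)
  then show "x \<in> reflection u ` K + cball 0 s" using \<open>y \<in> K\<close> by (auto intro!: set_plus_intro)
qed

lemma reflection_image_eq_vimage: "norm u = 1 \<Longrightarrow> reflection u ` A = reflection u -` A"
  by (auto simp: image_iff) (metis reflection_reflection)

lemma emeasure_reflection_image:
  assumes u: "norm u = 1" and A: "A \<in> sets borel"
  shows "emeasure lborel (reflection u ` A) = emeasure lborel A"
proof -
  have "emeasure lborel A = emeasure (distr lborel lborel (reflection u)) A" by (simp add: distr_lborel_reflection[OF u])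
  also have "\<dots> = emeasure lborel (reflection u -` A)" using A by (subst emeasure_distr) auto
  finally show ?thesis by (simp add: reflection_image_eq_vimage[OF u])
qed

lemma parallel_coeff_reflection:
  fixes K :: "'a::euclidean_space set"
  assumes "norm u = 1" "cvx_compact K"
  shows "parallel_coeff k (reflection u ` K) = parallel_coeff k K"
  unfolding parallel_coeff_def reflection_plus_cball[OF assms(1)] measure_def
  using assms by (subst emeasure_reflection_image) (auto intro!: cvx_compact_borel cvx_compact_plus)

lemma cvx_compact_scaleR: "cvx_compact K \<Longrightarrow> cvx_compact ((*\<^sub>R) t ` K)"
  unfolding cvx_compact_def by (auto intro: compact_scaling convex_scaling)

lemma measure_scaleR:
  fixes A :: "'a::euclidean_space set"
  assumes t: "t > 0" and A: "cvx_compact A"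
  shows "measure lborel ((*\<^sub>R) t ` A) = t ^ DIM('a) * measure lborel A"
proof -
  have "{x. 0 + t *\<^sub>R x \<in> (*\<^sub>R) t ` A} = A" using t by auto
  then have "emeasure lborel ((*\<^sub>R) t ` A) = ennreal (t ^ DIM('a)) * emeasure lborel A"
    using emeasure_lborel_vimage_affine[OF cvx_compact_borel[OF cvx_compact_scaleR[OF A]], of t t 0] t by simp
  then show ?thesis using t by (simp add: measure_def enn2real_mult)
qed

text \<open>Comparison of coefficients in \<open>t K + s B = t (K + (s / t) B)\<close>, where
  \<open>B\<close> is the unit ball.\<close>

lemma parallel_coeff_scaleR:
  fixes K :: "'a::euclidean_space set"
  assumes t: "t > 0" and K: "cvx_compact K" and k: "k \<le> DIM('a)"
  shows "parallel_coeff k ((*\<^sub>R) t ` K) = t ^ (DIM('a) - k) * parallel_coeff k K"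
proof -
  have "measure lborel ((*\<^sub>R) t ` K + cball 0 s) = (\<Sum>k\<le>DIM('a). (t ^ (DIM('a) - k) * parallel_coeff k K) * s ^ k)" if s: "s > 0" for s
  proof -
    have "cball (0::'a) s = (*\<^sub>R) t ` cball 0 (s / t)" using t s by (subst scaleR_cball) auto
    then have "(*\<^sub>R) t ` K + cball 0 s = (*\<^sub>R) t ` (K + cball 0 (s / t))"
      by (force simp: set_plus_def image_def scaleR_add_right)
    then have "measure lborel ((*\<^sub>R) t ` K + cball 0 s) = t ^ DIM('a) * measure lborel (K + cball 0 (s / t))"
      using t s by (simp add: measure_scaleR cvx_compact_plus K)
    also have "\<dots> = t ^ DIM('a) * (\<Sum>k\<le>DIM('a). parallel_coeff k K * (s / t) ^ k)"
      using t s by (subst steiner_formula[OF K]) auto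
    also have "\<dots> = (\<Sum>k\<le>DIM('a). (t ^ (DIM('a) - k) * parallel_coeff k K) * s ^ k)"
      unfolding sum_distrib_left using t by (intro sum.cong) (auto simp: power_diff power_divide)
    finally show ?thesis .
  qed
  then show ?thesis by (rule parallel_coeff_unique) (use k in auto)
qed

text \<open>By \<open>usc\<close> and the continuity of volume in the radius, the volume of each
  parallel body is upper semicontinuous in \<open>x\<close>: its strict sublevel sets are open. The
  weights in \<open>parallel_coeff\<close> may have either sign, which can destroy semicontinuity
  but not measurability.\<close>

lemma borel_measurable_parallel_coeff:
  fixes K :: "'x::topological_space \<Rightarrow> 'a::euclidean_space set"
  assumes cvx_compact: "\<And>x. cvx_compact (K x)"
    and usc: "\<And>x d. d > 0 \<Longrightarrow> \<exists>U. open U \<and> x \<in> U \<and> (\<forall>y\<in>U. K y \<subseteq> K x + cball 0 d)"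
  shows "(\<lambda>x. parallel_coeff k (K x)) \<in> borel_measurable borel"
proof -
  have "(\<lambda>x. measure lborel (K x + cball 0 r)) \<in> borel_measurable borel" if r: "r \<ge> 0" for r
  proof (rule borel_measurable_iff_less[THEN iffD2, rule_format])
    fix a
    have "open {x. measure lborel (K x + cball 0 r) < a}"
    proof (subst open_subopen, rule ballI)
      fix x assume "x \<in> {x. measure lborel (K x + cball 0 r) < a}"
      then have "\<forall>\<^sub>F m in sequentially. measure lborel (K x + cball 0 (r + 1 / real (Suc m))) < a"
        using order_tendstoD(2)[OF measure_plus_cball_tendsto[OF cvx_compact r, of 1]] by simp
      then obtain m where m: "measure lborel (K x + cball 0 (r + 1 / real (Suc m))) < a"
        by (metis (mono_tags, lifting) eventually_at_top_linorder order_refl)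
      obtain U where U: "open U" "x \<in> U" "\<And>y. y \<in> U \<Longrightarrow> K y \<subseteq> K x + cball 0 (1 / real (Suc m))"
        using usc[of "1 / real (Suc m)" x] by auto
      have "measure lborel (K y + cball 0 r) < a" if "y \<in> U" for y
      proof -
        have "K y + cball 0 r \<subseteq> K x + cball 0 (1 / real (Suc m)) + cball 0 r"
          using U(3)[OF that] by (intro set_plus_mono2) auto
        also have "\<dots> = K x + cball 0 (r + 1 / real (Suc m))"
          using r by (subst add.assoc, subst cball_plus_cball) (auto simp: add.commute)
        finally have "measure lborel (K y + cball 0 r) \<le> measure lborel (K x + cball 0 (r + 1 / real (Suc m)))"
          using r by (intro measure_cvx_compact_mono cvx_compact_plus cvx_compact cvx_compact_cball) auto
        with m show ?thesis by simp
      qed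
      with U show "\<exists>T. open T \<and> x \<in> T \<and> T \<subseteq> {x. measure lborel (K x + cball 0 r) < a}"
        by (intro exI[of _ U]) auto
    qed
    then show "{x \<in> space borel. measure lborel (K x + cball 0 r) < a} \<in> sets borel" by simp
  qed
  then show ?thesis unfolding parallel_coeff_def by (intro borel_measurable_sum borel_measurable_times) auto
qed

text \<open>The Steiner formula supplies one sequence satisfying \<open>steiner_coeffs\<close>, and
  \<open>steiner_coeffs_unique\<close> identifies the definite description with it.\<close>

theorem intrinsic_volume_eq_parallel_coeff:
  fixes K :: "(real ^ 'n) set"
  assumes K: "cvx_compact K" and j: "j \<le> CARD('n)"
  shows "intrinsic_volume j K = parallel_coeff (CARD('n) - j) K / unit_ball_vol (real (CARD('n) - j))"
proof -
  define v where "v j = (if j \<le> CARD('n) then parallel_coeff (CARD('n) - j) K / unit_ball_vol (real (CARD('n) - j)) else 0)" for j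
  have nz: "unit_ball_vol (real k) \<noteq> 0" for k by (rule less_imp_neq[THEN not_sym]) simp
  have "steiner_coeffs K v"
    unfolding steiner_coeffs_def
  proof (intro conjI allI impI)
    fix e :: real assume e: "e > 0"
    have "measure lborel (K + (*\<^sub>R) e ` cball 0 1) = (\<Sum>k\<le>CARD('n). parallel_coeff k K * e ^ k)"
      using e by (subst scaleR_cball) (auto simp: steiner_formula[OF K])
    also have "\<dots> = (\<Sum>j=0..CARD('n). parallel_coeff (CARD('n) - j) K * e ^ (CARD('n) - j))"
      by (rule sum.reindex_bij_witness[where i = "\<lambda>k. CARD('n) - k" and j = "\<lambda>k. CARD('n) - k"]) auto
    also have "\<dots> = (\<Sum>j=0..CARD('n). unit_ball_vol (real (CARD('n) - j)) * v j * e ^ (CARD('n) - j))"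
      using nz by (intro sum.cong) (auto simp: v_def simp del: of_nat_diff)
    finally show "measure lborel (K + (*\<^sub>R) e ` cball 0 1) = (\<Sum>j=0..CARD('n). unit_ball_vol (real (CARD('n) - j)) * v j * e ^ (CARD('n) - j))" .
  qed (simp add: v_def)
  then have "(THE v. steiner_coeffs K v) = v" using steiner_coeffs_unique by blast
  then show ?thesis unfolding intrinsic_volume_def using j by (simp add: v_def del: of_nat_diff)
qed

section \<open>Steiner symmetrization\<close>

text \<open>For convex \<open>A\<close> and unit \<open>u\<close> this is the Steiner symmetral: the points of a chord \<open>[a, b]\<close> average with their
  reflections to the centred interval of length \<open>b - a\<close>. In this form it is visibly compact and convex.\<close>

definition symmetral :: "'a::euclidean_space \<Rightarrow> 'a set \<Rightarrow> 'a set" where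
  "symmetral u A = {(1/2) *\<^sub>R (w + reflection u z) | w z. w \<in> A \<and> z \<in> A \<and> (\<exists>t. z - w = t *\<^sub>R u)}"

lemma cvx_compact_symmetral:
  assumes A: "cvx_compact A" and u: "norm u = 1"
  shows "cvx_compact (symmetral u A)"
proof -
  \<comment> \<open>The pairs of points on a common line parallel to \<open>u\<close>, written
    without the existential quantifier so that the condition is visibly closed.\<close>
  let ?S = "{p. snd p - fst p = ((snd p - fst p) \<bullet> u) *\<^sub>R u}"
  have par: "(\<exists>t. z - w = t *\<^sub>R u) \<longleftrightarrow> z - w = ((z - w) \<bullet> u) *\<^sub>R u" for z w :: 'a
    using u by (auto simp: norm_eq_1)
  have eq: "symmetral u A = (\<lambda>p. (1/2) *\<^sub>R (fst p + reflection u (snd p))) ` ((A \<times> A) \<inter> ?S)"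
    unfolding symmetral_def par by force
  have "closed ?S" by (intro closed_Collect_eq continuous_intros)
  then have "compact (symmetral u A)"
    unfolding eq using A unfolding cvx_compact_def reflection_def
    by (intro compact_continuous_image continuous_intros compact_Int_closed compact_Times) auto
  moreover have "convex (symmetral u A)"
  proof (rule convexI)
    fix x y and a b :: real assume xy: "x \<in> symmetral u A" "y \<in> symmetral u A" and ab: "0 \<le> a" "0 \<le> b" "a + b = 1"
    then obtain w z w' z' t t' where *: "x = (1/2) *\<^sub>R (w + reflection u z)" "y = (1/2) *\<^sub>R (w' + reflection u z')"
      "w \<in> A" "z \<in> A" "w' \<in> A" "z' \<in> A" "z - w = t *\<^sub>R u" "z' - w' = t' *\<^sub>R u"
      unfolding symmetral_def by blast
    have "a *\<^sub>R x + b *\<^sub>R y = (1/2) *\<^sub>R ((a *\<^sub>R w + b *\<^sub>R w') + reflection u (a *\<^sub>R z + b *\<^sub>R z'))"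
      unfolding * linear_add[OF linear_reflection] linear_cmul[OF linear_reflection] by (simp add: algebra_simps)
    moreover have "a *\<^sub>R w + b *\<^sub>R w' \<in> A" "a *\<^sub>R z + b *\<^sub>R z' \<in> A"
      using A * ab unfolding cvx_compact_def by (auto intro: convexD)
    moreover have "(a *\<^sub>R z + b *\<^sub>R z') - (a *\<^sub>R w + b *\<^sub>R w') = a *\<^sub>R (z - w) + b *\<^sub>R (z' - w')"
      by (simp add: algebra_simps)
    then have "(a *\<^sub>R z + b *\<^sub>R z') - (a *\<^sub>R w + b *\<^sub>R w') = (a * t + b * t') *\<^sub>R u"
      unfolding * by (simp add: algebra_simps)
    ultimately show "a *\<^sub>R x + b *\<^sub>R y \<in> symmetral u A" unfolding symmetral_def by blast
  qed
  moreover have "symmetral u A \<noteq> {}"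
  proof -
    obtain w where "w \<in> A" using A unfolding cvx_compact_def by auto
    moreover have "\<exists>t. w - w = t *\<^sub>R u" by (intro exI[of _ 0]) simp
    ultimately have "(1/2) *\<^sub>R (w + reflection u w) \<in> symmetral u A" unfolding symmetral_def by blast
    then show ?thesis by auto
  qed
  ultimately show ?thesis unfolding cvx_compact_def by simp
qed

lemma symmetral_subset_cball:
  assumes "A \<subseteq> cball 0 R" "norm u = 1"
  shows "symmetral u A \<subseteq> cball 0 R"
proof
  fix x assume "x \<in> symmetral u A"
  then obtain w z where x: "x = (1/2) *\<^sub>R (w + reflection u z)" "w \<in> A" "z \<in> A" unfolding symmetral_def by auto
  then have "norm w \<le> R" "norm (reflection u z) \<le> R" using assms by (auto simp: norm_reflection)
  then have "norm (w + reflection u z) \<le> R + R" using norm_triangle_ineq[of w "reflection u z"] by linarith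
  then show "x \<in> cball 0 R" unfolding x(1) by simp
qed

lemma reflection_line: "norm u = 1 \<Longrightarrow> reflection u (x + s *\<^sub>R u) = x + (- 2 * (x \<bullet> u) - s) *\<^sub>R u"
  by (simp add: reflection_def norm_eq_1 inner_left_distrib algebra_simps flip: scaleR_2)

lemma midpoint_line:
  fixes x u :: "'a::real_vector"
  shows "x + ((a + b) / 2) *\<^sub>R u = (1/2) *\<^sub>R ((x + a *\<^sub>R u) + (x + b *\<^sub>R u))"
proof -
  have "(x + a *\<^sub>R u) + (x + b *\<^sub>R u) = 2 *\<^sub>R x + (a + b) *\<^sub>R u"
    by (simp add: scaleR_2 scaleR_left_distrib)
  then show ?thesis by (simp add: scaleR_right_distrib)
qed

text \<open>Averaging the parameter \<open>q\<close> with the mirror image of \<open>q'\<close>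
  gives \<open>s + x \<bullet> u = (q - q') / 2\<close>, and half differences of points of
  \<open>{a..b}\<close> fill the interval of length \<open>b - a\<close> centred at 0.\<close>

lemma symmetral_chord:
  assumes u: "norm u = 1" and ab: "{s. x + s *\<^sub>R u \<in> A} = {a..b}"
  shows "{s. x + s *\<^sub>R u \<in> symmetral u A} =
    (if a \<le> b then {- (x \<bullet> u) - (b - a) / 2 .. - (x \<bullet> u) + (b - a) / 2} else {})"
proof -
  have mem: "x + s *\<^sub>R u \<in> A \<longleftrightarrow> a \<le> s \<and> s \<le> b" for s using ab by auto
  have uu: "u \<bullet> u = 1" using u by (simp add: norm_eq_1)
  have iff: "x + s *\<^sub>R u \<in> symmetral u A \<longleftrightarrow> (\<exists>q\<in>{a..b}. \<exists>q'\<in>{a..b}. s + x \<bullet> u = (q - q') / 2)" for s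
  proof
    assume "x + s *\<^sub>R u \<in> symmetral u A"
    then obtain w z t where *: "x + s *\<^sub>R u = (1/2) *\<^sub>R (w + reflection u z)" "w \<in> A" "z \<in> A" "z - w = t *\<^sub>R u"
      unfolding symmetral_def by auto
    have z: "z = w + t *\<^sub>R u" using *(4) by (simp add: algebra_simps)
    have h: "(1/2) *\<^sub>R (w + reflection u z) = w - (t / 2 + w \<bullet> u) *\<^sub>R u"
      unfolding z reflection_def by (simp add: inner_left_distrib uu algebra_simps flip: scaleR_2)
    define q where "q = s + t / 2 + w \<bullet> u"
    have w: "w = x + q *\<^sub>R u" using *(1) unfolding h q_def by (simp add: algebra_simps)
    have wu: "w \<bullet> u = x \<bullet> u + q" by (subst w) (simp add: inner_left_distrib uu)
    have "z = x + (q + t) *\<^sub>R u" unfolding z by (subst w) (simp add: algebra_simps)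
    then have "q \<in> {a..b}" "q + t \<in> {a..b}" using mem *(2,3) w by auto
    moreover have "s + x \<bullet> u = (q - (q + t)) / 2" using wu unfolding q_def by simp
    ultimately show "\<exists>q\<in>{a..b}. \<exists>q'\<in>{a..b}. s + x \<bullet> u = (q - q') / 2" by blast
  next
    assume "\<exists>q\<in>{a..b}. \<exists>q'\<in>{a..b}. s + x \<bullet> u = (q - q') / 2"
    then obtain q q' where q: "q \<in> {a..b}" "q' \<in> {a..b}" "s = (q - q') / 2 - x \<bullet> u" by (auto simp: algebra_simps)
    have "x + s *\<^sub>R u = (1/2) *\<^sub>R ((x + q *\<^sub>R u) + reflection u (x + q' *\<^sub>R u))"
      unfolding q(3) reflection_line[OF u] using midpoint_line[of x q "- 2 * (x \<bullet> u) - q'" u] by (simp add: field_simps)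
    moreover have "x + q *\<^sub>R u \<in> A" "x + q' *\<^sub>R u \<in> A" using mem q by auto
    moreover have "(x + q' *\<^sub>R u) - (x + q *\<^sub>R u) = (q' - q) *\<^sub>R u" by (simp add: algebra_simps)
    ultimately show "x + s *\<^sub>R u \<in> symmetral u A" unfolding symmetral_def by blast
  qed
  show ?thesis
  proof (cases "a \<le> b")
    case True
    have "s \<in> {- (x \<bullet> u) - (b - a) / 2 .. - (x \<bullet> u) + (b - a) / 2} \<longleftrightarrow> (\<exists>q\<in>{a..b}. \<exists>q'\<in>{a..b}. s + x \<bullet> u = (q - q') / 2)" for s
    proof
      assume s: "s \<in> {- (x \<bullet> u) - (b - a) / 2 .. - (x \<bullet> u) + (b - a) / 2}"
      define t where "t = 2 * (s + x \<bullet> u)"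
      have t: "- (b - a) \<le> t" "t \<le> b - a" using s by (auto simp: t_def field_simps)
      show "\<exists>q\<in>{a..b}. \<exists>q'\<in>{a..b}. s + x \<bullet> u = (q - q') / 2"
        using t True by (intro bexI[of _ "a + max t 0"] bexI[of _ "a + max t 0 - t"]) (auto simp: t_def max_def)
    next
      assume "\<exists>q\<in>{a..b}. \<exists>q'\<in>{a..b}. s + x \<bullet> u = (q - q') / 2"
      then obtain q q' where "q \<in> {a..b}" "q' \<in> {a..b}" "s + x \<bullet> u = (q - q') / 2" by blast
      then show "s \<in> {- (x \<bullet> u) - (b - a) / 2 .. - (x \<bullet> u) + (b - a) / 2}" by (simp add: field_simps)
    qed
    with True show ?thesis by (intro set_eqI) (simp only: if_True mem_Collect_eq iff)
  qed (auto simp: iff)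
qed

text \<open>The chord is invariant under the reflection in direction \<open>u\<close>, hence centred
  at the parameter \<open>- (x \<bullet> u)\<close>. A negative \<open>h\<close> encodes the empty
  chord.\<close>

lemma ball_chord:
  fixes u x :: "'a::euclidean_space"
  assumes u: "norm u = 1"
  shows "\<exists>h. {s. x + s *\<^sub>R u \<in> cball 0 r} = {- (x \<bullet> u) - h .. - (x \<bullet> u) + h}"
proof -
  obtain a b where ab: "{s. x + s *\<^sub>R u \<in> cball 0 r} = {a..b}"
    using chord_interval[OF compact_cball[of "0::'a" r] convex_cball[of "0::'a" r] u] by blast
  show ?thesis
  proof (cases "a \<le> b")
    case True
    have "- 2 * (x \<bullet> u) - s \<in> {a..b}" if "s \<in> {a..b}" for s
    proof -
      have "x + s *\<^sub>R u \<in> cball 0 r" using that ab by blast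
      moreover have "reflection u (x + s *\<^sub>R u) = x + (- 2 * (x \<bullet> u) - s) *\<^sub>R u"
        by (rule reflection_line[OF u])
      ultimately have "x + (- 2 * (x \<bullet> u) - s) *\<^sub>R u \<in> cball 0 r" using norm_reflection[OF u, of "x + s *\<^sub>R u"] by simp
      then show ?thesis using ab by blast
    qed
    from this[of a] this[of b] True have "a + b = - 2 * (x \<bullet> u)" by auto
    then show ?thesis unfolding ab by (intro exI[of _ "(b - a) / 2"]) (auto simp: field_simps)
  next
    case False
    then show ?thesis unfolding ab by (intro exI[of _ "-1"]) auto
  qed
qed

text \<open>If \<open>S\<close> lies in \<open>B\<close>, then \<open>S - B\<close> is empty and
  \<open>T\<close> is part of \<open>A - B\<close>. Otherwise |S - B| = |S| - |B| \<le> |A| - |B| =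
  |A - B| - |B - A|, and |B - A| is at least |T|.\<close>

lemma measure_Diff_gain:
  assumes "A \<in> fmeasurable M" "B \<in> fmeasurable M" "S \<in> fmeasurable M" "T \<in> sets M"
    and "S \<subseteq> B \<or> B \<subseteq> S" "measure M S \<le> measure M A" "T \<subseteq> A - B" "measure M T \<le> measure M (B - A)"
  shows "measure M (S - B) + measure M T \<le> measure M (A - B)"
  using assms(5)
proof
  assume "S \<subseteq> B"
  then have "measure M (S - B) = 0" by (metis Diff_eq_empty_iff measure_empty)
  moreover have "measure M T \<le> measure M (A - B)"
    using assms by (intro measure_mono_fmeasurable fmeasurable_Diff) auto
  ultimately show ?thesis by simp
next
  assume "B \<subseteq> S"
  then have "measure M (S - B) = measure M S - measure M B"
    using assms by (intro measurable_measure_Diff) auto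
  moreover have "measure M (A - B) = measure M A - measure M (A \<inter> B)" "measure M (B - A) = measure M B - measure M (A \<inter> B)"
    using assms measurable_measure_Diff[of A M "A \<inter> B"] measurable_measure_Diff[of B M "A \<inter> B"]
    by (auto simp: fmeasurable_def Diff_Int)
  ultimately show ?thesis using assms by linarith
qed

lemma fmeasurable_real_subset: "A \<subseteq> {a..b::real} \<Longrightarrow> A \<in> sets borel \<Longrightarrow> A \<in> fmeasurable lborel"
  by (rule fmeasurableI2[of "{a..b}"]) (auto intro: fmeasurable_compact)

text \<open>The symmetral and the ball meet the line in intervals with the same centre, hence
  nested, and \<open>measure_Diff_gain\<close> applies. The points of \<open>A - B\<close> that
  translation by \<open>- c *\<^sub>R u\<close> carries into \<open>B - A\<close> play the part of
  \<open>T\<close>; translation stays on the line and preserves length.\<close>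

lemma symmetral_line:
  fixes r c :: real
  assumes u: "norm u = 1" and A: "cvx_compact A"
  defines "B \<equiv> cball 0 r"
  shows "emeasure lborel {s. x + s *\<^sub>R u \<in> symmetral u A} \<le> emeasure lborel {s. x + s *\<^sub>R u \<in> A}"
    and "emeasure lborel {s. x + s *\<^sub>R u \<in> symmetral u A - B} + emeasure lborel {s. x + s *\<^sub>R u \<in> (A - B) \<inter> {y. y - c *\<^sub>R u \<in> B - A}}
      \<le> emeasure lborel {s. x + s *\<^sub>R u \<in> A - B}"
proof -
  obtain a b where ab: "{s. x + s *\<^sub>R u \<in> A} = {a..b}" using chord_interval[OF _ _ u] A unfolding cvx_compact_def by blast
  obtain h where h: "{s. x + s *\<^sub>R u \<in> B} = {- (x \<bullet> u) - h .. - (x \<bullet> u) + h}" using ball_chord[OF u] unfolding B_def by blast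
  note S = symmetral_chord[OF u ab]
  let ?S = "if a \<le> b then {- (x \<bullet> u) - (b - a) / 2 .. - (x \<bullet> u) + (b - a) / 2} else {}"
  let ?A = "{a..b}" let ?B = "{- (x \<bullet> u) - h .. - (x \<bullet> u) + h}"
  have SA: "measure lborel ?S \<le> measure lborel ?A" by auto
  then show "emeasure lborel {s. x + s *\<^sub>R u \<in> symmetral u A} \<le> emeasure lborel {s. x + s *\<^sub>R u \<in> A}"
    unfolding ab S by (auto simp: emeasure_lborel_Icc_eq intro!: ennreal_leI)
  let ?T = "(?A - ?B) \<inter> {s. - c + 1 *\<^sub>R s \<in> ?B - ?A}"
  have T: "{s. x + s *\<^sub>R u \<in> (A - B) \<inter> {y. y - c *\<^sub>R u \<in> B - A}} = ?T"
  proof -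
    have e: "x + (- c + 1 *\<^sub>R s) *\<^sub>R u = x + s *\<^sub>R u - c *\<^sub>R u" for s by (simp add: algebra_simps)
    show ?thesis unfolding ab[symmetric] h[symmetric]
      by (rule set_eqI) (simp only: mem_Collect_eq Int_iff Diff_iff e)
  qed
  have Tm: "?T \<in> sets borel" by measurable
  have BA: "?B - ?A \<in> fmeasurable lborel" "?A - ?B \<in> fmeasurable lborel" "?S - ?B \<in> fmeasurable lborel"
    by (intro fmeasurable_Diff; simp add: fmeasurable_compact)+
  have Tf: "?T \<in> fmeasurable lborel" using Tm by (intro fmeasurable_real_subset[of _ a b]) auto
  have "emeasure lborel ?T \<le> emeasure lborel {s. - c + 1 *\<^sub>R s \<in> ?B - ?A}"
    by (intro emeasure_mono) auto
  also have "\<dots> = emeasure lborel (?B - ?A)"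
    using emeasure_lborel_vimage_affine[of "?B - ?A" 1 "-c"] by simp
  finally have "measure lborel ?T \<le> measure lborel (?B - ?A)"
    using BA Tf unfolding measure_def by (intro enn2real_mono) (auto simp: fmeasurable_def)
  then have "measure lborel (?S - ?B) + measure lborel ?T \<le> measure lborel (?A - ?B)"
    using SA Tm by (intro measure_Diff_gain) (auto simp: fmeasurable_compact)
  then have "emeasure lborel (?S - ?B) + emeasure lborel ?T \<le> emeasure lborel (?A - ?B)"
    using BA Tf by (simp add: emeasure_eq_measure2 ennreal_plus[symmetric] ennreal_leI del: ennreal_plus)
  moreover have "{s. x + s *\<^sub>R u \<in> symmetral u A - B} = ?S - ?B" "{s. x + s *\<^sub>R u \<in> A - B} = ?A - ?B"
    unfolding S[symmetric] h[symmetric] ab[symmetric] by auto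
  ultimately show "emeasure lborel {s. x + s *\<^sub>R u \<in> symmetral u A - B} + emeasure lborel {s. x + s *\<^sub>R u \<in> (A - B) \<inter> {y. y - c *\<^sub>R u \<in> B - A}}
      \<le> emeasure lborel {s. x + s *\<^sub>R u \<in> A - B}"
    unfolding T by simp
qed

lemma cvx_compact_fmeasurable: "cvx_compact A \<Longrightarrow> A \<in> fmeasurable lborel"
  by (simp add: cvx_compact_def fmeasurable_compact)

lemma measure_symmetral_le:
  assumes u: "norm u = 1" and A: "cvx_compact A"
  shows "measure lborel (symmetral u A) \<le> measure lborel A"
proof -
  have "emeasure lborel (symmetral u A) \<le> emeasure lborel A"
    by (subst (1 2) emeasure_lines[OF u])
      (auto intro!: nn_integral_mono mult_left_mono symmetral_line(1) u A cvx_compact_borel cvx_compact_symmetral)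
  then show ?thesis unfolding measure_def using cvx_compact_fmeasurable[OF A]
    by (intro enn2real_mono) (auto simp: fmeasurable_def)
qed

lemma measure_symmetral_Diff_ball:
  assumes u: "norm u = 1" and A: "cvx_compact A" and r: "r \<ge> 0"
  defines "B \<equiv> cball 0 r"
  shows "measure lborel (symmetral u A - B) + measure lborel ((A - B) \<inter> {y. y - c *\<^sub>R u \<in> B - A}) \<le> measure lborel (A - B)"
proof -
  have [measurable]: "A \<in> sets borel" "B \<in> sets borel" "symmetral u A \<in> sets borel"
    using A u by (auto simp: B_def cvx_compact_borel cvx_compact_symmetral)
  let ?T = "(A - B) \<inter> {y. y - c *\<^sub>R u \<in> B - A}"
  have [measurable]: "?T \<in> sets borel" by measurable
  have "emeasure lborel (symmetral u A - B) + emeasure lborel ?T \<le> emeasure lborel (A - B)"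
  proof -
    have "emeasure lborel (symmetral u A - B) + emeasure lborel ?T = (\<integral>\<^sup>+x. indicator {x. x \<bullet> u \<in> {0..1}} x *
       (emeasure lborel {s. x + s *\<^sub>R u \<in> symmetral u A - B} + emeasure lborel {s. x + s *\<^sub>R u \<in> ?T}) \<partial>lborel)"
      by (subst (1 2) emeasure_lines[OF u], measurable, subst nn_integral_add[symmetric], measurable)
        (simp add: distrib_left)
    also have "\<dots> \<le> (\<integral>\<^sup>+x. indicator {x. x \<bullet> u \<in> {0..1}} x * emeasure lborel {s. x + s *\<^sub>R u \<in> A - B} \<partial>lborel)"
      unfolding B_def by (intro nn_integral_mono mult_left_mono symmetral_line(2) u A) simp
    also have "\<dots> = emeasure lborel (A - B)" by (rule emeasure_lines[OF u, symmetric]) measurable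
    finally show ?thesis .
  qed
  moreover have fm: "A - B \<in> fmeasurable lborel" "symmetral u A - B \<in> fmeasurable lborel"
    by (auto intro!: fmeasurable_Diff[OF cvx_compact_fmeasurable[OF A]] fmeasurable_Diff[OF cvx_compact_fmeasurable[OF cvx_compact_symmetral[OF A u]]] simp: B_def)
  moreover have "?T \<in> fmeasurable lborel" by (rule fmeasurableI2[OF fm(1)]) auto
  ultimately have "ennreal (measure lborel (symmetral u A - B) + measure lborel ?T) \<le> ennreal (measure lborel (A - B))"
    by (simp add: emeasure_eq_measure2 ennreal_plus[symmetric] del: ennreal_plus)
  then show ?thesis by (subst (asm) ennreal_le_iff) auto
qed

text \<open>The overlap, integrated over all translations \<open>w\<close>, equals \<open>|D| |E|\<close> and vanishes for \<open>|w| > 2 R\<close>.\<close>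

lemma exists_translate_overlap:
  fixes D E :: "'a::euclidean_space set"
  assumes [measurable]: "D \<in> sets borel" "E \<in> sets borel" and sub: "D \<subseteq> cball 0 R" "E \<subseteq> cball 0 R" and R: "R > 0"
  shows "\<exists>w. measure lborel D * measure lborel E / (2 * measure lborel (cball (0::'a) (2 * R))) \<le> measure lborel (D \<inter> {y. y - w \<in> E})"
proof (rule ccontr)
  let ?V = "measure lborel (cball (0::'a) (2 * R))"
  \<comment> \<open>Half of the average overlap: if every overlap were below \<open>q\<close>, the
    integral over the ball of radius \<open>2 * R\<close> would be at most half of the product that
    it equals.\<close>
  define q where "q = measure lborel D * measure lborel E / (2 * ?V)"
  assume "\<not> ?thesis"
  then have lt: "measure lborel (D \<inter> {y. y - w \<in> E}) < q" for w unfolding q_def by (simp add: not_le)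
  have V: "?V > 0" using R by (subst content_cball) auto
  have fm: "D \<in> fmeasurable lborel" "E \<in> fmeasurable lborel" "D \<inter> {y. y - w \<in> E} \<in> fmeasurable lborel" for w
    using sub by (auto intro!: fmeasurableI2[OF fmeasurable_compact[OF compact_cball[of 0 R]]])
  have q: "q > 0" using lt[of 0] by (meson le_less_trans measure_nonneg)
  have "ennreal (measure lborel D * measure lborel E) = emeasure lborel D * emeasure lborel E"
    using fm by (simp add: emeasure_eq_measure2 ennreal_mult)
  also have "\<dots> = (\<integral>\<^sup>+y. indicator D y * (\<integral>\<^sup>+w. indicator E (y - w) \<partial>lborel) \<partial>lborel)"
  proof -
    have "(\<integral>\<^sup>+w. indicator E (y - w) \<partial>lborel) = emeasure lborel E" for y
    proof -
      have "emeasure lborel E = (\<integral>\<^sup>+w. indicator E w \<partial>distr lborel lborel (\<lambda>w. y - w))"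
        by (simp add: distr_lborel_point_reflection)
      also have "\<dots> = (\<integral>\<^sup>+w. indicator E (y - w) \<partial>lborel)" by (subst nn_integral_distr) auto
      finally show ?thesis by simp
    qed
    then show ?thesis by (simp add: nn_integral_multc)
  qed
  also have "\<dots> = (\<integral>\<^sup>+y. (\<integral>\<^sup>+w. indicator D y * indicator E (y - w) \<partial>lborel) \<partial>lborel)"
    by (subst nn_integral_cmult) auto
  also have "\<dots> = (\<integral>\<^sup>+w. (\<integral>\<^sup>+y. indicator D y * indicator E (y - w) \<partial>lborel) \<partial>lborel)"
    by (rule lborel_pair.Fubini') measurable
  also have "\<dots> = (\<integral>\<^sup>+w. emeasure lborel (D \<inter> {y. y - w \<in> E}) \<partial>lborel)"
  proof (rule nn_integral_cong)
    fix w :: 'a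
    have "(\<integral>\<^sup>+y. indicator D y * indicator E (y - w) \<partial>lborel) = (\<integral>\<^sup>+y. indicator (D \<inter> {y. y - w \<in> E}) y \<partial>lborel)"
      by (intro nn_integral_cong) (auto simp: indicator_def)
    then show "(\<integral>\<^sup>+y. indicator D y * indicator E (y - w) \<partial>lborel) = emeasure lborel (D \<inter> {y. y - w \<in> E})"
      by simp
  qed
  also have "\<dots> \<le> (\<integral>\<^sup>+w. ennreal q * indicator (cball (0::'a) (2 * R)) w \<partial>lborel)"
  proof (rule nn_integral_mono)
    fix w :: 'a
    show "emeasure lborel (D \<inter> {y. y - w \<in> E}) \<le> ennreal q * indicator (cball 0 (2 * R)) w"
    proof (cases "D \<inter> {y. y - w \<in> E} = {}")
      case False
      then obtain y where "y \<in> D" "y - w \<in> E" by auto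
      then have "y \<in> cball 0 R" "y - w \<in> cball 0 R" using sub by blast+
      then have "norm w \<le> 2 * R" using norm_triangle_ineq4[of y "y - w"] by simp
      then show ?thesis using lt[of w] fm(3)[of w] by (simp add: emeasure_eq_measure2 ennreal_leI)
    qed simp
  qed
  also have "\<dots> = ennreal (q * ?V)"
    using q fmeasurable_compact[OF compact_cball[of "0::'a" "2 * R"]]
    by (simp add: nn_integral_cmult_indicator emeasure_eq_measure2 ennreal_mult)
  finally have "measure lborel D * measure lborel E \<le> q * ?V" using q by (subst (asm) ennreal_le_iff) auto
  also have "q * ?V = measure lborel D * measure lborel E / 2" using V by (simp add: q_def)
  also have "\<dots> < measure lborel D * measure lborel E" using q V by (simp add: q_def zero_less_divide_iff)
  finally show False by simp
qed

lemma exists_symmetral_gain: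
  fixes A :: "'a::euclidean_space set"
  assumes A: "cvx_compact A" "A \<subseteq> cball 0 R" and r: "r \<ge> 0" "r \<le> R" "R > 0"
    and le: "measure lborel A \<le> measure lborel (cball (0::'a) r)"
  shows "\<exists>u. norm u = 1 \<and> measure lborel (symmetral u A - cball 0 r) \<le>
    measure lborel (A - cball 0 r) - (measure lborel (A - cball 0 r))\<^sup>2 / (2 * measure lborel (cball (0::'a) (2 * R)))"
proof -
  let ?B = "cball (0::'a) r" let ?V = "measure lborel (cball (0::'a) (2 * R))"
  have V: "?V > 0" using r by (subst content_cball) auto
  have fm: "A \<in> fmeasurable lborel" "?B \<in> fmeasurable lborel" using A by (auto intro: cvx_compact_fmeasurable fmeasurable_compact)
  have "measure lborel (A - ?B) = measure lborel A - measure lborel (A \<inter> ?B)"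
    "measure lborel (?B - A) = measure lborel ?B - measure lborel (A \<inter> ?B)"
    using fm measurable_measure_Diff[of A lborel "A \<inter> ?B"] measurable_measure_Diff[of ?B lborel "A \<inter> ?B"]
    by (auto simp: fmeasurable_def Diff_Int)
  then have le': "measure lborel (A - ?B) \<le> measure lborel (?B - A)" using le by simp
  have mAB: "A - ?B \<in> sets borel" "?B - A \<in> sets borel" using cvx_compact_borel[OF A(1)] by auto
  have sAB: "A - ?B \<subseteq> cball 0 R" "?B - A \<subseteq> cball 0 R" using A(2) r by auto
  obtain w where "measure lborel (A - ?B) * measure lborel (?B - A) / (2 * ?V) \<le> measure lborel ((A - ?B) \<inter> {y. y - w \<in> ?B - A})"
    using exists_translate_overlap[OF mAB sAB r(3)] by blast
  moreover have "(measure lborel (A - ?B))\<^sup>2 / (2 * ?V) \<le> measure lborel (A - ?B) * measure lborel (?B - A) / (2 * ?V)"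
    using le' V by (intro divide_right_mono) (auto simp: power2_eq_square intro!: mult_left_mono)
  ultimately have w: "(measure lborel (A - ?B))\<^sup>2 / (2 * ?V) \<le> measure lborel ((A - ?B) \<inter> {y. y - w \<in> ?B - A})" by linarith
  \<comment> \<open>For \<open>w = 0\<close> the overlap is empty because the two differences are
    disjoint, and any direction will do.\<close>
  obtain u c where uc: "norm u = 1" "w = c *\<^sub>R u"
  proof (cases "w = 0")
    case True
    obtain b :: 'a where "b \<in> Basis" using nonempty_Basis by blast
    then show ?thesis using True by (intro that[of b 0]) auto
  next
    case False
    then show ?thesis by (intro that[of "w /\<^sub>R norm w" "norm w"]) auto
  qed
  show ?thesis
    using measure_symmetral_Diff_ball[OF uc(1) A(1) r(1), of c] w uc by (intro exI[of _ u]) auto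
qed

section \<open>Symmetrization of all factors of a product\<close>

lemma ennreal_power2_le_imp_le: "a\<^sup>2 \<le> b\<^sup>2 \<Longrightarrow> a \<le> b" for a b :: ennreal
proof (cases a; cases b)
  fix x y :: real assume *: "0 \<le> x" "a = ennreal x" "0 \<le> y" "b = ennreal y" "a\<^sup>2 \<le> b\<^sup>2"
  then have "x\<^sup>2 \<le> y\<^sup>2" by (simp add: ennreal_power)
  then show "a \<le> b" using * power2_le_imp_le by (simp add: ennreal_leI)
qed (auto simp: ennreal_power top_unique)

text \<open>Both \<open>x\<close> and the reflection of \<open>z\<close> have to stay in \<open>G\<close> after averaging; on a line this says
  that the section of \<open>G\<close> is midpoint convex and symmetric.\<close>

definition steiner_convex :: "'i set \<Rightarrow> ('i \<Rightarrow> 'a::euclidean_space) set \<Rightarrow> bool" where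
  "steiner_convex I G \<longleftrightarrow> (\<forall>u x z. norm u = 1 \<longrightarrow> x \<in> G \<longrightarrow> z \<in> G \<longrightarrow> (\<forall>i\<in>I. \<exists>t. z i - x i = t *\<^sub>R u) \<longrightarrow>
     (\<lambda>i\<in>I. (1/2) *\<^sub>R (x i + reflection u (z i))) \<in> G)"

lemma emeasure_symmetral_increase:
  fixes A :: "'i \<Rightarrow> 'a::euclidean_space set"
  assumes I: "finite I" and u: "norm u = 1" and G [measurable]: "G \<in> sets (lborel_pow I)"
    and Gc: "steiner_convex I G" and A: "\<And>i. i \<in> I \<Longrightarrow> cvx_compact (A i)"
  shows "emeasure (lborel_pow I) (G \<inter> PiE I A) \<le> emeasure (lborel_pow I) (G \<inter> PiE I (\<lambda>i. symmetral u (A i)))"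
proof -
  let ?P = "PiM I (\<lambda>_. lborel :: 'a measure)" let ?Q = "PiM I (\<lambda>_. lborel :: real measure)"
  define GA where "GA = G \<inter> PiE I A" define GS where "GS = G \<inter> PiE I (\<lambda>i. symmetral u (A i))"
  have [measurable]: "GA \<in> sets ?P" "GS \<in> sets ?P"
    unfolding GA_def GS_def using A u by (auto intro!: sets.Int sets_PiM_I_finite I cvx_compact_borel cvx_compact_symmetral)
  have uu: "u \<bullet> u = 1" using u by (simp add: norm_eq_1)
  have line: "(\<integral>\<^sup>+s. indicator GA (\<lambda>i\<in>I. x i + s i *\<^sub>R u) \<partial>?Q) \<le> (\<integral>\<^sup>+s. indicator GS (\<lambda>i\<in>I. x i + s i *\<^sub>R u) \<partial>?Q)" for x
  proof (rule ennreal_power2_le_imp_le)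
    \<comment> \<open>Reflection in direction \<open>u\<close> sends the parameter
      \<open>s i\<close> on the line through \<open>x i\<close> to
      \<open>- 2 * p i - s i\<close>.\<close>
    define p where "p i = x i \<bullet> u" for i
    define f :: "('i \<Rightarrow> real) \<Rightarrow> ennreal" where "f s = indicator GA (\<lambda>i\<in>I. x i + s i *\<^sub>R u)" for s
    define h :: "('i \<Rightarrow> real) \<Rightarrow> ennreal" where "h s = indicator GS (\<lambda>i\<in>I. x i + s i *\<^sub>R u)" for s
    have [measurable]: "(\<lambda>s. \<lambda>i\<in>I. x i + s i *\<^sub>R u) \<in> ?Q \<rightarrow>\<^sub>M ?P"
      "(\<lambda>s. \<lambda>i\<in>I. - 2 * p i - s i) \<in> ?Q \<rightarrow>\<^sub>M ?Q" by measurable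
    have [measurable]: "f \<in> borel_measurable ?Q" "h \<in> borel_measurable ?Q"
      unfolding f_def h_def by measurable
    have "(\<integral>\<^sup>+s. f (\<lambda>i\<in>I. - 2 * p i - s i) \<partial>?Q) = (\<integral>\<^sup>+s. f s \<partial>?Q)"
      by (rule nn_integral_PiM_lborel_vimage[OF I]) (auto simp: distr_lborel_point_reflection)
    then have "(\<integral>\<^sup>+s. f s \<partial>?Q)\<^sup>2 = (\<integral>\<^sup>+s. f s \<partial>?Q) * (\<integral>\<^sup>+s. f (\<lambda>i\<in>I. - 2 * p i - s i) \<partial>?Q)"
      by (simp add: power2_eq_square)
    also have "\<dots> \<le> (\<integral>\<^sup>+s. h s \<partial>?Q)\<^sup>2"
    proof (rule prekopa_leindler_PiM[OF I])
      fix s s' :: "'i \<Rightarrow> real"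
      let ?x = "\<lambda>i\<in>I. x i + s i *\<^sub>R u" let ?z = "\<lambda>i\<in>I. x i + (- 2 * p i - s' i) *\<^sub>R u"
      let ?m = "\<lambda>i\<in>I. x i + ((s i + s' i) / 2) *\<^sub>R u"
      have zz: "(\<lambda>i\<in>I. x i + (\<lambda>i\<in>I. - 2 * p i - s' i) i *\<^sub>R u) = ?z" "(\<lambda>i\<in>I. x i + (\<lambda>i\<in>I. (s i + s' i) / 2) i *\<^sub>R u) = ?m"
        by (auto simp: fun_eq_iff)
      have "?m \<in> GS" if "?x \<in> GA" "?z \<in> GA"
      proof -
        \<comment> \<open>The point \<open>?z i\<close> has the mirror image of \<open>s' i\<close>
          as its parameter; reflecting it back makes the average land at the midpoint of
          \<open>s i\<close> and \<open>s' i\<close>.\<close>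
        have m: "x i + ((s i + s' i) / 2) *\<^sub>R u = (1/2) *\<^sub>R (?x i + reflection u (?z i))" if "i \<in> I" for i
          using that reflection_line[OF u, of "x i" "- 2 * p i - s' i"] midpoint_line[of "x i" "s i" "s' i" u] by (simp add: p_def)
        have t: "?z i - ?x i = (- 2 * p i - s' i - s i) *\<^sub>R u" if "i \<in> I" for i
          using that by (simp add: algebra_simps)
        have "?m = (\<lambda>i\<in>I. (1/2) *\<^sub>R (?x i + reflection u (?z i)))" using m by (auto simp: fun_eq_iff)
        also have "\<dots> \<in> G" using that t u Gc unfolding steiner_convex_def GA_def by blast
        finally have "?m \<in> G" .
        moreover have "?m i \<in> symmetral u (A i)" if i: "i \<in> I" for i
        proof -
          have "?x i \<in> A i" "?z i \<in> A i" using \<open>?x \<in> GA\<close> \<open>?z \<in> GA\<close> i unfolding GA_def PiE_iff by blast+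
          then have "(1/2) *\<^sub>R (?x i + reflection u (?z i)) \<in> symmetral u (A i)" using t[OF i] unfolding symmetral_def by blast
          then show ?thesis using m[OF i] i by simp
        qed
        ultimately show ?thesis unfolding GS_def PiE_iff by simp
      qed
      then show "f s * f (\<lambda>i\<in>I. - 2 * p i - s' i) \<le> (h (\<lambda>i\<in>I. (s i + s' i) / 2))\<^sup>2"
        unfolding f_def h_def zz by (auto simp: indicator_def simp del: restrict_apply)
    qed measurable
    finally show "(\<integral>\<^sup>+s. indicator GA (\<lambda>i\<in>I. x i + s i *\<^sub>R u) \<partial>?Q)\<^sup>2 \<le> (\<integral>\<^sup>+s. indicator GS (\<lambda>i\<in>I. x i + s i *\<^sub>R u) \<partial>?Q)\<^sup>2"
      unfolding f_def h_def .
  qed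
  have "emeasure ?P GA = (\<integral>\<^sup>+x. indicator (PiE I (\<lambda>_. {x. x \<bullet> u \<in> {0..1}})) x * (\<integral>\<^sup>+s. indicator GA (\<lambda>i\<in>I. x i + s i *\<^sub>R u) \<partial>?Q) \<partial>?P)"
    using nn_integral_lines_PiM[OF I u, of "indicator GA"] by simp
  also have "\<dots> \<le> (\<integral>\<^sup>+x. indicator (PiE I (\<lambda>_. {x. x \<bullet> u \<in> {0..1}})) x * (\<integral>\<^sup>+s. indicator GS (\<lambda>i\<in>I. x i + s i *\<^sub>R u) \<partial>?Q) \<partial>?P)"
    by (intro nn_integral_mono mult_left_mono line) simp
  also have "\<dots> = emeasure ?P GS"
    using nn_integral_lines_PiM[OF I u, of "indicator GS"] by simp
  finally show ?thesis unfolding GA_def GS_def .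
qed

text \<open>Union bound: a tuple from the product of the \<open>A i\<close> that is outside the
  product of the \<open>B i\<close> has some coordinate in \<open>A i - B i\<close>, while the
  remaining \<open>card I - 1\<close> coordinates lie in the ball of radius
  \<open>R\<close>.\<close>

lemma emeasure_PiM_replace_le:
  fixes A :: "'i \<Rightarrow> 'a::euclidean_space set"
  assumes I: "finite I" and A: "\<And>i. i \<in> I \<Longrightarrow> A i \<in> sets borel \<and> A i \<subseteq> cball 0 R" and B: "\<And>i. i \<in> I \<Longrightarrow> B i \<in> sets borel"
    and G: "G \<in> sets (lborel_pow I)"
  shows "emeasure (lborel_pow I) (G \<inter> PiE I A) \<le> emeasure (lborel_pow I) (G \<inter> PiE I B) +
    ennreal ((\<Sum>i\<in>I. measure lborel (A i - B i)) * measure lborel (cball (0::'a) R) ^ (card I - 1))"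
proof -
  let ?P = "PiM I (\<lambda>_. lborel :: 'a measure)"
  define D where "D i = PiE I (\<lambda>j. if j = i then A j - B j else A j)" for i
  have m: "PiE I A \<in> sets ?P" "PiE I B \<in> sets ?P" "D i \<in> sets ?P" for i
    using B conjunct1[OF A] by (auto intro!: sets_PiM_I_finite I simp: D_def)
  have sub: "G \<inter> PiE I A \<subseteq> (G \<inter> PiE I B) \<union> (\<Union>i\<in>I. D i)"
    by (auto simp: D_def PiE_iff split: if_splits)
  have D: "emeasure ?P (D i) \<le> ennreal (measure lborel (A i - B i) * measure lborel (cball (0::'a) R) ^ (card I - 1))" if i: "i \<in> I" for i
  proof -
    have fm: "A i - B i \<in> fmeasurable lborel"
    proof (rule fmeasurableI2[OF fmeasurable_compact[OF compact_cball[of 0 R]]])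
      show "A i - B i \<subseteq> cball 0 R" using A[OF i] by blast
      show "A i - B i \<in> sets lborel" using sets.Diff[of "A i" lborel "B i"] A[OF i] B[OF i] by simp
    qed
    have "emeasure ?P (D i) = (\<Prod>j\<in>I. emeasure lborel (if j = i then A j - B j else A j))"
      unfolding D_def using A B I by (intro lborelP.emeasure_PiM) auto
    also have "\<dots> = emeasure lborel (A i - B i) * (\<Prod>j\<in>I-{i}. emeasure lborel (A j))"
      using I i by (subst prod.remove[of _ i]) (auto intro!: arg_cong2[where f="(*)"] prod.cong)
    also have "\<dots> \<le> emeasure lborel (A i - B i) * (\<Prod>j\<in>I-{i}. emeasure lborel (cball (0::'a) R))"
      using A by (intro mult_left_mono prod_mono_ennreal emeasure_mono) auto
    also have "\<dots> = ennreal (measure lborel (A i - B i) * measure lborel (cball (0::'a) R) ^ (card I - 1))"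
      using fm i I fmeasurable_compact[OF compact_cball[of "0::'a" R]]
      by (simp add: emeasure_eq_measure2 ennreal_mult ennreal_power)
    finally show ?thesis .
  qed
  have "emeasure ?P (G \<inter> PiE I A) \<le> emeasure ?P ((G \<inter> PiE I B) \<union> (\<Union>i\<in>I. D i))"
    using sub m G I by (intro emeasure_mono sets.Un sets.Int sets.finite_UN) auto
  also have "\<dots> \<le> emeasure ?P (G \<inter> PiE I B) + emeasure ?P (\<Union>i\<in>I. D i)"
    using m G I by (intro emeasure_subadditive sets.Int sets.finite_UN) auto
  also have "emeasure ?P (\<Union>i\<in>I. D i) \<le> (\<Sum>i\<in>I. emeasure ?P (D i))"
    using m I by (intro emeasure_subadditive_finite) auto
  also have "\<dots> \<le> (\<Sum>i\<in>I. ennreal (measure lborel (A i - B i) * measure lborel (cball (0::'a) R) ^ (card I - 1)))"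
    by (intro sum_mono D)
  also have "\<dots> = ennreal ((\<Sum>i\<in>I. measure lborel (A i - B i)) * measure lborel (cball (0::'a) R) ^ (card I - 1))"
    by (subst sum_ennreal) (auto simp: sum_distrib_right)
  finally show ?thesis by simp
qed

text \<open>If the infimum \<open>l\<close> were positive, an element below
  \<open>l + c * l\<^sup>2\<close> would be sent by \<open>step\<close> below \<open>l\<close>. Thus
  no sequence of symmetrizations has to be shown to converge.\<close>

lemma Inf_quadratic_descent:
  fixes M :: "real set"
  assumes ne: "M \<noteq> {}" and nn: "\<And>m. m \<in> M \<Longrightarrow> m \<ge> 0" and c: "c > 0"
    and step: "\<And>m. m \<in> M \<Longrightarrow> \<exists>m'\<in>M. m' \<le> m - c * m\<^sup>2" and e: "e > 0"
  shows "\<exists>m\<in>M. m < e"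
proof (rule ccontr)
  assume "\<not> ?thesis"
  then have e': "\<And>m. m \<in> M \<Longrightarrow> e \<le> m" by force
  define l where "l = Inf M"
  have l: "l \<le> m" if "m \<in> M" for m unfolding l_def using nn that by (intro cInf_lower bdd_belowI) auto
  have "e \<le> l" unfolding l_def using ne e' by (intro cInf_greatest) auto
  then have "l > 0" using e by simp
  then have "l < l + c * l\<^sup>2" using c by simp
  then obtain m where m: "m \<in> M" "m < l + c * l\<^sup>2" unfolding l_def using cInf_lessD[OF ne] by blast
  obtain m' where m': "m' \<in> M" "m' \<le> m - c * m\<^sup>2" using step[OF m(1)] by blast
  have "c * l\<^sup>2 \<le> c * m\<^sup>2" using l[OF m(1)] \<open>l > 0\<close> c by (intro mult_left_mono power_mono) auto
  then show False using m m' l[OF m'(1)] by linarith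
qed

text \<open>All factors must be symmetrized in the same direction, since
  \<open>steiner_convex\<close> concerns whole tuples. The direction is chosen for one factor
  carrying a fixed share of the total excess \<open>mu\<close> over the balls; the excess of the
  others does not grow, so \<open>mu\<close> still decreases quadratically.\<close>

theorem emeasure_ball_increase:
  fixes A :: "'i \<Rightarrow> 'a::euclidean_space set"
  assumes I: "finite I" and G: "G \<in> sets (lborel_pow I)" and Gc: "steiner_convex I G"
    and A: "\<And>i. i \<in> I \<Longrightarrow> cvx_compact (A i)" and r: "\<And>i. i \<in> I \<Longrightarrow> r i \<ge> 0"
    and vol: "\<And>i. i \<in> I \<Longrightarrow> measure lborel (A i) \<le> measure lborel (cball (0::'a) (r i))"
  shows "emeasure (lborel_pow I) (G \<inter> PiE I A) \<le> emeasure (lborel_pow I) (G \<inter> PiE I (\<lambda>i. cball 0 (r i)))"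
proof -
  let ?P = "PiM I (\<lambda>_. lborel :: 'a measure)"
  have "bounded ((\<Union>i\<in>I. A i) \<union> (\<Union>i\<in>I. cball 0 (r i)))"
    using A I by (auto simp: cvx_compact_def compact_imp_bounded)
  then obtain R where R: "R > 0" "(\<Union>i\<in>I. A i) \<union> (\<Union>i\<in>I. cball 0 (r i)) \<subseteq> ball 0 R"
    using bounded_subset_ballD[of _ 0] by blast
  have AR: "A i \<subseteq> cball 0 R" "r i \<le> R" if "i \<in> I" for i
  proof -
    show "A i \<subseteq> cball 0 R" using R that by fastforce
    have "cball (0::'a) (r i) \<subseteq> cball 0 R" using R that by fastforce
    then show "r i \<le> R" using r[OF that] by (auto simp: cball_subset_cball_iff)
  qed
  define V where "V = measure lborel (cball (0::'a) (2 * R))"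
  have V: "V > 0" unfolding V_def using R by (subst content_cball) auto
  \<comment> \<open>The invariant kept by symmetrization; the infimum of \<open>mu\<close> is taken
    over all families satisfying it.\<close>
  define valid where "valid C \<longleftrightarrow> (\<forall>i\<in>I. cvx_compact (C i) \<and> C i \<subseteq> cball 0 R \<and> measure lborel (C i) \<le> measure lborel (cball (0::'a) (r i))) \<and>
     emeasure ?P (G \<inter> PiE I A) \<le> emeasure ?P (G \<inter> PiE I C)" for C
  define mu where "mu C = (\<Sum>i\<in>I. measure lborel (C i - cball (0::'a) (r i)))" for C
  \<comment> \<open>One more than the number of factors, for strictness in the pigeonhole argument
    and a nonzero denominator when \<open>I\<close> is empty. The constant \<open>c\<close> is then
    read off from \<open>(mu C / N)\<^sup>2 / (2 * V)\<close>.\<close>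
  define N where "N = real (card I) + 1"
  define c where "c = 1 / (2 * V * N\<^sup>2)"
  have c: "c > 0" using V by (auto simp: c_def N_def)
  have step: "\<exists>C'. valid C' \<and> mu C' \<le> mu C - c * (mu C)\<^sup>2" if C: "valid C" for C
  proof (cases "mu C = 0")
    case True then show ?thesis using C by (intro exI[of _ C]) simp
  next
    case False
    define m where "m i = measure lborel (C i - cball (0::'a) (r i))" for i
    have mu: "mu C = sum m I" by (simp add: mu_def m_def)
    have "mu C \<ge> 0" unfolding mu_def by (intro sum_nonneg) auto
    obtain i where i: "i \<in> I" "mu C / N \<le> m i"
    proof (rule ccontr)
      assume "\<not> thesis"
      then have "\<And>i. i \<in> I \<Longrightarrow> m i \<le> mu C / N" using that by force
      then have "mu C \<le> real (card I) * (mu C / N)" unfolding mu by (rule sum_bounded_above)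
      moreover have "real (card I) * (mu C / N) < mu C" using False \<open>mu C \<ge> 0\<close> by (simp add: N_def field_simps)
      ultimately show False by simp
    qed
    have Ci: "cvx_compact (C j)" "C j \<subseteq> cball 0 R" "measure lborel (C j) \<le> measure lborel (cball (0::'a) (r j))" if "j \<in> I" for j
      using C that unfolding valid_def by auto
    obtain u where u: "norm u = 1" "measure lborel (symmetral u (C i) - cball 0 (r i)) \<le> m i - (m i)\<^sup>2 / (2 * V)"
      using exists_symmetral_gain[OF Ci(1,2)[OF i(1)] r[OF i(1)] AR(2)[OF i(1)] R(1) Ci(3)[OF i(1)]] unfolding m_def V_def by blast
    let ?C = "\<lambda>i. symmetral u (C i)"
    have "valid ?C"
      unfolding valid_def
    proof (intro conjI ballI)
      fix j assume j: "j \<in> I"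
      show "cvx_compact (symmetral u (C j))" "symmetral u (C j) \<subseteq> cball 0 R" using Ci[OF j] u by (auto intro: cvx_compact_symmetral symmetral_subset_cball[THEN subsetD])
      show "measure lborel (symmetral u (C j)) \<le> measure lborel (cball (0::'a) (r j))"
        using measure_symmetral_le[OF u(1) Ci(1)[OF j]] Ci(3)[OF j] by simp
    next
      have "emeasure ?P (G \<inter> PiE I C) \<le> emeasure ?P (G \<inter> PiE I ?C)"
        by (rule emeasure_symmetral_increase[OF I u(1) G Gc Ci(1)])
      then show "emeasure ?P (G \<inter> PiE I A) \<le> emeasure ?P (G \<inter> PiE I ?C)"
        using C unfolding valid_def by (blast intro: order_trans)
    qed
    moreover have "mu ?C \<le> mu C - c * (mu C)\<^sup>2"
    proof -
      \<comment> \<open>With translation length 0 the gain term is merely nonnegative, which leaves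
        monotonicity of the excess for every factor.\<close>
      have le: "measure lborel (symmetral u (C j) - cball 0 (r j)) \<le> m j" if "j \<in> I" for j
        using measure_symmetral_Diff_ball[OF u(1) Ci(1)[OF that] r[OF that], of 0] measure_nonneg unfolding m_def
        by (smt (verit))
      have "mu ?C = measure lborel (symmetral u (C i) - cball 0 (r i)) + (\<Sum>j\<in>I-{i}. measure lborel (symmetral u (C j) - cball 0 (r j)))"
        unfolding mu_def using I i by (subst sum.remove[of _ i]) auto
      also have "\<dots> \<le> (m i - (m i)\<^sup>2 / (2 * V)) + (\<Sum>j\<in>I-{i}. m j)"
        using le u by (intro add_mono sum_mono) auto
      also have "\<dots> = mu C - (m i)\<^sup>2 / (2 * V)" unfolding mu using I i by (subst (2) sum.remove[of _ i]) auto
      also have "\<dots> \<le> mu C - (mu C / N)\<^sup>2 / (2 * V)"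
        using i V \<open>mu C \<ge> 0\<close> by (intro diff_left_mono divide_right_mono power_mono) (auto simp: N_def)
      also have "\<dots> = mu C - c * (mu C)\<^sup>2" by (simp add: c_def power_divide)
      finally show ?thesis .
    qed
    ultimately show ?thesis by blast
  qed
  have vA: "valid A" unfolding valid_def using A AR vol by auto
  define K where "K = measure lborel (cball (0::'a) R) ^ (card I - 1)"
  have K: "K \<ge> 0" by (simp add: K_def)
  show ?thesis
  proof (rule ennreal_le_epsilon)
    fix e :: real assume e: "e > 0"
    have "\<exists>m\<in>mu ` {C. valid C}. m < e / (K + 1)"
    proof (rule Inf_quadratic_descent[OF _ _ c])
      show "mu ` {C. valid C} \<noteq> {}" using vA by blast
      show "\<And>m. m \<in> mu ` {C. valid C} \<Longrightarrow> 0 \<le> m" unfolding mu_def by (auto intro: sum_nonneg)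
      show "\<And>m. m \<in> mu ` {C. valid C} \<Longrightarrow> \<exists>m'\<in>mu ` {C. valid C}. m' \<le> m - c * m\<^sup>2" using step by blast
      show "e / (K + 1) > 0" using e K by simp
    qed
    then obtain C where C: "valid C" "mu C < e / (K + 1)" by auto
    have "mu C * K \<le> e / (K + 1) * (K + 1)" using C K e by (intro mult_mono) auto
    then have muK: "mu C * K \<le> e" using K by simp
    have "emeasure ?P (G \<inter> PiE I A) \<le> emeasure ?P (G \<inter> PiE I C)" using C unfolding valid_def by blast
    also have "\<dots> \<le> emeasure ?P (G \<inter> PiE I (\<lambda>i. cball 0 (r i))) + ennreal (mu C * K)"
      unfolding mu_def K_def using C(1) by (intro emeasure_PiM_replace_le I G) (auto simp: valid_def cvx_compact_borel)
    also have "\<dots> \<le> emeasure ?P (G \<inter> PiE I (\<lambda>i. cball 0 (r i))) + ennreal e"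
      by (intro add_left_mono ennreal_leI muK)
    finally show "emeasure ?P (G \<inter> PiE I A) \<le> emeasure ?P (G \<inter> PiE I (\<lambda>i. cball 0 (r i))) + ennreal e" .
  qed
qed

section \<open>M-combinations of convex hulls\<close>

lemma intrinsic_volume_mono:
  fixes A B :: "(real ^ 'n) set"
  assumes "cvx_compact A" "cvx_compact B" "A \<subseteq> B" "j \<le> CARD('n)"
  shows "intrinsic_volume j A \<le> intrinsic_volume j B"
  using assms by (simp add: intrinsic_volume_eq_parallel_coeff divide_right_mono parallel_coeff_mono del: of_nat_diff)

lemma intrinsic_volume_shadow_mid:
  fixes A B C :: "(real ^ 'n) set"
  assumes "norm u = 1" "cvx_compact A" "cvx_compact B" "cvx_compact C" "shadow_mid u A B C" "j \<le> CARD('n)"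
  shows "intrinsic_volume j C \<le> (intrinsic_volume j A + intrinsic_volume j B) / 2"
proof -
  have "parallel_coeff (CARD('n) - j) C \<le> (parallel_coeff (CARD('n) - j) A + parallel_coeff (CARD('n) - j) B) / 2"
    using assms by (intro parallel_coeff_shadow_mid) auto
  then have "parallel_coeff (CARD('n) - j) C / unit_ball_vol (real (CARD('n) - j)) \<le> (parallel_coeff (CARD('n) - j) A + parallel_coeff (CARD('n) - j) B) / 2 / unit_ball_vol (real (CARD('n) - j))"
    by (intro divide_right_mono) (auto simp del: of_nat_diff)
  then show ?thesis using assms by (simp add: intrinsic_volume_eq_parallel_coeff add_divide_distrib mult.commute del: of_nat_diff)
qed

lemma cvx_compact_reflection: "cvx_compact A \<Longrightarrow> cvx_compact (reflection u ` A)"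
  unfolding cvx_compact_def by (auto intro: compact_continuous_image continuous_on_reflection convex_linear_image linear_reflection)

lemma intrinsic_volume_reflection:
  fixes A :: "(real ^ 'n) set"
  assumes "norm u = 1" "cvx_compact A" "j \<le> CARD('n)"
  shows "intrinsic_volume j (reflection u ` A) = intrinsic_volume j A"
  using assms by (simp add: intrinsic_volume_eq_parallel_coeff parallel_coeff_reflection cvx_compact_reflection)

lemma intrinsic_volume_scaleR:
  fixes A :: "(real ^ 'n) set"
  assumes "t > 0" "cvx_compact A" "j \<le> CARD('n)"
  shows "intrinsic_volume j ((*\<^sub>R) t ` A) = t ^ j * intrinsic_volume j A"
  using assms by (simp add: intrinsic_volume_eq_parallel_coeff parallel_coeff_scaleR cvx_compact_scaleR del: of_nat_diff)

text \<open>Nonemptiness is included so that combinations are again \<open>cvx_compact\<close>;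
  empty \<open>M\<close> is treated separately at the end.\<close>

definition combination_set :: "(real \<times> real) set \<Rightarrow> bool" where
  "combination_set M \<longleftrightarrow> compact M \<and> convex M \<and> M \<subseteq> {0..} \<times> {0..} \<and> M \<noteq> {}"

lemma cvx_compact_M_combination:
  assumes M: "combination_set M" and A: "cvx_compact A" and B: "cvx_compact B"
  shows "cvx_compact (M_combination M A B)"
proof -
  have eq: "M_combination M A B = (\<lambda>p. fst (fst p) *\<^sub>R fst (snd p) + snd (fst p) *\<^sub>R snd (snd p)) ` (M \<times> (A \<times> B))"
  proof (intro equalityI subsetI)
    fix p assume "p \<in> M_combination M A B"
    then obtain a b x y where "p = a *\<^sub>R x + b *\<^sub>R y" "x \<in> A" "y \<in> B" "(a, b) \<in> M" unfolding M_combination_def by blast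
    then show "p \<in> (\<lambda>p. fst (fst p) *\<^sub>R fst (snd p) + snd (fst p) *\<^sub>R snd (snd p)) ` (M \<times> (A \<times> B))"
      by (intro image_eqI[of _ _ "((a, b), (x, y))"]) auto
  next
    fix p assume "p \<in> (\<lambda>p. fst (fst p) *\<^sub>R fst (snd p) + snd (fst p) *\<^sub>R snd (snd p)) ` (M \<times> (A \<times> B))"
    then obtain a b x y where "p = a *\<^sub>R x + b *\<^sub>R y" "x \<in> A" "y \<in> B" "(a, b) \<in> M" by auto
    then show "p \<in> M_combination M A B" unfolding M_combination_def by blast
  qed
  have "compact (M_combination M A B)"
    unfolding eq using M A B unfolding combination_set_def cvx_compact_def
    by (intro compact_continuous_image continuous_intros compact_Times) auto
  moreover have "M_combination M A B \<noteq> {}" unfolding eq using M A B unfolding combination_set_def cvx_compact_def by auto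
  moreover have "convex (M_combination M A B)"
  proof (rule convexI)
    \<comment> \<open>Here the positive orthant enters: nonnegative weights can be normalised to a
      convex combination. If the total weight is 0, both terms vanish and any point serves as
      \<open>z\<close>.\<close>
    have mix: "\<exists>z\<in>A. s *\<^sub>R (a *\<^sub>R x) + t *\<^sub>R (b *\<^sub>R y) = (s * a + t * b) *\<^sub>R z"
      if A: "convex A" and xy: "x \<in> A" "y \<in> A" and nn: "s \<ge> 0" "t \<ge> 0" "a \<ge> 0" "b \<ge> 0" for A :: "(real ^ 'n) set" and s t a b x y
    proof (cases "s * a + t * b = 0")
      case True
      moreover have "s * a \<ge> 0" "t * b \<ge> 0" using nn by auto
      ultimately have "s * a = 0" "t * b = 0" by linarith+
      then show ?thesis using xy by (intro bexI[of _ x]) auto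
    next
      case False
      have "s * a \<ge> 0" "t * b \<ge> 0" using nn by auto
      then have "((s * a) / (s * a + t * b)) *\<^sub>R x + ((t * b) / (s * a + t * b)) *\<^sub>R y \<in> A"
      proof (intro convexD[OF A xy])
        show "(s * a) / (s * a + t * b) + (t * b) / (s * a + t * b) = 1"
          using divide_self[OF False] by (simp only: add_divide_distrib)
      qed (use \<open>s * a \<ge> 0\<close> \<open>t * b \<ge> 0\<close> in simp_all)
      moreover have "s *\<^sub>R (a *\<^sub>R x) + t *\<^sub>R (b *\<^sub>R y) =
         (s * a + t * b) *\<^sub>R (((s * a) / (s * a + t * b)) *\<^sub>R x + ((t * b) / (s * a + t * b)) *\<^sub>R y)"
        using False by (simp add: scaleR_right_distrib)
      ultimately show ?thesis by blast
    qed
    fix p q and s t :: real assume pq: "p \<in> M_combination M A B" "q \<in> M_combination M A B" and st: "0 \<le> s" "0 \<le> t" "s + t = 1"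
    obtain a1 a2 x y where p: "p = a1 *\<^sub>R x + a2 *\<^sub>R y" "x \<in> A" "y \<in> B" "(a1, a2) \<in> M" using pq unfolding M_combination_def by blast
    obtain b1 b2 x' y' where q: "q = b1 *\<^sub>R x' + b2 *\<^sub>R y'" "x' \<in> A" "y' \<in> B" "(b1, b2) \<in> M" using pq unfolding M_combination_def by blast
    have nn: "a1 \<ge> 0" "a2 \<ge> 0" "b1 \<ge> 0" "b2 \<ge> 0" using p(4) q(4) M unfolding combination_set_def by auto
    have cvx: "convex A" "convex B" using A B unfolding cvx_compact_def by simp_all
    obtain z where z: "z \<in> A" "s *\<^sub>R (a1 *\<^sub>R x) + t *\<^sub>R (b1 *\<^sub>R x') = (s * a1 + t * b1) *\<^sub>R z"
      using mix[OF cvx(1) p(2) q(2) st(1,2) nn(1,3)] by (elim bexE)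
    obtain z' where z': "z' \<in> B" "s *\<^sub>R (a2 *\<^sub>R y) + t *\<^sub>R (b2 *\<^sub>R y') = (s * a2 + t * b2) *\<^sub>R z'"
      using mix[OF cvx(2) p(3) q(3) st(1,2) nn(2,4)] by (elim bexE)
    have "s *\<^sub>R (a1, a2) + t *\<^sub>R (b1, b2) \<in> M"
      using M st by (intro convexD p q) (simp_all add: combination_set_def)
    then have M': "(s * a1 + t * b1, s * a2 + t * b2) \<in> M" by simp
    have "s *\<^sub>R p + t *\<^sub>R q = (s *\<^sub>R (a1 *\<^sub>R x) + t *\<^sub>R (b1 *\<^sub>R x')) + (s *\<^sub>R (a2 *\<^sub>R y) + t *\<^sub>R (b2 *\<^sub>R y'))"
      unfolding p(1) q(1) by (simp add: algebra_simps)
    then have "s *\<^sub>R p + t *\<^sub>R q = (s * a1 + t * b1) *\<^sub>R z + (s * a2 + t * b2) *\<^sub>R z'" unfolding z z' .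
    then show "s *\<^sub>R p + t *\<^sub>R q \<in> M_combination M A B"
      unfolding M_combination_def using z(1) z'(1) M' by blast
  qed
  ultimately show ?thesis unfolding cvx_compact_def by simp
qed

lemma M_combination_mono: "A \<subseteq> A' \<Longrightarrow> B \<subseteq> B' \<Longrightarrow> M_combination M A B \<subseteq> M_combination M A' B'"
  unfolding M_combination_def by blast

lemma shadow_mid_M_combination:
  assumes "shadow_mid u A B C" "shadow_mid u A' B' C'"
  shows "shadow_mid u (M_combination M A A') (M_combination M B B') (M_combination M C C')"
  unfolding shadow_mid_def
proof
  fix p assume "p \<in> M_combination M C C'"
  then obtain a1 a2 x y where p: "p = a1 *\<^sub>R x + a2 *\<^sub>R y" "x \<in> C" "y \<in> C'" "(a1, a2) \<in> M" unfolding M_combination_def by blast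
  obtain t where t: "x + t *\<^sub>R u \<in> A" "x - t *\<^sub>R u \<in> B" using assms(1) p unfolding shadow_mid_def by blast
  obtain t' where t': "y + t' *\<^sub>R u \<in> A'" "y - t' *\<^sub>R u \<in> B'" using assms(2) p unfolding shadow_mid_def by blast
  have "p + (a1 * t + a2 * t') *\<^sub>R u = a1 *\<^sub>R (x + t *\<^sub>R u) + a2 *\<^sub>R (y + t' *\<^sub>R u)"
    "p - (a1 * t + a2 * t') *\<^sub>R u = a1 *\<^sub>R (x - t *\<^sub>R u) + a2 *\<^sub>R (y - t' *\<^sub>R u)"
    unfolding p by (simp_all add: algebra_simps)
  then show "\<exists>t. p + t *\<^sub>R u \<in> M_combination M A A' \<and> p - t *\<^sub>R u \<in> M_combination M B B'"
    unfolding M_combination_def using t t' p(4) by blast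
qed

text \<open>The points \<open>p\<close> that admit a suitable displacement form a convex set,
  because displacements can be averaged along with the points, and this set contains the
  generators.\<close>

lemma shadow_mid_hull:
  assumes "\<And>i. i \<in> J \<Longrightarrow> \<exists>t. x i = m i + t *\<^sub>R u \<and> y i = m i - t *\<^sub>R u"
  shows "shadow_mid u (convex hull (x ` J)) (convex hull (y ` J)) (convex hull (m ` J))"
proof -
  let ?S = "{p. \<exists>t. p + t *\<^sub>R u \<in> convex hull (x ` J) \<and> p - t *\<^sub>R u \<in> convex hull (y ` J)}"
  have "convex ?S"
  proof (rule convexI)
    fix p q and a b :: real assume pq: "p \<in> ?S" "q \<in> ?S" and ab: "0 \<le> a" "0 \<le> b" "a + b = 1"
    obtain t where t: "p + t *\<^sub>R u \<in> convex hull (x ` J)" "p - t *\<^sub>R u \<in> convex hull (y ` J)" using pq by blast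
    obtain t' where t': "q + t' *\<^sub>R u \<in> convex hull (x ` J)" "q - t' *\<^sub>R u \<in> convex hull (y ` J)" using pq by blast
    have "a *\<^sub>R p + b *\<^sub>R q + (a * t + b * t') *\<^sub>R u = a *\<^sub>R (p + t *\<^sub>R u) + b *\<^sub>R (q + t' *\<^sub>R u)"
      "a *\<^sub>R p + b *\<^sub>R q - (a * t + b * t') *\<^sub>R u = a *\<^sub>R (p - t *\<^sub>R u) + b *\<^sub>R (q - t' *\<^sub>R u)"
      by (simp_all add: algebra_simps)
    moreover have "a *\<^sub>R (p + t *\<^sub>R u) + b *\<^sub>R (q + t' *\<^sub>R u) \<in> convex hull (x ` J)"
      "a *\<^sub>R (p - t *\<^sub>R u) + b *\<^sub>R (q - t' *\<^sub>R u) \<in> convex hull (y ` J)"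
      using t t' ab by (auto intro!: convexD[OF convex_convex_hull])
    ultimately show "a *\<^sub>R p + b *\<^sub>R q \<in> ?S" by (intro CollectI exI[of _ "a * t + b * t'"]) simp
  qed
  moreover have "m ` J \<subseteq> ?S"
  proof
    fix p assume "p \<in> m ` J"
    then obtain i where i: "i \<in> J" "p = m i" by blast
    obtain t where "x i = m i + t *\<^sub>R u" "y i = m i - t *\<^sub>R u" using assms[OF i(1)] by blast
    then have "p + t *\<^sub>R u \<in> convex hull (x ` J)" "p - t *\<^sub>R u \<in> convex hull (y ` J)"
      using i by (metis hull_inc imageI)+
    then show "p \<in> ?S" by blast
  qed
  ultimately have "convex hull (m ` J) \<subseteq> ?S" by (intro hull_minimal)
  then show ?thesis unfolding shadow_mid_def by blast
qed

lemma cvx_compact_hull: "finite J \<Longrightarrow> J \<noteq> {} \<Longrightarrow> cvx_compact (convex hull (x ` J))"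
  unfolding cvx_compact_def by (auto intro: finite_imp_compact_convex_hull)

lemma M_combination_linear_image:
  assumes "linear f"
  shows "M_combination M (f ` A) (f ` B) = f ` M_combination M A B"
proof -
  have f: "f (a *\<^sub>R x + b *\<^sub>R y) = a *\<^sub>R f x + b *\<^sub>R f y" for a b x y
    using assms by (simp add: linear_add linear_cmul)
  show ?thesis
  proof (intro equalityI subsetI)
    fix p assume "p \<in> M_combination M (f ` A) (f ` B)"
    then obtain a b x y where "p = a *\<^sub>R f x + b *\<^sub>R f y" "x \<in> A" "y \<in> B" "(a, b) \<in> M" unfolding M_combination_def by blast
    then show "p \<in> f ` M_combination M A B" unfolding f[symmetric] M_combination_def by blast
  next
    fix p assume "p \<in> f ` M_combination M A B"
    then obtain a b x y where "p = f (a *\<^sub>R x + b *\<^sub>R y)" "x \<in> A" "y \<in> B" "(a, b) \<in> M" unfolding M_combination_def by blast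
    then show "p \<in> M_combination M (f ` A) (f ` B)" unfolding f M_combination_def by blast
  qed
qed

section \<open>Intrinsic volume as a function of the tuple of points\<close>

definition hull_comb :: "(real \<times> real) set \<Rightarrow> 'i set \<Rightarrow> 'i set \<Rightarrow> ('i \<Rightarrow> real ^ 'n) \<Rightarrow> (real ^ 'n) set" where
  "hull_comb M J1 J2 x = M_combination M (convex hull (x ` J1)) (convex hull (x ` J2))"

context
  fixes M :: "(real \<times> real) set" and J1 J2 :: "'i set" and j :: nat
  assumes M: "combination_set M" and J: "finite J1" "finite J2" "J1 \<noteq> {}" "J2 \<noteq> {}" and j: "j \<le> CARD('n::finite)"
begin

lemma cvx_compact_hull_comb: "cvx_compact (hull_comb M J1 J2 (x :: 'i \<Rightarrow> real ^ 'n))"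
  unfolding hull_comb_def using J by (intro cvx_compact_M_combination M cvx_compact_hull)

text \<open>The reflected points \<open>y i\<close> give a reflected body with the same intrinsic
  volume as for \<open>z\<close>. Since \<open>x i\<close> and \<open>y i\<close> differ by a
  multiple of \<open>u\<close>, the midpoints \<open>m i\<close> give the middle of a shadow system,
  and convexity along it preserves the bound.\<close>

lemma steiner_convex_sublevel:
  fixes c :: real
  shows "steiner_convex (J1 \<union> J2) {x \<in> space (lborel_pow (J1 \<union> J2)). intrinsic_volume j (hull_comb M J1 J2 (x :: 'i \<Rightarrow> real ^ 'n)) \<le> c}"
  (is "steiner_convex ?I ?G")
  unfolding steiner_convex_def
proof (intro allI impI)
  fix u :: "real ^ 'n" and x z assume u: "norm u = 1" and x: "x \<in> ?G" and z: "z \<in> ?G" and par: "\<forall>i\<in>?I. \<exists>t. z i - x i = t *\<^sub>R u"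
  define y where "y i = reflection u (z i)" for i
  define m where "m = (\<lambda>i\<in>?I. (1/2) *\<^sub>R (x i + y i))"
  have mid: "\<exists>t. x i = m i + t *\<^sub>R u \<and> y i = m i - t *\<^sub>R u" if i: "i \<in> ?I" for i
  proof -
    obtain t where "z i - x i = t *\<^sub>R u" using par i by blast
    then have "z i = x i + t *\<^sub>R u" by (simp add: algebra_simps)
    then have "y i = x i + (- 2 * (x i \<bullet> u) - t) *\<^sub>R u" unfolding y_def by (simp only: reflection_line[OF u])
    then obtain r where y: "y i = x i + r *\<^sub>R u" by blast
    have m: "m i = x i + (r / 2) *\<^sub>R u"
      using midpoint_line[of "x i" 0 r u] i by (simp add: m_def y)
    have "(r / 2) *\<^sub>R u + (r / 2) *\<^sub>R u = r *\<^sub>R u" by (simp flip: scaleR_left_distrib)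
    then show ?thesis unfolding m y by (intro exI[of _ "- (r / 2)"]) (simp add: add.assoc)
  qed
  have "shadow_mid u (hull_comb M J1 J2 x) (hull_comb M J1 J2 y) (hull_comb M J1 J2 m)"
    unfolding hull_comb_def by (intro shadow_mid_M_combination shadow_mid_hull mid) auto
  then have avg: "intrinsic_volume j (hull_comb M J1 J2 m) \<le> (intrinsic_volume j (hull_comb M J1 J2 x) + intrinsic_volume j (hull_comb M J1 J2 y)) / 2"
    by (rule intrinsic_volume_shadow_mid[OF u cvx_compact_hull_comb cvx_compact_hull_comb cvx_compact_hull_comb _ j])
  have "hull_comb M J1 J2 y = reflection u ` hull_comb M J1 J2 z"
  proof -
    have "convex hull (y ` J) = reflection u ` (convex hull (z ` J))" for J
      unfolding convex_hull_linear_image[OF linear_reflection] image_image y_def ..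
    then show ?thesis unfolding hull_comb_def by (simp only: M_combination_linear_image[OF linear_reflection])
  qed
  then have yz: "intrinsic_volume j (hull_comb M J1 J2 y) = intrinsic_volume j (hull_comb M J1 J2 z)"
    by (simp add: intrinsic_volume_reflection[OF u cvx_compact_hull_comb j])
  have "intrinsic_volume j (hull_comb M J1 J2 x) \<le> c" "intrinsic_volume j (hull_comb M J1 J2 y) \<le> c"
    using x z unfolding yz by auto
  then have "(intrinsic_volume j (hull_comb M J1 J2 x) + intrinsic_volume j (hull_comb M J1 J2 y)) / 2 \<le> c" by simp
  with avg have "intrinsic_volume j (hull_comb M J1 J2 m) \<le> c" by (rule order_trans)
  moreover have "m \<in> space (lborel_pow ?I)" unfolding m_def by (simp add: space_PiM PiE_iff)
  ultimately have "m \<in> ?G" by simp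
  then show "(\<lambda>i\<in>?I. (1/2) *\<^sub>R (x i + reflection u (z i))) \<in> ?G" unfolding m_def y_def .
qed

text \<open>Upper semicontinuity, which suffices for measurability.\<close>

lemma hull_comb_usc:
  fixes x :: "'i \<Rightarrow> real ^ 'n"
  assumes d: "d > 0"
  shows "\<exists>U. open U \<and> x \<in> U \<and> (\<forall>y\<in>U. hull_comb M J1 J2 y \<subseteq> hull_comb M J1 J2 x + cball 0 d)"
proof -
  obtain b where b: "b > 0" "\<And>p. p \<in> M \<Longrightarrow> norm p \<le> b"
    using M compact_imp_bounded[of M] unfolding combination_set_def bounded_pos by auto
  \<comment> \<open>Coefficients in \<open>M\<close> are at most \<open>b\<close>, so moving every
    point by less than \<open>e\<close> moves a combination by at most
    \<open>2 * b * e = d\<close>.\<close>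
  define e where "e = d / (2 * b)"
  have e: "e > 0" "2 * b * e = d" using b d by (auto simp: e_def)
  define U where "U = (\<Inter>i\<in>J1 \<union> J2. (\<lambda>y :: 'i \<Rightarrow> real ^ 'n. y i) -` ball (x i) e)"
  have "open U" unfolding U_def using J by (intro open_INT ballI open_vimage) auto
  moreover have "x \<in> U" unfolding U_def using e by auto
  moreover have "hull_comb M J1 J2 y \<subseteq> hull_comb M J1 J2 x + cball 0 d" if y: "y \<in> U" for y
  proof -
    have hull: "convex hull (y ` J) \<subseteq> convex hull (x ` J) + cball 0 e" if "J \<subseteq> J1 \<union> J2" for J
    proof (rule hull_minimal)
      show "y ` J \<subseteq> convex hull (x ` J) + cball 0 e"
      proof
        fix p assume "p \<in> y ` J"
        then obtain i where i: "i \<in> J" "p = y i" by blast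
        then have "dist (x i) (y i) < e" using y that unfolding U_def by auto
        then have "y i - x i \<in> cball 0 e" by (simp add: dist_norm norm_minus_commute)
        then have "x i + (y i - x i) \<in> convex hull (x ` J) + cball 0 e" using i by (intro set_plus_intro) (auto intro: hull_inc)
        then show "p \<in> convex hull (x ` J) + cball 0 e" using i by simp
      qed
    qed (intro convex_set_plus; simp)
    show ?thesis
    proof
      fix p assume "p \<in> hull_comb M J1 J2 y"
      then obtain a1 a2 v w where p: "p = a1 *\<^sub>R v + a2 *\<^sub>R w" "v \<in> convex hull (y ` J1)" "w \<in> convex hull (y ` J2)" "(a1, a2) \<in> M"
        unfolding hull_comb_def M_combination_def by blast
      obtain v' f where v: "v' \<in> convex hull (x ` J1)" "norm f \<le> e" "v = v' + f"
      proof -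
        have "v \<in> convex hull (x ` J1) + cball 0 e" using hull[of J1] p(2) by blast
        then show thesis by (rule set_plus_elim) (auto intro: that)
      qed
      obtain w' g where w: "w' \<in> convex hull (x ` J2)" "norm g \<le> e" "w = w' + g"
      proof -
        have "w \<in> convex hull (x ` J2) + cball 0 e" using hull[of J2] p(3) by blast
        then show thesis by (rule set_plus_elim) (auto intro: that)
      qed
      have a: "\<bar>a1\<bar> \<le> b" "\<bar>a2\<bar> \<le> b"
        using b(2)[OF p(4)] norm_fst_le[of a1 a2] norm_snd_le[of a2 a1] by auto
      have "norm (a1 *\<^sub>R f + a2 *\<^sub>R g) \<le> \<bar>a1\<bar> * norm f + \<bar>a2\<bar> * norm g"
        using norm_triangle_ineq[of "a1 *\<^sub>R f" "a2 *\<^sub>R g"] by simp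
      also have "\<dots> \<le> b * e + b * e" using a v w b e by (intro add_mono mult_mono) auto
      finally have "a1 *\<^sub>R f + a2 *\<^sub>R g \<in> cball 0 d" using e by simp
      moreover have "a1 *\<^sub>R v' + a2 *\<^sub>R w' \<in> hull_comb M J1 J2 x" unfolding hull_comb_def M_combination_def using v w p by blast
      ultimately have "(a1 *\<^sub>R v' + a2 *\<^sub>R w') + (a1 *\<^sub>R f + a2 *\<^sub>R g) \<in> hull_comb M J1 J2 x + cball 0 d" by (intro set_plus_intro)
      then show "p \<in> hull_comb M J1 J2 x + cball 0 d" unfolding p(1) v(3) w(3) by (simp add: algebra_simps)
    qed
  qed
  ultimately show ?thesis by blast
qed

lemma hull_comb_cong: "(\<And>i. i \<in> J1 \<union> J2 \<Longrightarrow> x i = y i) \<Longrightarrow> hull_comb M J1 J2 x = hull_comb M J1 J2 y"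
  using image_cong[of J1 J1 x y] image_cong[of J2 J2 x y] unfolding hull_comb_def by simp

end

lemma borel_measurable_intrinsic_volume_hull_comb:
  fixes J1 J2 :: "'i::countable set" and j :: nat
  assumes M: "combination_set M" and J: "finite J1" "finite J2" "J1 \<noteq> {}" "J2 \<noteq> {}" and j: "j \<le> CARD('n)"
  shows "(\<lambda>x :: 'i \<Rightarrow> real ^ 'n. intrinsic_volume j (hull_comb M J1 J2 x)) \<in> borel_measurable (lborel_pow (J1 \<union> J2))"
proof -
  let ?F = "\<lambda>x :: 'i \<Rightarrow> real ^ 'n. intrinsic_volume j (hull_comb M J1 J2 x)"
  have "(\<lambda>x :: 'i \<Rightarrow> real ^ 'n. parallel_coeff (CARD('n) - j) (hull_comb M J1 J2 x)) \<in> borel_measurable borel"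
    by (intro borel_measurable_parallel_coeff cvx_compact_hull_comb[OF M J j] hull_comb_usc[OF M J j])
  then have "?F \<in> borel_measurable borel"
    by (simp add: intrinsic_volume_eq_parallel_coeff[OF cvx_compact_hull_comb[OF M J j] j])
  \<comment> \<open>Tuples in the product space are \<open>undefined\<close> off the index set.
    Setting those coordinates to 0 gives a map into the space of all functions; since the index type
    is countable, its Borel measurability may be checked coordinatewise.\<close>
  moreover have "(\<lambda>x i. if i \<in> J1 \<union> J2 then x i else 0 :: real ^ 'n) \<in> borel_measurable (lborel_pow (J1 \<union> J2))"
  proof (rule measurable_coordinatewise_then_product)
    fix i show "(\<lambda>x. if i \<in> J1 \<union> J2 then x i else 0 :: real ^ 'n) \<in> borel_measurable (lborel_pow (J1 \<union> J2))"
      by (cases "i \<in> J1 \<union> J2") auto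
  qed
  ultimately have "(\<lambda>x. ?F (\<lambda>i. if i \<in> J1 \<union> J2 then x i else 0)) \<in> borel_measurable (lborel_pow (J1 \<union> J2))"
    by (rule measurable_compose[rotated])
  moreover have "?F (\<lambda>i. if i \<in> J1 \<union> J2 then x i else 0) = ?F x" for x
    by (intro arg_cong[where f="intrinsic_volume j"] hull_comb_cong[OF M J j]) auto
  ultimately show ?thesis by simp
qed

section \<open>Random points\<close>

lemma measure_pos_of_interior:
  fixes K :: "'a::euclidean_space set"
  assumes "compact K" "interior K \<noteq> {}"
  shows "measure lborel K > 0"
proof -
  obtain x e where "e > 0" "cball x e \<subseteq> K" using assms(2) unfolding ex_in_conv[symmetric] mem_interior_cball by blast
  have "0 < measure lborel (cball x e)" using \<open>e > 0\<close> by (subst content_cball) auto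
  also have "\<dots> \<le> measure lborel K"
    using assms(1) \<open>cball x e \<subseteq> K\<close> by (intro measure_mono_fmeasurable fmeasurable_compact) auto
  finally show ?thesis .
qed

lemma vol_radius:
  fixes K :: "(real ^ 'n) set"
  assumes "measure lborel K > 0"
  shows "vol_radius K > 0" "measure lborel (cball (0 :: real ^ 'n) (vol_radius K)) = measure lborel K"
proof -
  let ?V = "measure lborel (cball (0 :: real ^ 'n) 1)"
  have V: "?V = unit_ball_vol (real CARD('n))" by (subst content_cball) auto
  have Vp: "?V > 0" unfolding V by simp
  show pos: "vol_radius K > 0" unfolding vol_radius_def using assms Vp by (intro real_root_gt_zero) auto
  have "vol_radius K ^ CARD('n) = measure lborel K / ?V"
    unfolding vol_radius_def using assms Vp by (intro real_root_pow_pos2) auto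
  then show "measure lborel (cball (0 :: real ^ 'n) (vol_radius K)) = measure lborel K"
    using pos Vp by (subst content_cball) (auto simp: V[symmetric])
qed

lemma emeasure_PiM_uniform_measure:
  fixes A :: "'i \<Rightarrow> 'a::euclidean_space set"
  assumes I: "finite I" and A: "\<And>i. A i \<in> fmeasurable lborel" and pos: "\<And>i. measure lborel (A i) > 0"
  shows "PiM I (\<lambda>i. uniform_measure lborel (A i)) = uniform_measure (lborel_pow I) (PiE I A)"
proof -
  have Am: "A i \<in> sets borel" for i using A[of i] by (simp add: fmeasurable_def)
  have eA: "emeasure lborel (A i) = ennreal (measure lborel (A i))" for i
    using A[of i] by (simp add: emeasure_eq_measure2)
  have "prob_space (uniform_measure lborel (A i))" for i
    using pos[of i] by (intro prob_space_uniform_measure) (auto simp: eA)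
  then interpret product_prob_space "\<lambda>i. uniform_measure lborel (A i)"
    by (rule product_prob_spaceI)
  show ?thesis
  proof (rule PiM_eqI[OF I, symmetric])
    show "sets (uniform_measure (lborel_pow I) (PiE I A)) = sets (PiM I (\<lambda>i. uniform_measure lborel (A i)))"
      by (simp, intro sets_PiM_cong) auto
    fix B assume "\<And>i. i \<in> I \<Longrightarrow> B i \<in> sets (uniform_measure lborel (A i))"
    then have B: "\<And>i. i \<in> I \<Longrightarrow> B i \<in> sets borel" by simp
    have fm: "A i \<inter> B i \<in> fmeasurable lborel" if "i \<in> I" for i
      using A[of i] B[OF that] by (intro fmeasurableI2[OF A[of i]]) (auto simp: fmeasurable_def)
    have "emeasure (uniform_measure (lborel_pow I) (PiE I A)) (PiE I B) =
      emeasure (lborel_pow I) (PiE I A \<inter> PiE I B) / emeasure (lborel_pow I) (PiE I A)"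
      using Am B I by (intro emeasure_uniform_measure sets_PiM_I_finite) auto
    also have "PiE I A \<inter> PiE I B = PiE I (\<lambda>i. A i \<inter> B i)" by (auto simp: PiE_iff)
    also have "emeasure (lborel_pow I) (PiE I (\<lambda>i. A i \<inter> B i)) = ennreal (\<Prod>i\<in>I. measure lborel (A i \<inter> B i))"
      using Am B I fm by (subst lborelP.emeasure_PiM) (auto simp: emeasure_eq_measure2 prod_ennreal)
    also have "emeasure (lborel_pow I) (PiE I A) = ennreal (\<Prod>i\<in>I. measure lborel (A i))"
      using Am I by (subst lborelP.emeasure_PiM) (auto simp: eA prod_ennreal)
    also have "ennreal (\<Prod>i\<in>I. measure lborel (A i \<inter> B i)) / ennreal (\<Prod>i\<in>I. measure lborel (A i))
      = ennreal (\<Prod>i\<in>I. measure lborel (A i \<inter> B i) / measure lborel (A i))"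
      using pos by (subst divide_ennreal) (auto intro!: prod_nonneg prod_pos simp: prod_dividef)
    also have "\<dots> = (\<Prod>i\<in>I. ennreal (measure lborel (A i \<inter> B i) / measure lborel (A i)))"
      by (simp add: prod_ennreal)
    also have "\<dots> = (\<Prod>i\<in>I. emeasure (uniform_measure lborel (A i)) (B i))"
    proof (rule prod.cong[OF refl])
      fix i assume i: "i \<in> I"
      have "emeasure (uniform_measure lborel (A i)) (B i) = emeasure lborel (A i \<inter> B i) / emeasure lborel (A i)"
        using Am B[OF i] by (intro emeasure_uniform_measure) auto
      also have "\<dots> = ennreal (measure lborel (A i \<inter> B i) / measure lborel (A i))"
        using fm[OF i] pos[of i] by (simp add: eA emeasure_eq_measure2 divide_ennreal)
      finally show "ennreal (measure lborel (A i \<inter> B i) / measure lborel (A i)) = emeasure (uniform_measure lborel (A i)) (B i)" by simp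
    qed
    finally show "emeasure (uniform_measure (lborel_pow I) (PiE I A)) (PiE I B) = (\<Prod>i\<in>I. emeasure (uniform_measure lborel (A i)) (B i))" .
  qed
qed

text \<open>The joint law is normalised Lebesgue measure on the product of the bodies. The
  probability is expressed through the complement of \<open>S\<close> because symmetrization
  controls sublevel sets, while the theorem speaks of superlevel events.\<close>

lemma prob_indep_uniform_sample:
  fixes A :: "nat \<Rightarrow> (real ^ 'n) set"
  assumes X: "indep_uniform_sample \<Omega> X N1 K N2 L" and N: "N1 \<ge> 1"
    and K: "K \<in> fmeasurable lborel" "measure lborel K > 0" and L: "L \<in> fmeasurable lborel" "measure lborel L > 0"
    and S: "S \<in> sets (lborel_pow {1..N1 + N2})"
  defines "A \<equiv> (\<lambda>i. if i \<in> {1..N1} then K else L)"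
  shows "measure \<Omega> {w \<in> space \<Omega>. (\<lambda>i\<in>{1..N1 + N2}. X i w) \<in> S} =
    1 - measure (lborel_pow {1..N1 + N2}) ((space (lborel_pow {1..N1 + N2}) - S) \<inter> PiE {1..N1 + N2} A) /
      (\<Prod>i\<in>{1..N1 + N2}. measure lborel (A i))"
proof -
  let ?I = "{1..N1 + N2}" let ?P = "PiM ?I (\<lambda>_. lborel :: (real ^ 'n) measure)"
  interpret prob_space \<Omega> using X by (simp add: indep_uniform_sample_def)
  have rv: "X i \<in> borel_measurable \<Omega>" "distr \<Omega> borel (X i) = uniform_measure lborel (A i)" if "i \<in> ?I" for i
    using X that unfolding indep_uniform_sample_def uniform_rv_def A_def by auto
  have iv: "indep_vars (\<lambda>_. borel) X ?I" using X by (simp add: indep_uniform_sample_def)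
  have "distr \<Omega> (PiM ?I (\<lambda>_. borel)) (\<lambda>w. \<lambda>i\<in>?I. X i w) = PiM ?I (\<lambda>i. distr \<Omega> borel (X i))"
    using iv N rv(1) by (subst (asm) indep_vars_iff_distr_eq_PiM') auto
  also have "\<dots> = PiM ?I (\<lambda>i. uniform_measure lborel (A i))"
    using rv(2) by (intro PiM_cong) auto
  also have "\<dots> = uniform_measure ?P (PiE ?I A)"
    using K L by (intro emeasure_PiM_uniform_measure) (auto simp: A_def)
  finally have D: "distr \<Omega> (PiM ?I (\<lambda>_. borel)) (\<lambda>w. \<lambda>i\<in>?I. X i w) = uniform_measure ?P (PiE ?I A)" .
  have Am: "A i \<in> sets borel" "A i \<in> fmeasurable lborel" for i using K L by (auto simp: A_def fmeasurable_def)
  have sets: "sets (PiM ?I (\<lambda>_. borel :: (real ^ 'n) measure)) = sets ?P" by (intro sets_PiM_cong) auto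
  have m [measurable]: "(\<lambda>w. \<lambda>i\<in>?I. X i w) \<in> \<Omega> \<rightarrow>\<^sub>M PiM ?I (\<lambda>_. borel)"
    using rv(1) by (intro measurable_restrict) auto
  have PA: "PiE ?I A \<in> sets ?P" using Am by (intro sets_PiM_I_finite) auto
  define v where "v = (\<Prod>i\<in>?I. measure lborel (A i))"
  have v: "v > 0" unfolding v_def A_def using K L by (intro prod_pos) auto
  have ePA: "emeasure ?P (PiE ?I A) = ennreal v" unfolding v_def
    using Am by (subst lborelP.emeasure_PiM) (auto simp: emeasure_eq_measure2 prod_ennreal)
  let ?C = "space ?P - S"
  have C: "?C \<in> sets ?P" using S by auto
  have "prob {w \<in> space \<Omega>. (\<lambda>i\<in>?I. X i w) \<in> ?C} = measure (distr \<Omega> (PiM ?I (\<lambda>_. borel)) (\<lambda>w. \<lambda>i\<in>?I. X i w)) ?C"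
    using C sets by (subst measure_distr[OF m]) (auto intro!: arg_cong[where f=prob])
  also have "\<dots> = measure ?P (?C \<inter> PiE ?I A) / v"
  proof -
    have "emeasure ?P (?C \<inter> PiE ?I A) \<le> ennreal v" unfolding ePA[symmetric] by (intro emeasure_mono PA) auto
    then have fin: "emeasure ?P (?C \<inter> PiE ?I A) = ennreal (measure ?P (?C \<inter> PiE ?I A))"
      by (intro emeasure_eq_ennreal_measure) (auto simp: top_unique)
    have "emeasure (uniform_measure ?P (PiE ?I A)) ?C = ennreal (measure ?P (?C \<inter> PiE ?I A) / v)"
      unfolding emeasure_uniform_measure[OF PA C] Int_commute[of _ ?C] ePA fin
      using v by (intro divide_ennreal) auto
    then show ?thesis unfolding D using v by (simp add: measure_def)
  qed
  finally have 1: "prob {w \<in> space \<Omega>. (\<lambda>i\<in>?I. X i w) \<in> ?C} = measure ?P (?C \<inter> PiE ?I A) / v" .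
  have "{w \<in> space \<Omega>. (\<lambda>i\<in>?I. X i w) \<in> S} \<in> events"
    using measurable_sets[OF m, of S] S sets by (simp add: vimage_def Int_def conj_commute)
  moreover have "{w \<in> space \<Omega>. (\<lambda>i\<in>?I. X i w) \<in> ?C} = space \<Omega> - {w \<in> space \<Omega>. (\<lambda>i\<in>?I. X i w) \<in> S}"
    by (auto simp: space_PiM)
  ultimately have "prob {w \<in> space \<Omega>. (\<lambda>i\<in>?I. X i w) \<in> ?C} = 1 - prob {w \<in> space \<Omega>. (\<lambda>i\<in>?I. X i w) \<in> S}"
    by (simp add: prob_compl)
  then show ?thesis using 1 unfolding v_def by simp
qed

context
  fixes K L :: "(real ^ 'n) set" and M :: "(real \<times> real) set" and j N1 N2 :: nat
  assumes K: "cvx_compact K" "measure lborel K > 0" and L: "cvx_compact L" "measure lborel L > 0"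
    and M: "combination_set M" and j: "j \<le> CARD('n)" and N: "N1 \<ge> 1" "N2 \<ge> 1"
begin

definition "sublevel \<alpha> = {x \<in> space (lborel_pow {1..N1 + N2}).
   intrinsic_volume j (hull_comb M {1..N1} {N1 + 1..N1 + N2} (x :: nat \<Rightarrow> real ^ 'n)) \<le> \<alpha>}"

lemma index_sets: "finite {1..N1}" "finite {N1 + 1..N1 + N2}" "{1..N1} \<noteq> {}" "{N1 + 1..N1 + N2} \<noteq> {}"
  "{1..N1} \<union> {N1 + 1..N1 + N2} = {1..N1 + N2}"
  using N by auto

lemma sublevel_sets: "sublevel \<alpha> \<in> sets (lborel_pow {1..N1 + N2})"
  unfolding sublevel_def using borel_measurable_intrinsic_volume_hull_comb[OF M index_sets(1-4) j] unfolding index_sets(5) by measurable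

lemma emeasure_sublevel_le:
  "emeasure (lborel_pow {1..N1 + N2}) (sublevel \<alpha> \<inter> PiE {1..N1 + N2} (\<lambda>i. if i \<in> {1..N1} then K else L))
   \<le> emeasure (lborel_pow {1..N1 + N2}) (sublevel \<alpha> \<inter> PiE {1..N1 + N2} (\<lambda>i. if i \<in> {1..N1} then cball 0 (vol_radius K) else cball 0 (vol_radius L)))"
proof -
  have "emeasure (lborel_pow {1..N1 + N2}) (sublevel \<alpha> \<inter> PiE {1..N1 + N2} (\<lambda>i. if i \<in> {1..N1} then K else L))
   \<le> emeasure (lborel_pow {1..N1 + N2}) (sublevel \<alpha> \<inter> PiE {1..N1 + N2} (\<lambda>i. cball 0 (if i \<in> {1..N1} then vol_radius K else vol_radius L)))"
  proof (rule emeasure_ball_increase[OF _ sublevel_sets])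
    show "steiner_convex {1..N1 + N2} (sublevel \<alpha>)"
      using steiner_convex_sublevel[OF M index_sets(1-4) j] unfolding index_sets(5) sublevel_def .
  qed (use K L vol_radius[OF K(2)] vol_radius[OF L(2)] in auto)
  then show ?thesis by (simp only: if_distrib[of "cball 0"])
qed

lemma sample_event_eq:
  fixes X :: "nat \<Rightarrow> 'w \<Rightarrow> real ^ 'n"
  shows "{w \<in> space \<Omega>. intrinsic_volume j (M_combination M (random_hull X {1..N1} w) (random_hull X {N1 + 1..N1 + N2} w)) > \<alpha>}
    = {w \<in> space \<Omega>. (\<lambda>i\<in>{1..N1 + N2}. X i w) \<in> space (lborel_pow {1..N1 + N2}) - sublevel \<alpha>}"
proof -
  have "hull_comb M {1..N1} {N1 + 1..N1 + N2} (\<lambda>i\<in>{1..N1 + N2}. X i w) = hull_comb M {1..N1} {N1 + 1..N1 + N2} (\<lambda>i. X i w)" for w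
    by (rule hull_comb_cong[OF M index_sets(1-4) j]) auto
  moreover have "(\<lambda>i\<in>{1..N1 + N2}. X i w) \<in> space (lborel_pow {1..N1 + N2})" for w by (simp add: space_PiM)
  ultimately show ?thesis unfolding sublevel_def random_hull_def hull_comb_def by auto
qed

text \<open>Both events are complements of the same sublevel set, and the two products of bodies
  have equal volume by the choice of the radii, so \<open>emeasure_sublevel_le\<close> becomes the
  reversed inequality of probabilities.\<close>

lemma prob_sample_le:
  fixes X :: "nat \<Rightarrow> 'w \<Rightarrow> real ^ 'n" and X' :: "nat \<Rightarrow> 'v \<Rightarrow> real ^ 'n"
  assumes X: "indep_uniform_sample \<Omega> X N1 K N2 L"
    and X': "indep_uniform_sample \<Omega>' X' N1 (cball 0 (vol_radius K)) N2 (cball 0 (vol_radius L))"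
  shows "\<P>(w in \<Omega>'. intrinsic_volume j (M_combination M (random_hull X' {1..N1} w) (random_hull X' {N1 + 1..N1 + N2} w)) > \<alpha>)
    \<le> \<P>(w in \<Omega>. intrinsic_volume j (M_combination M (random_hull X {1..N1} w) (random_hull X {N1 + 1..N1 + N2} w)) > \<alpha>)"
proof -
  let ?I = "{1..N1 + N2}" let ?P = "PiM ?I (\<lambda>_. lborel :: (real ^ 'n) measure)"
  define S where "S = space ?P - sublevel \<alpha>"
  have S: "S \<in> sets ?P" unfolding S_def using sublevel_sets by auto
  have S': "space ?P - S = sublevel \<alpha>" unfolding S_def sublevel_def by auto
  have B: "cball (0 :: real ^ 'n) (vol_radius K) \<in> fmeasurable lborel" "cball (0 :: real ^ 'n) (vol_radius L) \<in> fmeasurable lborel"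
    by (auto intro: fmeasurable_compact)
  define A where "A i = (if i \<in> {1..N1} then K else L)" for i
  define A' where "A' i = (if i \<in> {1..N1} then cball 0 (vol_radius K) else cball (0 :: real ^ 'n) (vol_radius L))" for i
  define v where "v = (\<Prod>i\<in>?I. measure lborel (A i))"
  have v': "v = (\<Prod>i\<in>?I. measure lborel (A' i))" unfolding v_def
    by (intro prod.cong) (auto simp: A_def A'_def vol_radius K L)
  have v: "v > 0" unfolding v_def A_def using K L by (intro prod_pos) auto
  have 1: "measure \<Omega> {w \<in> space \<Omega>. (\<lambda>i\<in>?I. X i w) \<in> S} = 1 - measure ?P (sublevel \<alpha> \<inter> PiE ?I A) / v"
    using prob_indep_uniform_sample[OF X N(1) cvx_compact_fmeasurable[OF K(1)] K(2) cvx_compact_fmeasurable[OF L(1)] L(2) S]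
    unfolding S' v_def A_def .
  have 2: "measure \<Omega>' {w \<in> space \<Omega>'. (\<lambda>i\<in>?I. X' i w) \<in> S} = 1 - measure ?P (sublevel \<alpha> \<inter> PiE ?I A') / v"
    using prob_indep_uniform_sample[OF X' N(1) B(1) _ B(2) _ S] vol_radius[OF K(2)] vol_radius[OF L(2)] K(2) L(2)
    unfolding S' v' A'_def by simp
  have "emeasure ?P (PiE ?I A') < \<infinity>"
    using emeasure_lborel_cball_finite[of "0 :: real ^ 'n" "vol_radius K"] emeasure_lborel_cball_finite[of "0 :: real ^ 'n" "vol_radius L"]
    by (subst lborelP.emeasure_PiM) (auto simp: A'_def less_top[symmetric] ennreal_prod_eq_top)
  moreover have "emeasure ?P (sublevel \<alpha> \<inter> PiE ?I A') \<le> emeasure ?P (PiE ?I A')"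
    by (intro emeasure_mono sets_PiM_I_finite) (auto simp: A'_def)
  ultimately have "emeasure ?P (sublevel \<alpha> \<inter> PiE ?I A') < \<infinity>" by (rule le_less_trans[rotated])
  then have "measure ?P (sublevel \<alpha> \<inter> PiE ?I A) \<le> measure ?P (sublevel \<alpha> \<inter> PiE ?I A')"
    using emeasure_sublevel_le[of \<alpha>] unfolding measure_def A_def A'_def by (intro enn2real_mono) auto
  then show ?thesis unfolding sample_event_eq S_def[symmetric] 1 2 using v by (intro diff_left_mono divide_right_mono) auto
qed

end

section \<open>Points near fine nets, and the inequality for the bodies themselves\<close>

lemma hull_contains_ball:
  fixes x c :: "'i \<Rightarrow> 'a::euclidean_space"
  assumes J: "finite J" "J \<noteq> {}" and net: "cball 0 r \<subseteq> (\<Union>i\<in>J. ball (c i) d)" and r: "r \<ge> 0"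
    and x: "\<And>i. i \<in> J \<Longrightarrow> x i \<in> ball (c i) d"
  shows "cball 0 (r - 2 * d) \<subseteq> convex hull (x ` J)"
proof (rule ball_subset_of_support[OF cvx_compact_hull[OF J]])
  fix u :: 'a assume u: "norm u = 1"
  \<comment> \<open>The boundary point in direction \<open>u\<close> is within \<open>d\<close> of a
    net point and thus within \<open>2 * d\<close> of some \<open>x i\<close>, which bounds the
    support of the hull in direction \<open>u\<close> from below.\<close>
  then have "r *\<^sub>R u \<in> (\<Union>i\<in>J. ball (c i) d)" using r by (intro subsetD[OF net]) simp
  then obtain i where i: "i \<in> J" "dist (c i) (r *\<^sub>R u) < d" by auto
  have "norm (x i - r *\<^sub>R u) \<le> 2 * d"
    using dist_triangle[of "x i" "r *\<^sub>R u" "c i"] i x[OF i(1)] by (simp add: dist_norm norm_minus_commute)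
  moreover have "\<bar>(x i - r *\<^sub>R u) \<bullet> u\<bar> \<le> norm (x i - r *\<^sub>R u) * norm u" by (rule Cauchy_Schwarz_ineq2)
  moreover have "(x i - r *\<^sub>R u) \<bullet> u = x i \<bullet> u - r" using u by (simp add: inner_diff_left norm_eq_1)
  ultimately have "r - 2 * d \<le> x i \<bullet> u" using u by simp
  then show "\<exists>z\<in>convex hull (x ` J). r - 2 * d \<le> z \<bullet> u" using i by (intro bexI[of _ "x i"]) (auto intro: hull_inc)
qed

lemma ball_net:
  assumes "d > 0" "r \<ge> 0"
  shows "\<exists>P. finite P \<and> P \<noteq> {} \<and> P \<subseteq> cball (0::'a::euclidean_space) r \<and> cball 0 r \<subseteq> (\<Union>p\<in>P. ball p d)"
proof -
  have "cball (0::'a) r \<subseteq> (\<Union>x\<in>cball 0 r. ball x d)" using assms by auto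
  then obtain P where P: "P \<subseteq> cball 0 r" "finite P" "cball (0::'a) r \<subseteq> (\<Union>x\<in>P. ball x d)"
    by (rule compactE_image[OF compact_cball open_ball])
  moreover have "P \<noteq> {}" using P(3) assms(2) by auto
  ultimately show ?thesis by blast
qed

text \<open>A net point may lie on the boundary sphere, so a small ball is placed around a nearby
  interior point.\<close>

lemma measure_ball_Int_cball_pos:
  fixes c :: "'a::euclidean_space"
  assumes "d > 0" "r > 0" "c \<in> cball 0 r"
  shows "measure lborel (ball c d \<inter> cball 0 r) > 0"
proof -
  have "c \<in> closure (ball 0 r)" using assms by simp
  then obtain y where "y \<in> ball 0 r" "dist y c < d" using assms(1) unfolding closure_approachable by blast
  then have "y \<in> ball c d \<inter> ball 0 r" by (simp add: dist_commute)
  moreover have "open (ball c d \<inter> ball 0 r)" by auto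
  ultimately obtain e where e: "e > 0" "ball y e \<subseteq> ball c d \<inter> ball 0 r" using open_contains_ball by blast
  have "0 < measure lborel (ball y e)" using e by (subst content_ball) auto
  also have "\<dots> \<le> measure lborel (ball c d \<inter> cball 0 r)"
  proof (rule measure_mono_fmeasurable)
    show "ball y e \<subseteq> ball c d \<inter> cball 0 r" using e by auto
    show "ball c d \<inter> cball 0 r \<in> fmeasurable lborel"
      by (rule fmeasurableI2[OF fmeasurable_compact[OF compact_cball[of 0 r]]]) auto
  qed simp
  finally show ?thesis .
qed

text \<open>The argument runs with Lebesgue measure on tuples, without a sample. All tuples from
  \<open>K\<close> and \<open>L\<close> lie in the sublevel set of \<alpha>, which by
  \<open>emeasure_sublevel_le\<close> must then fill the product of the balls up to measure 0; but
  the box \<open>D\<close> of tuples near the nets has positive measure and misses it.\<close>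

lemma M_combination_ball_le:
  fixes K L :: "(real ^ 'n) set"
  assumes K: "cvx_compact K" "measure lborel K > 0" and L: "cvx_compact L" "measure lborel L > 0"
    and M: "combination_set M" and j: "j \<le> CARD('n)"
  shows "intrinsic_volume j (M_combination M (cball (0 :: real ^ 'n) (vol_radius K)) (cball 0 (vol_radius L)))
    \<le> intrinsic_volume j (M_combination M K L)"
proof (rule ccontr)
  define r where "r = vol_radius K" define q where "q = vol_radius L"
  have r: "r > 0" "measure lborel (cball (0 :: real ^ 'n) r) = measure lborel K" and q: "q > 0" "measure lborel (cball (0 :: real ^ 'n) q) = measure lborel L"
    using vol_radius[OF K(2)] vol_radius[OF L(2)] by (auto simp: r_def q_def)
  define B where "B = M_combination M (cball (0 :: real ^ 'n) r) (cball 0 q)"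
  have cB: "cvx_compact B" unfolding B_def using r q by (intro cvx_compact_M_combination M cvx_compact_cball) auto
  define \<alpha> where "\<alpha> = intrinsic_volume j (M_combination M K L)"
  assume "\<not> ?thesis"
  then have lt: "\<alpha> < intrinsic_volume j B" by (simp add: \<alpha>_def B_def r_def q_def)
  \<comment> \<open>Homogeneity of degree \<open>j\<close> leaves room for a factor
    \<open>t < 1\<close>: the intrinsic volume of \<open>B\<close> shrunk by \<open>t\<close> still
    exceeds \<alpha>.\<close>
  have "((\<lambda>t. t ^ j * intrinsic_volume j B) \<longlongrightarrow> 1 ^ j * intrinsic_volume j B) (at_left (1::real))"
    by (intro tendsto_intros)
  then have "\<forall>\<^sub>F t in at_left (1::real). \<alpha> < t ^ j * intrinsic_volume j B" using lt by (intro order_tendstoD) auto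
  moreover have "\<forall>\<^sub>F t in at_left (1::real). t \<in> {0<..<1}" by (rule eventually_at_leftI[of 0]) auto
  ultimately have "\<forall>\<^sub>F t in at_left (1::real). \<alpha> < t ^ j * intrinsic_volume j B \<and> t \<in> {0<..<1}"
    by (rule eventually_conj)
  then obtain t where t: "\<alpha> < t ^ j * intrinsic_volume j B" "0 < t" "t < 1"
    using eventually_happens trivial_limit_at_left_real by fastforce
  \<comment> \<open>Makes the radii \<open>r - 2 * d\<close> and \<open>q - 2 * d\<close> that
    \<open>hull_contains_ball\<close> guarantees at least \<open>t * r\<close> and
    \<open>t * q\<close>.\<close>
  define d where "d = (1 - t) * min r q / 2"
  have d: "d > 0" using t r q by (simp add: d_def)
  have "2 * d \<le> (1 - t) * r" "2 * d \<le> (1 - t) * q" using t by (auto simp: d_def intro!: mult_left_mono)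
  then have tr: "t * r \<le> r - 2 * d" "t * q \<le> q - 2 * d" by (auto simp: algebra_simps)
  obtain P1 where P1: "finite P1" "P1 \<noteq> {}" "P1 \<subseteq> cball (0 :: real ^ 'n) r" "cball 0 r \<subseteq> (\<Union>p\<in>P1. ball p d)"
    using ball_net[of d r] d r by auto
  obtain P2 where P2: "finite P2" "P2 \<noteq> {}" "P2 \<subseteq> cball (0 :: real ^ 'n) q" "cball 0 q \<subseteq> (\<Union>p\<in>P2. ball p d)"
    using ball_net[of d q] d q by auto
  define N1 where "N1 = card P1" define N2 where "N2 = card P2"
  have N: "N1 \<ge> 1" "N2 \<ge> 1" using P1 P2 by (auto simp: N1_def N2_def Suc_le_eq card_gt_0_iff)
  obtain f where f: "bij_betw f {1..N1} P1" using ex_bij_betw_nat_finite_1[OF P1(1)] N1_def by auto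
  obtain g where g: "bij_betw g {1..N2} P2" using ex_bij_betw_nat_finite_1[OF P2(1)] N2_def by auto
  define c where "c i = (if i \<in> {1..N1} then f i else g (i - N1))" for i
  have c1: "c ` {1..N1} = P1" using f unfolding c_def bij_betw_def by auto
  have c2: "c ` {N1 + 1..N1 + N2} = P2"
  proof -
    have "c ` {N1 + 1..N1 + N2} = g ` (\<lambda>i. i - N1) ` {N1 + 1..N1 + N2}" unfolding image_image by (intro image_cong) (auto simp: c_def)
    also have "(\<lambda>i. i - N1) ` {N1 + 1..N1 + N2} = {1..N2}"
    proof (intro equalityI subsetI)
      fix i assume "i \<in> {1..N2}"
      then show "i \<in> (\<lambda>i. i - N1) ` {N1 + 1..N1 + N2}" by (intro image_eqI[of _ _ "i + N1"]) auto
    qed auto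
    finally show ?thesis using g by (simp add: bij_betw_def)
  qed
  let ?I = "{1..N1 + N2}" let ?P = "PiM ?I (\<lambda>_. lborel :: (real ^ 'n) measure)"
  note index_sets = index_sets[OF K L M j N]
  let ?S = "sublevel M j N1 N2 \<alpha>"
  define A where "A i = (if i \<in> {1..N1} then K else L)" for i
  define A' where "A' i = (if i \<in> {1..N1} then cball 0 r else cball (0 :: real ^ 'n) q)" for i
  define D where "D i = ball (c i) d \<inter> A' i" for i
  have fmA: "A i \<in> fmeasurable lborel" "A' i \<in> fmeasurable lborel" for i
    using K L by (auto simp: A_def A'_def cvx_compact_fmeasurable fmeasurable_compact)
  have fmD: "D i \<in> fmeasurable lborel" for i
  proof (rule fmeasurableI2[OF fmA(2)[of i]])
    show "D i \<in> sets lborel" unfolding D_def using fmeasurableD[OF fmA(2)[of i]] by (intro sets.Int) simp_all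
  qed (simp add: D_def)
  have sets: "PiE ?I A \<in> sets ?P" "PiE ?I A' \<in> sets ?P" "PiE ?I D \<in> sets ?P"
    using fmA fmD by (auto intro!: sets_PiM_I_finite fmeasurableD)
  have box: "emeasure ?P (PiE ?I C) = ennreal (\<Prod>i\<in>?I. measure lborel (C i))"
    if "\<And>i. C i \<in> fmeasurable lborel" for C :: "nat \<Rightarrow> (real ^ 'n) set"
  proof -
    have "emeasure ?P (PiE ?I C) = (\<Prod>i\<in>?I. emeasure lborel (C i))"
      using that by (intro lborelP.emeasure_PiM fmeasurableD) auto
    also have "\<dots> = (\<Prod>i\<in>?I. ennreal (measure lborel (C i)))"
      using that by (intro prod.cong refl emeasure_eq_measure2)
    finally show ?thesis by (simp only: prod_ennreal measure_nonneg)
  qed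
  note vol = box[of A, OF fmA(1)] box[of A', OF fmA(2)] box[of D, OF fmD]
  have eq: "(\<Prod>i\<in>?I. measure lborel (A i)) = (\<Prod>i\<in>?I. measure lborel (A' i))"
    by (intro prod.cong) (auto simp: A_def A'_def r q)
  have inS: "PiE ?I A \<subseteq> ?S"
  proof
    fix x assume x: "x \<in> PiE ?I A"
    have xA: "x i \<in> A i" if "i \<in> ?I" for i using PiE_mem[OF x that] .
    have "x i \<in> K" if "i \<in> {1..N1}" for i using xA[of i] that by (simp add: A_def)
    moreover have "x i \<in> L" if "i \<in> {N1 + 1..N1 + N2}" for i using xA[of i] that by (simp add: A_def)
    ultimately have "x ` {1..N1} \<subseteq> K" "x ` {N1 + 1..N1 + N2} \<subseteq> L" by blast+
    then have "convex hull (x ` {1..N1}) \<subseteq> K" "convex hull (x ` {N1 + 1..N1 + N2}) \<subseteq> L"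
      using K(1) L(1) unfolding cvx_compact_def by (simp_all add: hull_minimal)
    then have "hull_comb M {1..N1} {N1 + 1..N1 + N2} x \<subseteq> M_combination M K L" unfolding hull_comb_def by (rule M_combination_mono)
    then have "intrinsic_volume j (hull_comb M {1..N1} {N1 + 1..N1 + N2} x) \<le> \<alpha>"
      unfolding \<alpha>_def using K L by (intro intrinsic_volume_mono cvx_compact_hull_comb[OF M index_sets(1-4) j] cvx_compact_M_combination M j) auto
    then show "x \<in> ?S" using x unfolding sublevel_def[OF K L M j N] by (auto simp: space_PiM PiE_iff)
  qed
  have outS: "PiE ?I D \<inter> ?S = {}"
  proof -
    have "x \<notin> ?S" if x: "x \<in> PiE ?I D" for x
    proof -
      have xi: "x i \<in> ball (c i) d" if "i \<in> ?I" for i using x that by (auto simp: D_def PiE_iff)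
      have "cball 0 (r - 2 * d) \<subseteq> convex hull (x ` {1..N1})"
        using P1(4) r xi unfolding c1[symmetric] by (intro hull_contains_ball[where c=c] index_sets) auto
      moreover have "cball 0 (q - 2 * d) \<subseteq> convex hull (x ` {N1 + 1..N1 + N2})"
        using P2(4) q xi unfolding c2[symmetric] by (intro hull_contains_ball[where c=c] index_sets) auto
      moreover have "cball (0 :: real ^ 'n) (t * r) \<subseteq> cball 0 (r - 2 * d)" "cball (0 :: real ^ 'n) (t * q) \<subseteq> cball 0 (q - 2 * d)"
        using tr by (auto intro!: subset_cball)
      ultimately have "M_combination M (cball 0 (t * r)) (cball 0 (t * q)) \<subseteq> hull_comb M {1..N1} {N1 + 1..N1 + N2} x"
        unfolding hull_comb_def by (intro M_combination_mono) auto
      moreover have "M_combination M (cball 0 (t * r)) (cball (0 :: real ^ 'n) (t * q)) = (*\<^sub>R) t ` B"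
        unfolding B_def using t r q
        by (subst M_combination_linear_image[symmetric]) (auto simp: scaleR_cball intro: linear_scale_self)
      ultimately have "intrinsic_volume j ((*\<^sub>R) t ` B) \<le> intrinsic_volume j (hull_comb M {1..N1} {N1 + 1..N1 + N2} x)"
        by (intro intrinsic_volume_mono cvx_compact_hull_comb[OF M index_sets(1-4) j] cvx_compact_scaleR cB j) auto
      then have "\<alpha> < intrinsic_volume j (hull_comb M {1..N1} {N1 + 1..N1 + N2} x)"
        using t intrinsic_volume_scaleR[OF t(2) cB j] by simp
      then show ?thesis unfolding sublevel_def[OF K L M j N] by simp
    qed
    then show ?thesis by blast
  qed
  have DA: "PiE ?I D \<subseteq> PiE ?I A'" by (auto simp: D_def PiE_iff)
  have Ss: "?S \<in> sets ?P" using sublevel_sets[OF K L M j N] .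
  have "ennreal (\<Prod>i\<in>?I. measure lborel (A' i)) = emeasure ?P (?S \<inter> PiE ?I A)"
    unfolding Int_absorb1[OF inS] vol(1) eq ..
  also have "\<dots> \<le> emeasure ?P (?S \<inter> PiE ?I A')"
    using emeasure_sublevel_le[OF K L M j N, of \<alpha>] unfolding A_def A'_def r_def q_def .
  finally have "ennreal (\<Prod>i\<in>?I. measure lborel (A' i)) + ennreal (\<Prod>i\<in>?I. measure lborel (D i)) \<le>
    emeasure ?P (?S \<inter> PiE ?I A') + emeasure ?P (PiE ?I D)" unfolding vol(3) by (intro add_mono) auto
  also have "\<dots> = emeasure ?P ((?S \<inter> PiE ?I A') \<union> PiE ?I D)"
    using outS sets Ss by (intro plus_emeasure) auto
  also have "\<dots> \<le> emeasure ?P (PiE ?I A')" using DA sets by (intro emeasure_mono) auto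
  finally have "ennreal ((\<Prod>i\<in>?I. measure lborel (A' i)) + (\<Prod>i\<in>?I. measure lborel (D i))) \<le> ennreal (\<Prod>i\<in>?I. measure lborel (A' i))"
    unfolding vol(2) by (subst ennreal_plus) (auto intro: prod_nonneg)
  then have "(\<Prod>i\<in>?I. measure lborel (D i)) \<le> 0" by (subst (asm) ennreal_le_iff) (auto intro: prod_nonneg)
  moreover have "(\<Prod>i\<in>?I. measure lborel (D i)) > 0"
  proof (rule prod_pos)
    fix i assume i: "i \<in> ?I"
    show "measure lborel (D i) > 0"
    proof (cases "i \<in> {1..N1}")
      case True
      then have "c i \<in> cball 0 r" using c1 P1 by blast
      then show ?thesis unfolding D_def A'_def if_P[OF True] by (rule measure_ball_Int_cball_pos[OF d r(1)])
    next
      case False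
      then have "c i \<in> cball 0 q" using c2 P2 i by (metis index_sets(5) UnE image_eqI subsetD)
      then show ?thesis unfolding D_def A'_def if_not_P[OF False] by (rule measure_ball_Int_cball_pos[OF d q(1)])
    qed
  qed
  ultimately show False by simp
qed

lemma intrinsic_volume_empty: "intrinsic_volume j ({} :: (real ^ 'n) set) = 0"
proof -
  have "steiner_coeffs ({} :: (real ^ 'n) set) (\<lambda>_. 0)" unfolding steiner_coeffs_def set_plus_def by simp
  then have "The (steiner_coeffs ({} :: (real ^ 'n) set)) = (\<lambda>_. 0)" using steiner_coeffs_unique by blast
  then show ?thesis by (simp add: intrinsic_volume_def)
qed

theorem mainTheorem4:
  fixes K L :: "(real ^ 'n) set" and M :: "(real \<times> real) set" and j :: nat
  assumes "convex_body K" and "convex_body L"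
    and "compact M" and "convex M" and "M \<subseteq> {0..} \<times> {0..}"
    and "1 \<le> j" and "j \<le> CARD('n)"
  shows "(\<forall>(N1 :: nat) (N2 :: nat)
            (\<Omega> :: 'w measure) (X :: nat \<Rightarrow> 'w \<Rightarrow> real ^ 'n)
            (\<Omega>' :: 'v measure) (X' :: nat \<Rightarrow> 'v \<Rightarrow> real ^ 'n).
            N1 \<ge> 1 \<and> N2 \<ge> 1 \<and>
            indep_uniform_sample \<Omega> X N1 K N2 L \<and>
            indep_uniform_sample \<Omega>' X' N1 (cball 0 (vol_radius K)) N2 (cball 0 (vol_radius L)) \<longrightarrow>
            (\<forall>\<alpha>>0.
              \<P>(w in \<Omega>. intrinsic_volume j (M_combination M
                  (random_hull X {1..N1} w) (random_hull X {N1 + 1..N1 + N2} w)) > \<alpha>)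
              \<ge> \<P>(w in \<Omega>'. intrinsic_volume j (M_combination M
                  (random_hull X' {1..N1} w) (random_hull X' {N1 + 1..N1 + N2} w)) > \<alpha>))) \<and>
         intrinsic_volume j (M_combination M K L)
           \<ge> intrinsic_volume j (M_combination M
                (cball (0 :: real ^ 'n) (vol_radius K)) (cball (0 :: real ^ 'n) (vol_radius L)))"
proof (cases "M = {}")
  case True
  \<comment> \<open>All combinations are empty and have intrinsic volume 0, so both events are
    impossible for \<alpha> > 0 and the second claim is an equality.\<close>
  then have "M_combination M A B = {}" for A B :: "(real ^ 'n) set" by (simp add: M_combination_def)
  then show ?thesis by (simp add: intrinsic_volume_empty)
next
  case False
  have M: "combination_set M" using assms False by (simp add: combination_set_def)
  have K: "cvx_compact K" "measure lborel K > 0" and L: "cvx_compact L" "measure lborel L > 0"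
    using assms(1,2) interior_subset by (auto simp: convex_body_def cvx_compact_def measure_pos_of_interior)
  show ?thesis
    using prob_sample_le[OF K L M assms(7)] M_combination_ball_le[OF K L M assms(7)] by blast
qed

end
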